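(* Let $G$ be a compact and connected Abelian group whose character group $X$ is equipped with a fixed total order compatible with the group structure. Let $(\Omega,\mu)$ be a measure space, $A:\Omega\to\mathrm{Aut}(G)$ a measurable map with $A(u)\in\mathrm{Aut}(G)^+$ for $\mu$-a.e. $u\in\Omega$, and $\Phi$ a real-valued locally $\mu$-integrable function on $\Omega$. The Hausdorff operator $\mathcal{H}_{\Phi,A}$ is bounded on the real Hardy space $H^1_{\mathbb{R}}(G)$ if and only if $\Phi\in L^1(\mu)$. Moreover, in this case $$\|\mathcal{H}_{\Phi,A}\|_{\mathcal{L}(H^1_{\mathbb{R}}(G))}\le\|\Phi\|_{L^1(\mu)}.$$
   Context: $G$ carries its normalized Haar measure $\nu$. $X$ is the (discrete, multiplicatively written) group of continuous characters of $G$ with unit character $\mathbf 1$, and $X_+=\{\chi\in X:\chi\ge\mathbf 1\}$. $\mathrm{Aut}(G)$ is the group of topological automorphisms of $G$ with its natural topology. For $A\in\mathrm{Aut}(G)$, $A^*\in\mathrm{Aut}(X)$ is $A^*(\chi)=\chi\circ A$. $\mathrm{Aut}_+(X)$ is the set of $\tau\in\mathrm{Aut}(X)$ with $\tau(X_+)\subset X_+$, and $\mathrm{Aut}(G)^+=\{A\in\mathrm{Aut}(G):A^*\in\mathrm{Aut}_+(X)\}$. $P_+$ is the orthogonal projection of $L^2(G)$ onto the closed span of $X_+$, and $P_-=I-P_+$. $\mathrm{Pol}(G,\mathbb{R})$ is the space of real-valued trigonometric polynomials (finite linear combinations of characters) on $G$. The real Hardy space $H^1_{\mathbb{R}}(G)$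 is the completion of $\mathrm{Pol}(G,\mathbb{R})$ with respect to the norm $\|q\|_{1\ast}=\|P_-q\|_1+\|P_+q\|_1$, with $\|\cdot\|_{1\ast}$ also denoting the norm of the completion. It is known that $H^1_{\mathbb{R}}(G)$ embeds continuously in $L^1(G,\mathbb{R})$ and, as a set of functions, equals $\{\mathrm{Re} f:f\in H^1(G)\}$, where $H^1(G)=\{f\in L^1(G):\int_G f\overline\chi\,d\nu=0\ \forall\chi\in X\setminus X_+\}$. Hausdorff operator: $(\mathcal{H}_{\Phi,A}f)(x)=\int_\Omega\Phi(u)f(A(u)(x))\,d\mu(u)$. That it is bounded on a normed space $Y$ of functions on $G$ means that for each $f\in Y$ the (Lebesgue) integral exists for $\nu$-a.e. $x$ and defines an element of $Y$, and the resulting linear map $Y\to Y$ is bounded. $\mathcal{L}(Y)$ is the space of bounded linear operators on $Y$ with the operator norm.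
   Formalization: For non-metrizable G, (u,x) ↦ A(u)(x) is also assumed jointly measurable modulo null sets over sets of finite μ-measure; without this the claim can fail (if a real-valued measurable cardinal exists), and otherwise it is automatic. *)

theory Defs
  imports "HOL-Analysis.Analysis" "HOL-Probability.Probability_Measure"
begin

definition characters :: "('g::topological_ab_group_add \<Rightarrow> complex) set" where
  "characters = {\<theta>. continuous_on UNIV \<theta> \<and> (\<forall>x. cmod (\<theta> x) = 1) \<and>
                    (\<forall>x y. \<theta> (x + y) = \<theta> x * \<theta> y)}"

definition group_order ::
    "(('g::topological_ab_group_add \<Rightarrow> complex) \<times> ('g \<Rightarrow> complex)) set \<Rightarrow> bool" where
  "group_order r \<longleftrightarrow> linear_order_on characters r \<and>
     (\<forall>\<theta>\<in>characters. \<forall>\<psi>\<in>characters. \<forall>\<xi>\<in>characters.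
        (\<theta>, \<psi>) \<in> r \<longrightarrow> ((\<lambda>x. \<theta> x * \<xi> x), (\<lambda>x. \<psi> x * \<xi> x)) \<in> r)"

definition characters_plus ::
    "(('g::topological_ab_group_add \<Rightarrow> complex) \<times> ('g \<Rightarrow> complex)) set \<Rightarrow> ('g \<Rightarrow> complex) set" where
  "characters_plus r = {\<theta> \<in> characters. ((\<lambda>_. 1), \<theta>) \<in> r}"

definition group_aut :: "('g::topological_ab_group_add \<Rightarrow> 'g) set" where
  "group_aut = {A. bij A \<and> (\<forall>x y. A (x + y) = A x + A y) \<and>
                   continuous_on UNIV A \<and> continuous_on UNIV (inv A)}"

text \<open>
  The compact-open topology. For compact groups it is the usual (Braconnier) topology, which also
  controls inverses: the condition that the inverse of \<open>A\<close> maps \<open>K\<close> into \<open>U\<close> says that \<open>A\<close>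
  maps the compact set \<open>- U\<close> into the open set \<open>- K\<close>.
\<close>

definition group_aut_topology :: "('g::topological_ab_group_add \<Rightarrow> 'g) topology" where
  "group_aut_topology =
     topology_generated_by {{A \<in> group_aut. A ` K \<subseteq> U} | K U. compact K \<and> open U}"

definition group_aut_borel :: "('g::topological_ab_group_add \<Rightarrow> 'g) measure" where
  "group_aut_borel = sigma group_aut {V. openin group_aut_topology V}"

definition dual_aut ::
    "(('g::topological_ab_group_add \<Rightarrow> complex) \<Rightarrow> ('g \<Rightarrow> complex)) set" where
  "dual_aut = {\<tau>. bij_betw \<tau> characters characters \<and>
     (\<forall>\<theta>\<in>characters. \<forall>\<psi>\<in>characters. \<tau> (\<lambda>x. \<theta> x * \<psi> x) = (\<lambda>x. \<tau> \<theta> x * \<tau> \<psi> x))}"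

definition dual_aut_plus ::
    "(('g::topological_ab_group_add \<Rightarrow> complex) \<times> ('g \<Rightarrow> complex)) set
       \<Rightarrow> (('g \<Rightarrow> complex) \<Rightarrow> ('g \<Rightarrow> complex)) set" where
  "dual_aut_plus r = {\<tau> \<in> dual_aut. \<tau> ` characters_plus r \<subseteq> characters_plus r}"

definition adjoint_aut :: "('g \<Rightarrow> 'g) \<Rightarrow> ('g \<Rightarrow> complex) \<Rightarrow> ('g \<Rightarrow> complex)" where
  "adjoint_aut A \<theta> = \<theta> \<circ> A"

definition group_aut_plus ::
    "(('g::topological_ab_group_add \<Rightarrow> complex) \<times> ('g \<Rightarrow> complex)) set \<Rightarrow> ('g \<Rightarrow> 'g) set" where
  "group_aut_plus r = {A \<in> group_aut. adjoint_aut A \<in> dual_aut_plus r}"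

text \<open>Regularity is part of the definition, since the group need not be metrizable.\<close>

definition normalized_haar :: "'g::topological_ab_group_add measure \<Rightarrow> bool" where
  "normalized_haar \<nu> \<longleftrightarrow> sets \<nu> = sets borel \<and> prob_space \<nu> \<and>
     (\<forall>a. distr \<nu> borel (\<lambda>x. a + x) = \<nu>) \<and>
     (\<forall>B\<in>sets borel. emeasure \<nu> B = (INF U\<in>{U. open U \<and> B \<subseteq> U}. emeasure \<nu> U)) \<and>
     (\<forall>U. open U \<longrightarrow> emeasure \<nu> U = (SUP K\<in>{K. compact K \<and> K \<subseteq> U}. emeasure \<nu> K))"

definition trig_span :: "('g \<Rightarrow> complex) set \<Rightarrow> ('g \<Rightarrow> complex) set" where
  "trig_span S = {(\<lambda>x. \<Sum>\<theta>\<in>F. c \<theta> * \<theta> x) | F c. finite F \<and> F \<subseteq> S}"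

definition L2_functions :: "'g::topological_space measure \<Rightarrow> ('g \<Rightarrow> complex) set" where
  "L2_functions \<nu> = {f \<in> borel_measurable \<nu>. integrable \<nu> (\<lambda>x. (cmod (f x))\<^sup>2)}"

definition L2_closed_span ::
    "'g::topological_space measure \<Rightarrow> ('g \<Rightarrow> complex) set \<Rightarrow> ('g \<Rightarrow> complex) set" where
  "L2_closed_span \<nu> S = {f \<in> L2_functions \<nu>.
     \<forall>\<epsilon>>0. \<exists>p\<in>trig_span S. sqrt (\<integral>x. (cmod (f x - p x))\<^sup>2 \<partial>\<nu>) < \<epsilon>}"

text \<open>
  Elements of \<open>L\<^sup>p\<close> are represented by Borel functions. The chosen representative of the
  orthogonal projection is unique up to null sets, and it only enters through its \<open>L\<^sup>1\<close> norm.
\<close>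

definition proj_plus ::
    "'g::topological_ab_group_add measure \<Rightarrow> (('g \<Rightarrow> complex) \<times> ('g \<Rightarrow> complex)) set
       \<Rightarrow> ('g \<Rightarrow> complex) \<Rightarrow> ('g \<Rightarrow> complex)" where
  "proj_plus \<nu> r f = (SOME g. g \<in> L2_closed_span \<nu> (characters_plus r) \<and>
     (\<forall>h\<in>L2_closed_span \<nu> (characters_plus r). (\<integral>x. (f x - g x) * cnj (h x) \<partial>\<nu>) = 0))"

definition proj_minus ::
    "'g::topological_ab_group_add measure \<Rightarrow> (('g \<Rightarrow> complex) \<times> ('g \<Rightarrow> complex)) set
       \<Rightarrow> ('g \<Rightarrow> complex) \<Rightarrow> ('g \<Rightarrow> complex)" where
  "proj_minus \<nu> r f = (\<lambda>x. f x - proj_plus \<nu> r f x)"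

definition real_pol :: "('g::topological_ab_group_add \<Rightarrow> real) set" where
  "real_pol = {q. (\<lambda>x. complex_of_real (q x)) \<in> trig_span characters}"

definition norm_1star ::
    "'g::topological_ab_group_add measure \<Rightarrow> (('g \<Rightarrow> complex) \<times> ('g \<Rightarrow> complex)) set
       \<Rightarrow> ('g \<Rightarrow> real) \<Rightarrow> real" where
  "norm_1star \<nu> r q =
     (\<integral>x. cmod (proj_minus \<nu> r (\<lambda>y. complex_of_real (q y)) x) \<partial>\<nu>) +
     (\<integral>x. cmod (proj_plus \<nu> r (\<lambda>y. complex_of_real (q y)) x) \<partial>\<nu>)"

text \<open>
  The completion of the real polynomials is realised inside \<open>L\<^sup>1\<close> through its continuous
  embedding: a Cauchy sequence of polynomials represents its \<open>L\<^sup>1\<close> limit, and the norm of that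
  limit is the limit of the norms.
\<close>

definition hardy_approx ::
    "'g::topological_ab_group_add measure \<Rightarrow> (('g \<Rightarrow> complex) \<times> ('g \<Rightarrow> complex)) set
       \<Rightarrow> (nat \<Rightarrow> 'g \<Rightarrow> real) \<Rightarrow> ('g \<Rightarrow> real) \<Rightarrow> bool" where
  "hardy_approx \<nu> r q f \<longleftrightarrow> (\<forall>n. q n \<in> real_pol) \<and>
     (\<forall>\<epsilon>>0. \<exists>N. \<forall>m\<ge>N. \<forall>n\<ge>N. norm_1star \<nu> r (\<lambda>x. q m x - q n x) < \<epsilon>) \<and>
     (\<lambda>n. \<integral>x. \<bar>q n x - f x\<bar> \<partial>\<nu>) \<longlonglongrightarrow> 0"

definition real_hardy ::
    "'g::topological_ab_group_add measure \<Rightarrow> (('g \<Rightarrow> complex) \<times> ('g \<Rightarrow> complex)) set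
       \<Rightarrow> ('g \<Rightarrow> real) set" where
  "real_hardy \<nu> r = {f. integrable \<nu> f \<and> (\<exists>q. hardy_approx \<nu> r q f)}"

definition real_hardy_norm ::
    "'g::topological_ab_group_add measure \<Rightarrow> (('g \<Rightarrow> complex) \<times> ('g \<Rightarrow> complex)) set
       \<Rightarrow> ('g \<Rightarrow> real) \<Rightarrow> real" where
  "real_hardy_norm \<nu> r f =
     (THE l. \<exists>q. hardy_approx \<nu> r q f \<and> (\<lambda>n. norm_1star \<nu> r (q n)) \<longlonglongrightarrow> l)"

text \<open>A measure space carries no topology, so local means on sets of finite measure.\<close>

definition locally_integrable :: "'w measure \<Rightarrow> ('w \<Rightarrow> real) \<Rightarrow> bool" where
  "locally_integrable \<mu> \<Phi> \<longleftrightarrow> \<Phi> \<in> borel_measurable \<mu> \<and>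
     (\<forall>S\<in>sets \<mu>. emeasure \<mu> S < \<infinity> \<longrightarrow> set_integrable \<mu> S \<Phi>)"

definition hausdorff_op ::
    "'w measure \<Rightarrow> ('w \<Rightarrow> real) \<Rightarrow> ('w \<Rightarrow> 'g \<Rightarrow> 'g) \<Rightarrow> ('g \<Rightarrow> real) \<Rightarrow> 'g \<Rightarrow> real" where
  "hausdorff_op \<mu> \<Phi> A f x = (\<integral>u. \<Phi> u * f (A u x) \<partial>\<mu>)"

text \<open>
  Functions are Borel representatives of classes modulo null sets. The bound below, applied to
  differences of representatives, makes the operator well defined on classes.
\<close>

definition hausdorff_bounded ::
    "'g::topological_ab_group_add measure \<Rightarrow> (('g \<Rightarrow> complex) \<times> ('g \<Rightarrow> complex)) set
       \<Rightarrow> 'w measure \<Rightarrow> ('w \<Rightarrow> real) \<Rightarrow> ('w \<Rightarrow> 'g \<Rightarrow> 'g) \<Rightarrow> bool" where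
  "hausdorff_bounded \<nu> r \<mu> \<Phi> A \<longleftrightarrow>
     (\<forall>f\<in>real_hardy \<nu> r.
        (AE x in \<nu>. integrable \<mu> (\<lambda>u. \<Phi> u * f (A u x))) \<and>
        (\<exists>g\<in>real_hardy \<nu> r. AE x in \<nu>. hausdorff_op \<mu> \<Phi> A f x = g x)) \<and>
     (\<exists>C. \<forall>f\<in>real_hardy \<nu> r. \<forall>g\<in>real_hardy \<nu> r.
        (AE x in \<nu>. hausdorff_op \<mu> \<Phi> A f x = g x) \<longrightarrow>
        real_hardy_norm \<nu> r g \<le> C * real_hardy_norm \<nu> r f)"

definition hausdorff_norm ::
    "'g::topological_ab_group_add measure \<Rightarrow> (('g \<Rightarrow> complex) \<times> ('g \<Rightarrow> complex)) set
       \<Rightarrow> 'w measure \<Rightarrow> ('w \<Rightarrow> real) \<Rightarrow> ('w \<Rightarrow> 'g \<Rightarrow> 'g) \<Rightarrow> real" where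
  "hausdorff_norm \<nu> r \<mu> \<Phi> A =
     Sup {real_hardy_norm \<nu> r g | f g. f \<in> real_hardy \<nu> r \<and> real_hardy_norm \<nu> r f \<le> 1 \<and>
            g \<in> real_hardy \<nu> r \<and> (AE x in \<nu>. hausdorff_op \<mu> \<Phi> A f x = g x)}"

text \<open>
  Joint measurability of \<open>(u, x) \<mapsto> A u x\<close>, up to null sets and over sets of finite measure, as
  needed for Fubini's theorem. If the compact group has a countable base, this follows from Borel
  measurability of \<open>A\<close>. Otherwise the product of the Borel sigma-algebras can be strictly
  smaller than the Borel sigma-algebra of the product, and Borel measurability of \<open>A\<close> need not
  suffice. Example: suppose there is an atomless probability measure \<open>\<mu>\<close> on all subsets of a
  Hamel basis of positive reals (a real-valued measurable continuum gives one), let the character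
  group be the reals with their usual order and the discrete topology, let \<open>A u\<close> be dual to
  multiplication by \<open>u\<close>, and let \<open>\<Phi>\<close> be \<open>1\<close>. Every map on this measure space is measurable, but
  the Hausdorff operator, extended complex linearly, maps the character \<open>1\<close> to \<open>x \<mapsto> \<integral>u. x u \<partial>\<mu>\<close>, which is not measurable.
\<close>

definition action_measurable ::
    "'g::topological_space measure \<Rightarrow> 'w measure \<Rightarrow> ('w \<Rightarrow> 'g \<Rightarrow> 'g) \<Rightarrow> bool" where
  "action_measurable \<nu> \<mu> A \<longleftrightarrow> (\<forall>S\<in>sets \<mu>. emeasure \<mu> S < \<infinity> \<longrightarrow>
     (\<lambda>(u, x). A u x) \<in> measurable (completion (restrict_space \<mu> S \<Otimes>\<^sub>M \<nu>)) borel)"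

end

theory Submission
  imports Defs
begin

text \<open>
  Necessity of \<open>\<Phi> \<in> L\<^sup>1(\<mu>)\<close> comes from testing the operator on the constant function \<open>1\<close>
  (\<open>integrable_of_hausdorff_bounded\<close>). For sufficiency and the norm bound, the idea is that composition
  with an automorphism \<open>A\<close> acts isometrically on everything in sight: it preserves Haar measure
  (\<open>distr_aut\<close>), hence \<open>L\<^sup>1\<close> norms, and it permutes characters while respecting positivity, hence
  it commutes with the splitting of a function into its parts with nonnegative and with negative
  spectrum. The operator averages these compositions with weight \<open>\<Phi>\<close>, so it can enlarge the sum of
  the \<open>L\<^sup>1\<close> norms of the two parts by no more than the factor \<open>\<integral>\<bar>\<Phi>\<bar>\<close>.

  Two analytic points carry this out. First, a real trigonometric polynomial has the form
  \<open>c + 2 Re p\<close> with \<open>c\<close> real and \<open>p\<close> spanned by strictly positive characters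
  (\<open>real_pol_decomposition\<close>), and its norm is \<open>\<parallel>p\<parallel>\<^sub>1 + \<parallel>c + p\<parallel>\<^sub>1\<close> (\<open>norm_1star_eq\<close>). The norm of the
  completion is well defined on functions because a sequence of polynomials that is Cauchy and tends
  to zero in \<open>L\<^sup>1\<close> tends to zero (\<open>norm_1star_tendsto_zero\<close>). This rests on uniqueness of Fourier
  coefficients, proved by testing a polynomial against its own approximate conjugate phase
  (\<open>L1_limit_zero_of_coefficients\<close>).

  Second, the image of \<open>c + 2 Re p\<close> has to be approximated by polynomials of the same kind. It is
  \<open>c \<integral>\<Phi> + 2 Re (T p)\<close>, where \<open>T p\<close> is the average of the polynomials \<open>p \<circ> A u\<close>; these may range over
  infinitely many characters. A character \<open>\<theta> > 1\<close> is handled by removing from \<open>T \<theta>\<close> the finitely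
  many positive characters with large Fourier coefficient and observing, by Fubini's theorem, that
  the squared \<open>L\<^sup>2\<close> norm of what is left is an average of small coefficients
  (\<open>character_image_approximation\<close>).

  Fubini's theorem is applied to the finite measure \<open>\<bar>\<Phi>\<bar> \<mu>\<close>, for which the action
  \<open>(u, x) \<mapsto> A u x\<close> is jointly measurable modulo null sets (\<open>action_measurable_density\<close>). Invariance of
  Haar measure under automorphisms is its uniqueness, proved by approximating an integral over one
  invariant measure by finite averages of translates (\<open>integral_eq_of_invariant\<close>).
\<close>

section \<open>Characters and trigonometric polynomials\<close>

lemma characters_one: "(\<lambda>_. 1) \<in> characters"
  by (simp add: characters_def)

lemma characters_mult:
  assumes "\<theta> \<in> characters" "\<psi> \<in> characters"
  shows "(\<lambda>x. \<theta> x * \<psi> x) \<in> characters"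
  using assms by (auto simp: characters_def norm_mult intro!: continuous_intros)

lemma characters_cnj:
  assumes "\<theta> \<in> characters"
  shows "(\<lambda>x. cnj (\<theta> x)) \<in> characters"
  using assms by (auto simp: characters_def intro!: continuous_intros)

lemma norm_character: "\<theta> \<in> characters \<Longrightarrow> cmod (\<theta> x) = 1"
  by (simp add: characters_def)

lemma character_mult_cnj:
  assumes "\<theta> \<in> characters"
  shows "\<theta> x * cnj (\<theta> x) = 1"
  using assms by (simp add: norm_character complex_mult_cnj flip: cmod_power2)

text \<open>
  Excluding the unit character from the nonnegative cone makes the cone and its complex conjugate
  disjoint, so that a real trigonometric polynomial is a real constant plus twice the real part of
  a polynomial with spectrum in this set.
\<close>

definition positive_characters ::
    "(('g::topological_ab_group_add \<Rightarrow> complex) \<times> ('g \<Rightarrow> complex)) set \<Rightarrow> ('g \<Rightarrow> complex) set" where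
  "positive_characters r = characters_plus r - {\<lambda>_. 1}"

lemma positive_characters_subset:
  "positive_characters r \<subseteq> characters_plus r" "positive_characters r \<subseteq> characters"
  by (auto simp: positive_characters_def characters_plus_def)

lemma characters_plus_subset: "characters_plus r \<subseteq> characters"
  by (auto simp: characters_plus_def)

lemma one_in_characters_plus: "group_order r \<Longrightarrow> (\<lambda>_. 1) \<in> characters_plus r"
  using characters_one
  by (fastforce simp: characters_plus_def group_order_def linear_order_on_def partial_order_on_def
      preorder_on_def refl_on_def)

lemma group_order_mult:
  assumes "group_order r" "(\<theta>, \<psi>) \<in> r" "\<theta> \<in> characters" "\<psi> \<in> characters" "\<xi> \<in> characters"
  shows "((\<lambda>x. \<theta> x * \<xi> x), (\<lambda>x. \<psi> x * \<xi> x)) \<in> r"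
  using assms by (auto simp: group_order_def)

text \<open>
  The conjugate of a character is its inverse, and multiplying an inequality of characters by the
  inverse of the smaller one turns \<open>\<theta> < 1\<close> into \<open>1 < cnj \<theta>\<close>.
\<close>

lemma cnj_negative_character:
  assumes r: "group_order r" and \<theta>: "\<theta> \<in> characters" "\<theta> \<notin> characters_plus r"
  shows "(\<lambda>x. cnj (\<theta> x)) \<in> positive_characters r"
proof -
  have ne: "\<theta> \<noteq> (\<lambda>_. 1)"
    using \<theta>(2) one_in_characters_plus[OF r] by auto
  have "(\<theta>, \<lambda>_. 1) \<in> r"
    using r \<theta> ne characters_one
    by (auto simp: group_order_def linear_order_on_def total_on_def characters_plus_def)
  from group_order_mult[OF r this \<theta>(1) characters_one characters_cnj[OF \<theta>(1)]]
  have "((\<lambda>_. 1), (\<lambda>x. cnj (\<theta> x))) \<in> r"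
    using \<theta>(1) by (simp add: character_mult_cnj)
  moreover have "(\<lambda>x. cnj (\<theta> x)) \<noteq> (\<lambda>_. 1)"
    using ne by (metis complex_cnj_cnj complex_cnj_one)
  ultimately show ?thesis
    using \<theta>(1) by (auto simp: positive_characters_def characters_plus_def characters_cnj)
qed

lemma cnj_positive_character:
  assumes r: "group_order r" and \<theta>: "\<theta> \<in> positive_characters r"
  shows "(\<lambda>x. cnj (\<theta> x)) \<in> characters - characters_plus r"
proof -
  have ch: "\<theta> \<in> characters" and pos: "((\<lambda>_. 1), \<theta>) \<in> r" and ne: "\<theta> \<noteq> (\<lambda>_. 1)"
    using \<theta> by (auto simp: positive_characters_def characters_plus_def)
  have "((\<lambda>_. 1), (\<lambda>x. cnj (\<theta> x))) \<notin> r"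
  proof
    assume "((\<lambda>_. 1), (\<lambda>x. cnj (\<theta> x))) \<in> r"
    from group_order_mult[OF r this characters_one characters_cnj[OF ch] ch]
    have "(\<theta>, (\<lambda>_. 1)) \<in> r"
      using ch by (simp add: character_mult_cnj mult.commute[of "cnj _"])
    with pos ne r show False
      by (auto simp: group_order_def linear_order_on_def partial_order_on_def dest: antisymD)
  qed
  then show ?thesis
    using ch by (auto simp: characters_plus_def characters_cnj)
qed

text \<open>
  An automorphism is onto, so it pulls back no character but the unit to the unit; positivity of the
  adjoint is therefore strict.
\<close>

lemma group_aut_plus_D:
  assumes "A \<in> group_aut_plus r"
  shows "A \<in> group_aut" "\<theta> \<in> positive_characters r \<Longrightarrow> \<theta> \<circ> A \<in> positive_characters r"
proof -
  show "A \<in> group_aut"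
    using assms by (simp add: group_aut_plus_def)
  then have surj: "surj A"
    by (simp add: group_aut_def bij_is_surj)
  assume \<theta>: "\<theta> \<in> positive_characters r"
  have "\<theta> \<circ> A \<in> characters_plus r"
    using assms \<theta> by (auto simp: group_aut_plus_def dual_aut_plus_def adjoint_aut_def
        positive_characters_def)
  moreover have "\<theta> \<circ> A \<noteq> (\<lambda>_. 1)"
  proof
    assume *: "\<theta> \<circ> A = (\<lambda>_. 1)"
    have "\<theta> x = 1" for x
      using fun_cong[OF *, of "inv A x"] surj by (simp add: surj_f_inv_f)
    with \<theta> show False
      by (auto simp: positive_characters_def)
  qed
  ultimately show "\<theta> \<circ> A \<in> positive_characters r"
    by (simp add: positive_characters_def)
qed

lemma trig_span_zero: "(\<lambda>_. 0) \<in> trig_span S"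
  unfolding trig_span_def by (rule CollectI, rule exI[of _ "{}"]) auto

lemma trig_span_base: "\<theta> \<in> S \<Longrightarrow> \<theta> \<in> trig_span S"
  unfolding trig_span_def
  by (rule CollectI, rule exI[of _ "{\<theta>}"], rule exI[of _ "\<lambda>_. 1"]) auto

lemma trig_span_mono: "S \<subseteq> T \<Longrightarrow> trig_span S \<subseteq> trig_span T"
  unfolding trig_span_def by blast

lemma trig_span_add:
  assumes "p \<in> trig_span S" "q \<in> trig_span S"
  shows "(\<lambda>x. p x + q x) \<in> trig_span S"
proof -
  obtain F c where p: "p = (\<lambda>x. \<Sum>\<theta>\<in>F. c \<theta> * \<theta> x)" "finite F" "F \<subseteq> S"
    using assms(1) unfolding trig_span_def by auto
  obtain E d where q: "q = (\<lambda>x. \<Sum>\<theta>\<in>E. d \<theta> * \<theta> x)" "finite E" "E \<subseteq> S"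
    using assms(2) unfolding trig_span_def by auto
  let ?e = "\<lambda>\<theta>. (if \<theta> \<in> F then c \<theta> else 0) + (if \<theta> \<in> E then d \<theta> else 0)"
  have "(\<Sum>\<theta>\<in>F. c \<theta> * \<theta> x) = (\<Sum>\<theta>\<in>F \<union> E. (if \<theta> \<in> F then c \<theta> else 0) * \<theta> x)"
    and "(\<Sum>\<theta>\<in>E. d \<theta> * \<theta> x) = (\<Sum>\<theta>\<in>F \<union> E. (if \<theta> \<in> E then d \<theta> else 0) * \<theta> x)" for x
    using p q by (auto intro!: sum.mono_neutral_cong_left)
  then have "(\<lambda>x. p x + q x) = (\<lambda>x. \<Sum>\<theta>\<in>F \<union> E. ?e \<theta> * \<theta> x)"
    by (simp add: p(1) q(1) sum.distrib distrib_right)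
  with p q show ?thesis
    unfolding trig_span_def by (intro CollectI exI[of _ "F \<union> E"] exI[of _ ?e]) auto
qed

lemma trig_span_scale:
  assumes "p \<in> trig_span S"
  shows "(\<lambda>x. a * p x) \<in> trig_span S"
proof -
  obtain F c where p: "p = (\<lambda>x. \<Sum>\<theta>\<in>F. c \<theta> * \<theta> x)" "finite F" "F \<subseteq> S"
    using assms(1) unfolding trig_span_def by auto
  have "(\<lambda>x. a * p x) = (\<lambda>x. \<Sum>\<theta>\<in>F. (a * c \<theta>) * \<theta> x)"
    by (simp add: p(1) sum_distrib_left mult.assoc)
  with p show ?thesis
    unfolding trig_span_def by (intro CollectI exI[of _ F] exI[of _ "\<lambda>\<theta>. a * c \<theta>"]) auto
qed

lemma trig_span_step:
  assumes "\<theta> \<in> S" "p \<in> trig_span S"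
  shows "(\<lambda>x. a * \<theta> x + p x) \<in> trig_span S"
  by (intro trig_span_add trig_span_scale trig_span_base assms)

lemma trig_span_diff:
  "p \<in> trig_span S \<Longrightarrow> q \<in> trig_span S \<Longrightarrow> (\<lambda>x. p x - q x) \<in> trig_span S"
  using trig_span_add[OF _ trig_span_scale, of p S q "-1"] by simp

lemma trig_span_induct [consumes 1, case_names zero step]:
  assumes "p \<in> trig_span S" "P (\<lambda>_. 0)"
    and step: "\<And>c \<theta> p. \<theta> \<in> S \<Longrightarrow> p \<in> trig_span S \<Longrightarrow> P p \<Longrightarrow> P (\<lambda>x. c * \<theta> x + p x)"
  shows "P p"
proof -
  obtain F c where p: "p = (\<lambda>x. \<Sum>\<theta>\<in>F. c \<theta> * \<theta> x)" and F: "finite F" "F \<subseteq> S"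
    using assms(1) unfolding trig_span_def by auto
  have "(\<lambda>x. \<Sum>\<theta>\<in>F. c \<theta> * \<theta> x) \<in> trig_span S \<and> P (\<lambda>x. \<Sum>\<theta>\<in>F. c \<theta> * \<theta> x)"
    using F
  proof (induction F rule: finite_induct)
    case empty
    then show ?case using assms(2) by (simp add: trig_span_zero)
  next
    case (insert \<theta> F)
    then show ?case
      by (auto intro!: step trig_span_step)
  qed
  then show ?thesis by (simp add: p)
qed

lemma trig_span_cnj:
  assumes "p \<in> trig_span S" "\<And>\<theta>. \<theta> \<in> S \<Longrightarrow> (\<lambda>x. cnj (\<theta> x)) \<in> T"
  shows "(\<lambda>x. cnj (p x)) \<in> trig_span T"
  using assms(1)
proof (induction rule: trig_span_induct)
  case zero
  then show ?case by (simp add: trig_span_zero)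
next
  case (step c \<theta> p)
  then show ?case
    using trig_span_step[OF assms(2)] by simp
qed

lemma trig_span_mult:
  assumes "p \<in> trig_span characters" "q \<in> trig_span characters"
  shows "(\<lambda>x. p x * q x) \<in> trig_span characters"
proof -
  have *: "(\<lambda>x. \<theta> x * q x) \<in> trig_span characters" if "\<theta> \<in> characters" for \<theta>
    using assms(2)
  proof (induction rule: trig_span_induct)
    case zero
    then show ?case by (simp add: trig_span_zero)
  next
    case (step c \<psi> p)
    have "(\<lambda>x. c * (\<theta> x * \<psi> x) + \<theta> x * p x) \<in> trig_span characters"
      using step that
      by (intro trig_span_add trig_span_scale) (auto intro!: trig_span_base characters_mult)
    then show ?case
      by (simp add: algebra_simps)
  qed
  from assms(1) show ?thesis
  proof (induction rule: trig_span_induct)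
    case zero
    then show ?case by (simp add: trig_span_zero)
  next
    case (step c \<psi> p)
    have "(\<lambda>x. c * (\<psi> x * q x) + p x * q x) \<in> trig_span characters"
      using step * by (intro trig_span_add trig_span_scale) auto
    then show ?case
      by (simp add: algebra_simps)
  qed
qed

lemma trig_span_const: "(\<lambda>_. c) \<in> trig_span characters"
  using trig_span_scale[OF trig_span_base[OF characters_one], of c] by simp

lemma continuous_trig_span:
  assumes "p \<in> trig_span S" "S \<subseteq> characters"
  shows "continuous_on UNIV p"
  using assms(1)
  by (induction rule: trig_span_induct)
    (use assms(2) in \<open>auto simp: characters_def intro!: continuous_intros\<close>)

lemma bounded_trig_span:
  assumes "p \<in> trig_span S" "S \<subseteq> characters"
  obtains B where "B > 0" "\<And>x. cmod (p x) \<le> B"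
proof -
  have "\<exists>B>0. \<forall>x. cmod (p x) \<le> B"
    using assms(1)
  proof (induction rule: trig_span_induct)
    case zero
    then show ?case by (auto intro: exI[of _ 1])
  next
    case (step c \<theta> p)
    then obtain B where "B > 0" "\<And>x. cmod (p x) \<le> B" by auto
    moreover have "cmod (\<theta> x) = 1" for x
      using step assms(2) by (auto simp: norm_character)
    ultimately show ?case
      by (intro exI[of _ "cmod c + B"])
        (auto intro!: norm_triangle_le add_mono add_nonneg_pos simp: norm_mult)
  qed
  then show ?thesis using that by blast
qed

text \<open>
  A real polynomial is determined by its mean and its strictly positive part, because the
  conjugate of its strictly negative part is again strictly positive.
\<close>

lemma real_pol_decomposition:
  assumes r: "group_order r" and q: "q \<in> real_pol"
  obtains c p where "p \<in> trig_span (positive_characters r)" "q = (\<lambda>x. c + 2 * Re (p x))"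
proof -
  have split: "\<exists>c. \<exists>p\<in>trig_span (positive_characters r). \<exists>m\<in>trig_span (positive_characters r).
      \<forall>x. t x = c + p x + cnj (m x)" if "t \<in> trig_span characters" for t
    using that
  proof (induction rule: trig_span_induct)
    case zero
    then show ?case
      by (auto intro!: exI[of _ 0] bexI[of _ "\<lambda>_. 0"] trig_span_zero)
  next
    case (step a \<theta> t)
    then obtain c p m where IH: "p \<in> trig_span (positive_characters r)"
      "m \<in> trig_span (positive_characters r)" "\<And>x. t x = c + p x + cnj (m x)" by blast
    consider "\<theta> = (\<lambda>_. 1)" | "\<theta> \<in> positive_characters r" | "\<theta> \<notin> characters_plus r"
      by (auto simp: positive_characters_def)
    then show ?case
    proof cases
      case 1
      with IH show ?thesis
        by (intro exI[of _ "a + c"] bexI[of _ p] bexI[of _ m]) auto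
    next
      case 2
      with IH show ?thesis
        by (intro exI[of _ c] bexI[of _ "\<lambda>x. a * \<theta> x + p x"] bexI[of _ m] trig_span_step) auto
    next
      case 3
      with IH show ?thesis
        using trig_span_step[OF cnj_negative_character[OF r step(1)], of m "cnj a"]
        by (intro exI[of _ c] bexI[of _ p] bexI[of _ "\<lambda>x. cnj a * cnj (\<theta> x) + m x"]) auto
    qed
  qed
  obtain c p m where pm: "p \<in> trig_span (positive_characters r)"
    "m \<in> trig_span (positive_characters r)" "\<And>x. of_real (q x) = c + p x + cnj (m x)"
    using split[of "\<lambda>x. of_real (q x)"] q unfolding real_pol_def by blast
  have "q x = Re (of_real (q x))" for x
    by simp
  then have "q = (\<lambda>x. Re c + 2 * Re (1/2 * (p x + m x)))"
    unfolding pm(3) by auto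
  moreover have "(\<lambda>x. 1/2 * (p x + m x)) \<in> trig_span (positive_characters r)"
    by (intro trig_span_scale trig_span_add pm)
  ultimately show ?thesis
    by (rule that[rotated])
qed

lemma real_pol_of_positive:
  assumes "p \<in> trig_span (positive_characters r)"
  shows "(\<lambda>x. c + 2 * Re (p x)) \<in> real_pol"
proof -
  have p: "p \<in> trig_span characters"
    using assms trig_span_mono[OF positive_characters_subset(2)] by blast
  have "(\<lambda>x. of_real c + (p x + cnj (p x))) \<in> trig_span characters"
    by (intro trig_span_add trig_span_const p trig_span_cnj[OF p] characters_cnj)
  then show ?thesis
    by (simp add: real_pol_def complex_add_cnj)
qed

section \<open>The norm of a real trigonometric polynomial\<close>

lemma measurable_cnj [measurable]: "f \<in> borel_measurable M \<Longrightarrow> (\<lambda>x. cnj (f x)) \<in> borel_measurable M"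
  by (rule borel_measurable_continuous_on[OF continuous_on_cnj[OF continuous_on_id]])

locale haar_group =
  fixes \<nu> :: "'g::{topological_ab_group_add, t2_space} measure"
  assumes compact_group: "compact (UNIV :: 'g set)"
    and haar: "normalized_haar \<nu>"
begin

sublocale prob_space \<nu>
  using haar by (simp add: normalized_haar_def)

lemma sets_haar [measurable_cong]: "sets \<nu> = sets borel"
  using haar by (simp add: normalized_haar_def)

lemma space_haar [simp]: "space \<nu> = UNIV"
  using sets_eq_imp_space_eq[OF sets_haar] by simp

lemma measurable_continuous: "continuous_on UNIV f \<Longrightarrow> f \<in> borel_measurable \<nu>"
  by (simp add: measurable_cong_sets[OF sets_haar refl] borel_measurable_continuous_onI)

lemma integrable_bounded:
  fixes f :: "'g \<Rightarrow> 'b::{banach, second_countable_topology}"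
  assumes "f \<in> borel_measurable \<nu>" "\<And>x. norm (f x) \<le> B"
  shows "integrable \<nu> f"
  using assms by (intro integrable_const_bound[where B = B]) auto

lemma integral_translate:
  fixes f :: "'g \<Rightarrow> 'b::{banach, second_countable_topology}"
  assumes "f \<in> borel_measurable \<nu>"
  shows "(\<integral>x. f (a + x) \<partial>\<nu>) = (\<integral>x. f x \<partial>\<nu>)"
proof -
  have "distr \<nu> borel ((+) a) = \<nu>"
    using haar by (simp add: normalized_haar_def)
  moreover have "(+) a \<in> measurable \<nu> borel"
    by (intro measurable_continuous continuous_intros)
  ultimately show ?thesis
    using integral_distr[of "(+) a" \<nu> borel f] assms
    by (simp add: measurable_cong_sets[OF sets_haar refl])
qed

lemma measurable_character: "\<theta> \<in> characters \<Longrightarrow> \<theta> \<in> borel_measurable \<nu>"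
  by (intro measurable_continuous) (simp add: characters_def)

lemma integrable_character: "\<theta> \<in> characters \<Longrightarrow> integrable \<nu> \<theta>"
  by (intro integrable_bounded[where B = 1] measurable_character) (auto simp: norm_character)

lemma integral_character:
  assumes \<theta>: "\<theta> \<in> characters"
  shows "(\<integral>x. \<theta> x \<partial>\<nu>) = (if \<theta> = (\<lambda>_. 1) then 1 else 0)"
proof (cases "\<theta> = (\<lambda>_. 1)")
  case True
  then show ?thesis by (simp add: prob_space[simplified])
next
  case False
  then obtain a where a: "\<theta> a \<noteq> 1" by auto
  have "(\<integral>x. \<theta> x \<partial>\<nu>) = (\<integral>x. \<theta> (a + x) \<partial>\<nu>)"
    by (intro integral_translate[symmetric] measurable_character \<theta>)
  also have "\<dots> = \<theta> a * (\<integral>x. \<theta> x \<partial>\<nu>)"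
    using \<theta> by (simp add: characters_def)
  finally show ?thesis
    using a False by simp
qed

lemma character_orthonormal:
  assumes "\<theta> \<in> characters" "\<psi> \<in> characters"
  shows "(\<integral>x. \<theta> x * cnj (\<psi> x) \<partial>\<nu>) = (if \<theta> = \<psi> then 1 else 0)"
proof -
  have "(\<lambda>x. \<theta> x * cnj (\<psi> x)) = (\<lambda>_. 1) \<longleftrightarrow> \<theta> = \<psi>"
  proof
    assume *: "(\<lambda>x. \<theta> x * cnj (\<psi> x)) = (\<lambda>_. 1)"
    have "\<theta> x = \<psi> x" for x
    proof -
      have "\<theta> x = \<theta> x * (\<psi> x * cnj (\<psi> x))"
        using assms by (simp add: character_mult_cnj)
      also have "\<dots> = \<psi> x * (\<theta> x * cnj (\<psi> x))" by simp
      also have "\<dots> = \<psi> x"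
        using fun_cong[OF *, of x] by simp
      finally show ?thesis .
    qed
    then show "\<theta> = \<psi>" by auto
  qed (use assms in \<open>simp add: character_mult_cnj\<close>)
  then show ?thesis
    using integral_character[OF characters_mult[OF assms(1) characters_cnj[OF assms(2)]]] by simp
qed

lemma measurable_trig_span:
  "p \<in> trig_span S \<Longrightarrow> S \<subseteq> characters \<Longrightarrow> p \<in> borel_measurable \<nu>"
  by (intro measurable_continuous continuous_trig_span)

lemma integrable_trig_span:
  assumes "p \<in> trig_span S" "S \<subseteq> characters"
  shows "integrable \<nu> p"
  by (rule bounded_trig_span[OF assms]) (rule integrable_bounded[OF measurable_trig_span[OF assms]])

lemma integrable_mult_trig_span:
  assumes "integrable \<nu> f" "p \<in> trig_span S" "S \<subseteq> characters"
  shows "integrable \<nu> (\<lambda>x. f x * p x)" "integrable \<nu> (\<lambda>x. p x * f x)"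
    "integrable \<nu> (\<lambda>x. f x * cnj (p x))"
proof -
  obtain B where B: "\<And>x. cmod (p x) \<le> B"
    using bounded_trig_span[OF assms(2,3)] by blast
  have meas: "p \<in> borel_measurable \<nu>"
    by (rule measurable_trig_span[OF assms(2,3)])
  have *: "cmod (f x) * cmod (p x) \<le> cmod (of_real B * f x)" for x
  proof -
    have "cmod (f x) * cmod (p x) \<le> cmod (f x) * \<bar>B\<bar>"
      using B[of x] by (intro mult_left_mono) auto
    then show ?thesis by (simp add: norm_mult mult.commute)
  qed
  have int: "integrable \<nu> (\<lambda>x. of_real B * f x)"
    using assms(1) by simp
  show "integrable \<nu> (\<lambda>x. f x * p x)" "integrable \<nu> (\<lambda>x. p x * f x)"
    "integrable \<nu> (\<lambda>x. f x * cnj (p x))"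
    using * meas borel_measurable_integrable[OF assms(1)]
    by (auto intro!: Bochner_Integration.integrable_bound[OF int] AE_I2
        simp: norm_mult mult.commute[of "cmod (p _)"])
qed

lemma integral_trig_span_orthogonal:
  assumes "p \<in> trig_span S" "S \<subseteq> characters" "\<psi> \<in> characters" "\<psi> \<notin> S"
  shows "(\<integral>x. p x * cnj (\<psi> x) \<partial>\<nu>) = 0"
  using assms(1)
proof (induction rule: trig_span_induct)
  case zero
  then show ?case by simp
next
  case (step c \<theta> p)
  have \<psi>: "\<psi> \<in> trig_span characters"
    using assms(3) by (rule trig_span_base)
  have \<theta>: "\<theta> \<in> characters" "\<theta> \<noteq> \<psi>"
    using step assms by auto
  have "(\<integral>x. (c * \<theta> x + p x) * cnj (\<psi> x) \<partial>\<nu>)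
      = (\<integral>x. c * (\<theta> x * cnj (\<psi> x)) + p x * cnj (\<psi> x) \<partial>\<nu>)"
    by (simp add: algebra_simps)
  also have "\<dots> = (\<integral>x. c * (\<theta> x * cnj (\<psi> x)) \<partial>\<nu>) + (\<integral>x. p x * cnj (\<psi> x) \<partial>\<nu>)"
    using integrable_mult_trig_span(3)[OF integrable_character[OF \<theta>(1)] \<psi> order_refl]
      integrable_mult_trig_span(3)[OF integrable_trig_span[OF step(2) assms(2)] \<psi> order_refl]
    by (intro Bochner_Integration.integral_add) auto
  also have "\<dots> = 0"
    using step \<theta> assms(3) by (simp add: character_orthonormal)
  finally show ?case .
qed

text \<open>
  Both claims come from the total mass being \<open>1\<close>: \<open>2 a \<le> a\<^sup>2 + 1\<close> gives integrability, and the
  variance of \<open>\<bar>f\<bar>\<close> is nonnegative.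
\<close>

lemma integral_norm_le_L2:
  assumes f: "f \<in> L2_functions \<nu>"
  shows "integrable \<nu> f" "(\<integral>x. cmod (f x) \<partial>\<nu>) \<le> sqrt (\<integral>x. (cmod (f x))\<^sup>2 \<partial>\<nu>)"
proof -
  have meas: "f \<in> borel_measurable \<nu>" and sq: "integrable \<nu> (\<lambda>x. (cmod (f x))\<^sup>2)"
    using f by (auto simp: L2_functions_def)
  have "cmod (f x) \<le> 1 + (cmod (f x))\<^sup>2" for x
  proof -
    have "2 * cmod (f x) \<le> (cmod (f x))\<^sup>2 + 1"
      using zero_le_power2[of "cmod (f x) - 1"] by (simp add: power2_diff)
    then show ?thesis
      using norm_ge_zero[of "f x"] by linarith
  qed
  then have bound: "norm (f x) \<le> norm (1 + (cmod (f x))\<^sup>2)" for x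
    by (simp only: real_norm_def) (rule order_trans[OF _ abs_ge_self], simp)
  have "integrable \<nu> (\<lambda>x. 1 + (cmod (f x))\<^sup>2)"
    using sq by simp
  from Bochner_Integration.integrable_bound[OF this meas AE_I2[OF bound]]
  show int: "integrable \<nu> f" .
  have "0 \<le> (\<integral>x. (cmod (f x) - (\<integral>x. cmod (f x) \<partial>\<nu>))\<^sup>2 \<partial>\<nu>)"
    by (rule variance_positive)
  also have "\<dots> = (\<integral>x. (cmod (f x))\<^sup>2 \<partial>\<nu>) - (\<integral>x. cmod (f x) \<partial>\<nu>)\<^sup>2"
    using int sq by (intro variance_eq) auto
  finally show "(\<integral>x. cmod (f x) \<partial>\<nu>) \<le> sqrt (\<integral>x. (cmod (f x))\<^sup>2 \<partial>\<nu>)"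
    by (intro real_le_rsqrt) simp
qed

lemma L2_functions_trig_span:
  assumes "p \<in> trig_span S" "S \<subseteq> characters"
  shows "p \<in> L2_functions \<nu>"
proof -
  obtain B where B: "\<And>x. cmod (p x) \<le> B"
    using bounded_trig_span[OF assms] by blast
  have "norm ((cmod (p x))\<^sup>2) \<le> B\<^sup>2" for x
    using B[of x] by (simp add: power_mono)
  then show ?thesis
    using measurable_trig_span[OF assms]
    by (simp add: L2_functions_def integrable_bounded[where B = "B\<^sup>2"])
qed

lemma L2_functions_diff:
  assumes "f \<in> L2_functions \<nu>" "g \<in> L2_functions \<nu>"
  shows "(\<lambda>x. f x - g x) \<in> L2_functions \<nu>"
proof -
  have "(cmod (f x - g x))\<^sup>2 \<le> 2 * (cmod (f x))\<^sup>2 + 2 * (cmod (g x))\<^sup>2" for x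
  proof -
    have "(cmod (f x - g x))\<^sup>2 \<le> (cmod (f x) + cmod (g x))\<^sup>2"
      by (intro power_mono norm_triangle_ineq4) auto
    also have "\<dots> \<le> 2 * (cmod (f x))\<^sup>2 + 2 * (cmod (g x))\<^sup>2"
      using zero_le_power2[of "cmod (f x) - cmod (g x)"]
      by (simp add: power2_sum power2_diff)
    finally show ?thesis .
  qed
  then have bound: "norm ((cmod (f x - g x))\<^sup>2) \<le> norm (2 * (cmod (f x))\<^sup>2 + 2 * (cmod (g x))\<^sup>2)" for x
    by (simp only: real_norm_def) (rule order_trans[OF _ abs_ge_self], simp)
  have f: "f \<in> borel_measurable \<nu>" "integrable \<nu> (\<lambda>x. (cmod (f x))\<^sup>2)"
    and g: "g \<in> borel_measurable \<nu>" "integrable \<nu> (\<lambda>x. (cmod (g x))\<^sup>2)"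
    using assms by (auto simp: L2_functions_def)
  have "integrable \<nu> (\<lambda>x. 2 * (cmod (f x))\<^sup>2 + 2 * (cmod (g x))\<^sup>2)"
    using f g by simp
  from Bochner_Integration.integrable_bound[OF this _ AE_I2[OF bound]]
  have "integrable \<nu> (\<lambda>x. (cmod (f x - g x))\<^sup>2)"
    using f g by simp
  with f g show ?thesis
    by (simp add: L2_functions_def)
qed

text \<open>
  Orthogonality of characters passes from the span to its closure, since \<open>m\<close> is bounded and the
  \<open>L\<^sup>1\<close> distance is at most the \<open>L\<^sup>2\<close> distance.
\<close>

lemma L2_closed_span_orthogonal:
  assumes S: "S \<subseteq> characters" "T \<subseteq> characters" "S \<inter> T = {}"
    and m: "m \<in> trig_span T" and h: "h \<in> L2_closed_span \<nu> S"
  shows "(\<integral>x. m x * cnj (h x) \<partial>\<nu>) = 0"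
proof -
  have hL2: "h \<in> L2_functions \<nu>"
    using h by (simp add: L2_closed_span_def)
  have int_h: "integrable \<nu> (\<lambda>x. cnj (h x))"
    using integral_norm_le_L2(1)[OF hL2] by simp
  obtain B where B: "B > 0" "\<And>x. cmod (m x) \<le> B"
    using bounded_trig_span[OF m S(2)] by blast
  have span0: "(\<integral>x. m x * cnj (t x) \<partial>\<nu>) = 0" if "t \<in> trig_span S" for t
    using that
  proof (induction rule: trig_span_induct)
    case zero
    then show ?case by simp
  next
    case (step c \<theta> t)
    have \<theta>: "\<theta> \<in> characters" "\<theta> \<notin> T"
      using step S by auto
    have "(\<integral>x. m x * cnj (c * \<theta> x + t x) \<partial>\<nu>)
        = (\<integral>x. cnj c * (m x * cnj (\<theta> x)) + m x * cnj (t x) \<partial>\<nu>)"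
      by (simp add: algebra_simps)
    also have "\<dots> = (\<integral>x. cnj c * (m x * cnj (\<theta> x)) \<partial>\<nu>) + (\<integral>x. m x * cnj (t x) \<partial>\<nu>)"
      using integrable_mult_trig_span(3)[OF integrable_trig_span[OF m S(2)] step(2) S(1)]
        integrable_mult_trig_span(3)[OF integrable_trig_span[OF m S(2)] trig_span_base[OF \<theta>(1)] order_refl]
      by (intro Bochner_Integration.integral_add) auto
    also have "\<dots> = 0"
      using step integral_trig_span_orthogonal[OF m S(2) \<theta>] by simp
    finally show ?case .
  qed
  have "cmod (\<integral>x. m x * cnj (h x) \<partial>\<nu>) \<le> \<epsilon>" if "\<epsilon> > 0" for \<epsilon>
  proof -
    obtain t where t: "t \<in> trig_span S" "sqrt (\<integral>x. (cmod (h x - t x))\<^sup>2 \<partial>\<nu>) < \<epsilon> / B"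
      using h B(1) \<open>\<epsilon> > 0\<close> unfolding L2_closed_span_def by (blast intro: divide_pos_pos)
    have ht: "(\<lambda>x. h x - t x) \<in> L2_functions \<nu>"
      by (intro L2_functions_diff hL2 L2_functions_trig_span[OF t(1) S(1)])
    have int1: "integrable \<nu> (\<lambda>x. m x * cnj (h x))"
      using integrable_mult_trig_span(2)[OF int_h m S(2)] .
    have int2: "integrable \<nu> (\<lambda>x. m x * cnj (t x))"
      using integrable_mult_trig_span(3)[OF integrable_trig_span[OF m S(2)] t(1) S(1)] .
    have "(\<integral>x. m x * cnj (h x) \<partial>\<nu>) = (\<integral>x. m x * cnj (h x) \<partial>\<nu>) - (\<integral>x. m x * cnj (t x) \<partial>\<nu>)"
      using span0[OF t(1)] by simp
    also have "\<dots> = (\<integral>x. m x * cnj (h x) - m x * cnj (t x) \<partial>\<nu>)"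
      using int1 int2 by simp
    also have "cmod \<dots> \<le> (\<integral>x. B * cmod (h x - t x) \<partial>\<nu>)"
    proof (rule order_trans[OF integral_norm_bound integral_mono])
      show "integrable \<nu> (\<lambda>x. cmod (m x * cnj (h x) - m x * cnj (t x)))"
        using int1 int2 by auto
      show "integrable \<nu> (\<lambda>x. B * cmod (h x - t x))"
        using integral_norm_le_L2(1)[OF ht] by auto
      show "cmod (m x * cnj (h x) - m x * cnj (t x)) \<le> B * cmod (h x - t x)" for x
        using mult_right_mono[OF B(2)[of x], of "cmod (h x - t x)"]
        by (simp add: norm_mult flip: right_diff_distrib complex_cnj_diff)
    qed
    also have "\<dots> \<le> B * sqrt (\<integral>x. (cmod (h x - t x))\<^sup>2 \<partial>\<nu>)"
      using integral_norm_le_L2(2)[OF ht] B(1) by simp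
    also have "\<dots> \<le> \<epsilon>"
      using t(2) B(1) by (simp add: field_simps)
    finally show ?thesis .
  qed
  then have "cmod (\<integral>x. m x * cnj (h x) \<partial>\<nu>) \<le> 0"
    by (rule field_le_epsilon[of _ 0, simplified])
  then show ?thesis by simp
qed

text \<open>
  The orthogonality conditions satisfied by the chosen projection and by the partial sum over the
  nonnegative cone subtract to say that their difference, which lies in the closed span, is
  orthogonal to itself.
\<close>

lemma proj_plus_AE:
  assumes p: "p \<in> trig_span (characters_plus r)"
    and m: "m \<in> trig_span (characters - characters_plus r)"
  shows "proj_plus \<nu> r (\<lambda>x. p x + m x) \<in> borel_measurable \<nu>"
    and "AE x in \<nu>. proj_plus \<nu> r (\<lambda>x. p x + m x) x = p x"
proof -
  let ?L = "L2_closed_span \<nu> (characters_plus r)"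
  let ?spec = "\<lambda>g. g \<in> ?L \<and> (\<forall>h\<in>?L. (\<integral>x. (p x + m x - g x) * cnj (h x) \<partial>\<nu>) = 0)"
  define g where "g = proj_plus \<nu> r (\<lambda>x. p x + m x)"
  have pL: "p \<in> ?L"
    unfolding L2_closed_span_def
    using L2_functions_trig_span[OF p characters_plus_subset]
    by (intro CollectI conjI allI impI bexI[of _ p] p) auto
  have m0: "(\<integral>x. m x * cnj (h x) \<partial>\<nu>) = 0" if "h \<in> ?L" for h
    by (rule L2_closed_span_orthogonal[OF characters_plus_subset _ _ m that]) auto
  have "?spec p"
    using pL m0 by simp
  then have g: "?spec g"
    unfolding g_def proj_plus_def by (rule someI[where P = ?spec])
  have gL2: "g \<in> L2_functions \<nu>" and pL2: "p \<in> L2_functions \<nu>"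
    using g pL by (auto simp: L2_closed_span_def)
  then show "proj_plus \<nu> r (\<lambda>x. p x + m x) \<in> borel_measurable \<nu>"
    by (simp add: g_def L2_functions_def)
  define h where "h = (\<lambda>x. g x - p x)"
  have hL2: "h \<in> L2_functions \<nu>"
    unfolding h_def by (intro L2_functions_diff gL2 pL2)
  have h: "h \<in> ?L"
    unfolding L2_closed_span_def
  proof (intro CollectI conjI hL2 allI impI)
    fix \<epsilon> :: real assume "\<epsilon> > 0"
    then obtain t where "t \<in> trig_span (characters_plus r)"
      "sqrt (\<integral>x. (cmod (g x - t x))\<^sup>2 \<partial>\<nu>) < \<epsilon>"
      using g unfolding L2_closed_span_def by blast
    then show "\<exists>t\<in>trig_span (characters_plus r). sqrt (\<integral>x. (cmod (h x - t x))\<^sup>2 \<partial>\<nu>) < \<epsilon>"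
      using p by (intro bexI[of _ "\<lambda>x. t x - p x"] trig_span_diff) (auto simp: h_def)
  qed
  have sq: "integrable \<nu> (\<lambda>x. (cmod (h x))\<^sup>2)"
    using hL2 by (simp add: L2_functions_def)
  have mh: "integrable \<nu> (\<lambda>x. m x * cnj (h x))"
    using integrable_mult_trig_span(2)[of "\<lambda>x. cnj (h x)", OF _ m] integral_norm_le_L2(1)[OF hL2]
    by auto
  have "0 = (\<integral>x. (p x + m x - g x) * cnj (h x) \<partial>\<nu>)"
    using g h by simp
  also have "\<dots> = (\<integral>x. m x * cnj (h x) - of_real ((cmod (h x))\<^sup>2) \<partial>\<nu>)"
    by (rule Bochner_Integration.integral_cong)
      (auto simp: h_def complex_norm_square algebra_simps simp del: of_real_power)
  also have "\<dots> = (\<integral>x. m x * cnj (h x) \<partial>\<nu>) - (\<integral>x. of_real ((cmod (h x))\<^sup>2) \<partial>\<nu>)"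
    by (rule Bochner_Integration.integral_diff[OF mh]) (rule integrable_of_real[OF sq])
  finally have "(\<integral>x. (cmod (h x))\<^sup>2 \<partial>\<nu>) = 0"
    using m0[OF h] by (simp del: of_real_power)
  then have "AE x in \<nu>. (cmod (h x))\<^sup>2 = 0"
    using integral_nonneg_eq_0_iff_AE[OF sq] by simp
  then show "AE x in \<nu>. proj_plus \<nu> r (\<lambda>x. p x + m x) x = p x"
    by (auto simp: h_def g_def)
qed

text \<open>
  The part of \<open>c + 2 Re p\<close> with nonnegative spectrum is \<open>c + p\<close>, and the part with negative spectrum
  is \<open>cnj p\<close>, which has the modulus of \<open>p\<close>.
\<close>

lemma norm_1star_eq:
  assumes r: "group_order r" and p: "p \<in> trig_span (positive_characters r)"
  shows "norm_1star \<nu> r (\<lambda>x. c + 2 * Re (p x)) = (\<integral>x. cmod (p x) \<partial>\<nu>) + (\<integral>x. cmod (of_real c + p x) \<partial>\<nu>)"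
proof -
  define p1 where "p1 = (\<lambda>x. of_real c + p x)"
  define m where "m = (\<lambda>x. cnj (p x))"
  have p1: "p1 \<in> trig_span (characters_plus r)"
    using trig_span_step[OF one_in_characters_plus[OF r], of p "of_real c"]
      subsetD[OF trig_span_mono[OF positive_characters_subset(1)] p]
    by (simp add: p1_def)
  have m: "m \<in> trig_span (characters - characters_plus r)"
    unfolding m_def using p by (rule trig_span_cnj) (rule cnj_positive_character[OF r])
  have eq: "(\<lambda>x. complex_of_real (c + 2 * Re (p x))) = (\<lambda>x. p1 x + m x)"
    by (auto simp: p1_def m_def complex_add_cnj)
  have meas: "p1 \<in> borel_measurable \<nu>" "m \<in> borel_measurable \<nu>"
    using measurable_trig_span[OF p1 characters_plus_subset] measurable_trig_span[OF m] by auto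
  note AE = proj_plus_AE[OF p1 m]
  have "(\<integral>x. cmod (proj_plus \<nu> r (\<lambda>x. p1 x + m x) x) \<partial>\<nu>) = (\<integral>x. cmod (p1 x) \<partial>\<nu>)"
    by (rule integral_cong_AE) (use AE meas in auto)
  moreover have "(\<integral>x. cmod (proj_minus \<nu> r (\<lambda>x. p1 x + m x) x) \<partial>\<nu>) = (\<integral>x. cmod (m x) \<partial>\<nu>)"
    by (rule integral_cong_AE) (use AE meas in \<open>auto simp: proj_minus_def\<close>)
  ultimately show ?thesis
    unfolding norm_1star_def eq by (simp add: m_def p1_def)
qed

end

section \<open>Uniqueness of Fourier coefficients and the completed norm\<close>

lemma real_pol_const: "(\<lambda>_. c) \<in> real_pol"
  by (simp add: real_pol_def trig_span_const)

lemma real_pol_add: "p \<in> real_pol \<Longrightarrow> q \<in> real_pol \<Longrightarrow> (\<lambda>x. p x + q x) \<in> real_pol"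
  using trig_span_add[of "\<lambda>x. of_real (p x)" characters "\<lambda>x. of_real (q x)"]
  by (simp add: real_pol_def)

lemma real_pol_diff: "p \<in> real_pol \<Longrightarrow> q \<in> real_pol \<Longrightarrow> (\<lambda>x. p x - q x) \<in> real_pol"
  using trig_span_diff[of "\<lambda>x. of_real (p x)" characters "\<lambda>x. of_real (q x)"]
  by (simp add: real_pol_def)

lemma real_pol_mult: "p \<in> real_pol \<Longrightarrow> q \<in> real_pol \<Longrightarrow> (\<lambda>x. p x * q x) \<in> real_pol"
  using trig_span_mult[of "\<lambda>x. of_real (p x)" "\<lambda>x. of_real (q x)"]
  by (simp add: real_pol_def)

lemma real_pol_compose_polynomial:
  fixes h :: "real \<Rightarrow> real"
  assumes "real_polynomial_function h" "q \<in> real_pol"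
  shows "(\<lambda>x. h (q x)) \<in> real_pol"
  using assms(1)
proof (induction rule: real_polynomial_function.induct)
  case (linear f)
  then interpret bounded_linear f .
  define a where "a = f 1"
  have "f y = a * y" for y
    using scaleR[of y 1] by (simp add: a_def)
  then show ?case
    using real_pol_mult[OF real_pol_const assms(2), of a] by simp
qed (auto intro: real_pol_const real_pol_add real_pol_mult)

text \<open>
  A trigonometric substitute for multiplication by the conjugate phase of \<open>p\<close>: approximate
  \<open>cnj p / sqrt (\<bar>p\<bar>\<^sup>2 + d\<^sup>2)\<close> uniformly, using a polynomial approximation of the function
  \<open>s \<mapsto> 1 / sqrt (s + d\<^sup>2)\<close>. The approximation takes place on an interval that contains the values
  of \<open>\<bar>p\<bar>\<^sup>2\<close>, and composing a polynomial with \<open>p cnj p\<close> stays within trigonometric polynomials.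
\<close>

lemma trig_phase_approximation:
  assumes p: "p \<in> trig_span characters" and \<delta>: "\<delta> > 0"
  obtains t where "t \<in> trig_span characters" "\<And>x. cmod (t x) \<le> 2"
    "\<And>x. cmod (p x) \<le> Re (p x * t x) + \<delta>"
proof -
  obtain B where B: "B > 0" "\<And>x. cmod (p x) \<le> B"
    using bounded_trig_span[OF p order_refl] by blast
  define d where "d = \<delta> / 2"
  have d: "d > 0" using \<delta> by (simp add: d_def)
  \<comment> \<open>The error \<open>\<eta>\<close> of the polynomial is multiplied by at most \<open>B\<close> in the test function and by at
      most \<open>B\<^sup>2\<close> in its product with \<open>p\<close>.\<close>
  define \<eta> where "\<eta> = min (1 / B) (d / B\<^sup>2)"
  have \<eta>: "\<eta> > 0" "\<eta> * B \<le> 1" "\<eta> * B\<^sup>2 \<le> d"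
    using B(1) d by (auto simp: \<eta>_def min_def field_simps)
  define \<psi> where "\<psi> = (\<lambda>s. 1 / sqrt (s + d\<^sup>2))"
  have pos: "s + d\<^sup>2 > 0" if "s \<ge> 0" for s
    using that d by (intro add_nonneg_pos) auto
  have "continuous_on {0..B\<^sup>2} \<psi>"
    unfolding \<psi>_def using pos by (force intro!: continuous_intros)
  then obtain h where h: "real_polynomial_function h"
    "\<And>s. s \<in> {0..B\<^sup>2} \<Longrightarrow> \<bar>\<psi> s - h s\<bar> < \<eta>"
    using Stone_Weierstrass_real_polynomial_function[of "{0..B\<^sup>2}" \<psi> \<eta>] \<eta>(1) by auto
  define q where "q = (\<lambda>x. (cmod (p x))\<^sup>2)"
  have q_range: "q x \<in> {0..B\<^sup>2}" for x
    using B by (auto simp: q_def intro!: power_mono)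
  have "(\<lambda>x. p x * cnj (p x)) \<in> trig_span characters"
    by (intro trig_span_mult p trig_span_cnj[OF p] characters_cnj)
  then have "q \<in> real_pol"
    by (simp add: real_pol_def q_def complex_norm_square del: of_real_power)
  then have hq: "(\<lambda>x. of_real (h (q x))) \<in> trig_span characters"
    using real_pol_compose_polynomial[OF h(1)] by (simp add: real_pol_def)
  define t where "t = (\<lambda>x. cnj (p x) * of_real (h (q x)))"
  have t: "t \<in> trig_span characters"
    unfolding t_def by (intro trig_span_mult hq trig_span_cnj[OF p] characters_cnj)
  have *: "cmod (t x) \<le> 2 \<and> cmod (p x) \<le> Re (p x * t x) + \<delta>" for x
  proof -
    let ?a = "cmod (p x)"
    define S where "S = sqrt (?a\<^sup>2 + d\<^sup>2)"
    have S: "S > 0" "?a \<le> S" "S \<le> ?a + d" "d \<le> S" "S\<^sup>2 = ?a\<^sup>2 + d\<^sup>2"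
      using d pos[of "?a\<^sup>2"] sqrt_sum_squares_le_sum[of ?a d] by (auto simp: S_def real_le_rsqrt)
    have \<psi>S: "\<psi> (q x) = 1 / S"
      by (simp add: \<psi>_def q_def S_def)
    have close: "\<bar>\<psi> (q x) - h (q x)\<bar> \<le> \<eta>"
      using h(2)[OF q_range] by (simp add: less_imp_le)
    then have h_abs: "\<bar>h (q x)\<bar> \<le> 1 / S + \<eta>" and h_low: "1 / S - \<eta> \<le> h (q x)"
      using divide_pos_pos[OF zero_less_one S(1)] unfolding \<psi>S by linarith+
    have "cmod (t x) = ?a * \<bar>h (q x)\<bar>"
      by (simp add: t_def norm_mult)
    also have "\<dots> \<le> ?a * (1 / S + \<eta>)"
      using h_abs by (intro mult_left_mono) auto
    also have "\<dots> = ?a / S + \<eta> * ?a"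
      by (simp add: algebra_simps)
    also have "\<dots> \<le> 1 + \<eta> * B"
      using S B(2)[of x] \<eta>(1) by (intro add_mono mult_left_mono) auto
    finally have 1: "cmod (t x) \<le> 2" using \<eta>(2) by linarith
    have "?a - d \<le> ?a\<^sup>2 / S"
    proof -
      have "(?a - d) * S \<le> ?a\<^sup>2"
      proof (cases "?a \<ge> d")
        case True
        then have "(?a - d) * S \<le> (?a - d) * (?a + d)"
          using S by (intro mult_left_mono) auto
        also have "\<dots> \<le> ?a\<^sup>2"
          by (simp add: algebra_simps power2_eq_square)
        finally show ?thesis .
      next
        case False
        then have "(?a - d) * S \<le> 0"
          using S(1) by (intro mult_nonpos_nonneg) auto
        then show ?thesis
          using zero_le_power2[of ?a] by linarith
      qed
      then show ?thesis using S(1) by (simp add: field_simps)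
    qed
    moreover have "?a\<^sup>2 * (1 / S - \<eta>) \<le> ?a\<^sup>2 * h (q x)"
      using h_low by (intro mult_left_mono) auto
    moreover have "?a\<^sup>2 * \<eta> \<le> B\<^sup>2 * \<eta>"
      using B \<eta>(1) by (intro mult_right_mono power_mono) auto
    moreover have "Re (p x * t x) = ?a\<^sup>2 * h (q x)"
    proof -
      have "p x * t x = of_real (?a\<^sup>2 * h (q x))"
        by (simp add: t_def complex_norm_square mult.assoc del: of_real_power)
      then show ?thesis by simp
    qed
    ultimately have "?a \<le> Re (p x * t x) + \<delta>"
      using \<eta>(3) by (simp add: d_def algebra_simps)
    with 1 show ?thesis by simp
  qed
  show ?thesis
    by (rule that[OF t]) (use * in auto)
qed

context haar_group
begin

lemma norm_integral_mult_trig_le: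
  assumes f: "integrable \<nu> f" and t: "t \<in> trig_span characters" "\<And>x. cmod (t x) \<le> B"
  shows "cmod (\<integral>x. f x * t x \<partial>\<nu>) \<le> B * (\<integral>x. cmod (f x) \<partial>\<nu>)"
proof -
  have "cmod (\<integral>x. f x * t x \<partial>\<nu>) \<le> (\<integral>x. cmod (f x * t x) \<partial>\<nu>)"
    by (rule integral_norm_bound)
  also have "\<dots> \<le> (\<integral>x. B * cmod (f x) \<partial>\<nu>)"
  proof (rule integral_mono)
    show "integrable \<nu> (\<lambda>x. cmod (f x * t x))"
      using integrable_mult_trig_span(1)[OF f t(1)] by (intro integrable_norm) simp
    show "cmod (f x * t x) \<le> B * cmod (f x)" for x
      using mult_left_mono[OF t(2)[of x] norm_ge_zero[of "f x"]]
      by (simp add: norm_mult mult.commute)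
  qed (use f in simp)
  finally show ?thesis by simp
qed

text \<open>
  The uniqueness theorem for Fourier coefficients in its sequential form: an \<open>L\<^sup>1\<close> Cauchy sequence
  of polynomials whose coefficients all tend to zero tends to zero. Testing a far term of the
  sequence against its own approximate conjugate phase recovers its norm, while the same test
  against still later terms is a fixed finite combination of coefficients.
\<close>

lemma L1_limit_zero_of_coefficients:
  assumes p: "\<And>n. p n \<in> trig_span characters"
    and Cauchy: "\<And>\<epsilon>. \<epsilon> > 0 \<Longrightarrow> \<exists>N. \<forall>m\<ge>N. \<forall>n\<ge>N. (\<integral>x. cmod (p m x - p n x) \<partial>\<nu>) < \<epsilon>"
    and coeff: "\<And>\<psi>. \<psi> \<in> characters \<Longrightarrow> (\<lambda>n. \<integral>x. p n x * cnj (\<psi> x) \<partial>\<nu>) \<longlonglongrightarrow> 0"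
  shows "(\<lambda>n. \<integral>x. cmod (p n x) \<partial>\<nu>) \<longlonglongrightarrow> 0"
proof -
  have int: "integrable \<nu> (p n)" for n
    by (rule integrable_trig_span[OF p order_refl])
  have test: "(\<lambda>n. \<integral>x. p n x * t x \<partial>\<nu>) \<longlonglongrightarrow> 0" if "t \<in> trig_span characters" for t
    using that
  proof (induction rule: trig_span_induct)
    case zero
    then show ?case by simp
  next
    case (step c \<theta> t)
    have \<theta>: "\<theta> \<in> trig_span characters"
      using step(1) by (rule trig_span_base)
    have "(\<integral>x. p n x * (c * \<theta> x + t x) \<partial>\<nu>)
        = c * (\<integral>x. p n x * \<theta> x \<partial>\<nu>) + (\<integral>x. p n x * t x \<partial>\<nu>)" for n
    proof -
      have "(\<integral>x. p n x * (c * \<theta> x + t x) \<partial>\<nu>) = (\<integral>x. c * (p n x * \<theta> x) + p n x * t x \<partial>\<nu>)"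
        by (simp add: algebra_simps)
      also have "\<dots> = (\<integral>x. c * (p n x * \<theta> x) \<partial>\<nu>) + (\<integral>x. p n x * t x \<partial>\<nu>)"
        using integrable_mult_trig_span(1)[OF int \<theta>] integrable_mult_trig_span(1)[OF int step(2)]
        by (intro Bochner_Integration.integral_add) auto
      finally show ?thesis by simp
    qed
    moreover have "(\<lambda>n. c * (\<integral>x. p n x * \<theta> x \<partial>\<nu>) + (\<integral>x. p n x * t x \<partial>\<nu>)) \<longlonglongrightarrow> c * 0 + 0"
      using coeff[OF characters_cnj[OF step(1)]] step by (intro tendsto_intros) auto
    ultimately show ?case by simp
  qed
  show ?thesis
  proof (rule LIMSEQ_I)
    fix \<epsilon> :: real assume \<epsilon>: "\<epsilon> > 0"
    then obtain N where N: "\<And>m n. m \<ge> N \<Longrightarrow> n \<ge> N \<Longrightarrow> (\<integral>x. cmod (p m x - p n x) \<partial>\<nu>) < \<epsilon> / 8"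
      using Cauchy[of "\<epsilon> / 8"] by auto
    obtain t where t: "t \<in> trig_span characters" "\<And>x. cmod (t x) \<le> 2"
      "\<And>x. cmod (p N x) \<le> Re (p N x * t x) + \<epsilon> / 8"
      using trig_phase_approximation[OF p[of N], of "\<epsilon> / 8"] \<epsilon> by auto
    obtain M where M: "\<And>m. m \<ge> M \<Longrightarrow> cmod (\<integral>x. p m x * t x \<partial>\<nu>) < \<epsilon> / 8"
      using LIMSEQ_D[OF test[OF t(1)], of "\<epsilon> / 8"] \<epsilon> by auto
    define m where "m = max M N"
    have diff: "integrable \<nu> (\<lambda>x. p N x - p m x)"
      using int by auto
    have "(\<integral>x. cmod (p N x) \<partial>\<nu>) \<le> (\<integral>x. Re (p N x * t x) + \<epsilon> / 8 \<partial>\<nu>)"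
    proof (rule integral_mono)
      show "integrable \<nu> (\<lambda>x. Re (p N x * t x) + \<epsilon> / 8)"
        using integrable_Re[OF integrable_mult_trig_span(1)[OF int[of N] t(1) order_refl]]
        by (intro Bochner_Integration.integrable_add) auto
    qed (use int t(3) in auto)
    also have "\<dots> = Re (\<integral>x. p N x * t x \<partial>\<nu>) + \<epsilon> / 8"
      using integrable_mult_trig_span(1)[OF int t(1) order_refl, of N]
      by (subst Bochner_Integration.integral_add)
        (auto simp: prob_space[simplified] simp del: times_complex.sel)
    also have "(\<integral>x. p N x * t x \<partial>\<nu>) = (\<integral>x. (p N x - p m x) * t x + p m x * t x \<partial>\<nu>)"
      by (simp add: algebra_simps)
    also have "\<dots> = (\<integral>x. (p N x - p m x) * t x \<partial>\<nu>) + (\<integral>x. p m x * t x \<partial>\<nu>)"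
      using integrable_mult_trig_span(1)[OF int t(1) order_refl]
        integrable_mult_trig_span(1)[OF diff t(1) order_refl]
      by (rule Bochner_Integration.integral_add[rotated])
    also have "Re \<dots> + \<epsilon> / 8 \<le> cmod (\<integral>x. (p N x - p m x) * t x \<partial>\<nu>) + cmod (\<integral>x. p m x * t x \<partial>\<nu>) + \<epsilon> / 8"
      by (intro add_right_mono order_trans[OF complex_Re_le_cmod] norm_triangle_ineq)
    also have "\<dots> \<le> 2 * (\<integral>x. cmod (p N x - p m x) \<partial>\<nu>) + \<epsilon> / 8 + \<epsilon> / 8"
      using norm_integral_mult_trig_le[OF diff t(1,2)] M[of m] by (simp add: m_def)
    also have "\<dots> \<le> \<epsilon> / 2"
      using N[of N m] by (simp add: m_def)
    finally have pN: "(\<integral>x. cmod (p N x) \<partial>\<nu>) \<le> \<epsilon> / 2" .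
    have "norm ((\<integral>x. cmod (p n x) \<partial>\<nu>) - 0) < \<epsilon>" if "n \<ge> N" for n
    proof -
      have "(\<integral>x. cmod (p n x) \<partial>\<nu>) \<le> (\<integral>x. cmod (p n x - p N x) + cmod (p N x) \<partial>\<nu>)"
        using int norm_triangle_sub[of "p n _" "p N _"]
        by (intro integral_mono) (auto simp: add.commute)
      also have "\<dots> = (\<integral>x. cmod (p n x - p N x) \<partial>\<nu>) + (\<integral>x. cmod (p N x) \<partial>\<nu>)"
        using int by (intro Bochner_Integration.integral_add) auto
      also have "\<dots> < \<epsilon>"
        using N[OF that order_refl] pN \<epsilon> by linarith
      finally show ?thesis by simp
    qed
    then show "\<exists>N. \<forall>n\<ge>N. norm ((\<integral>x. cmod (p n x) \<partial>\<nu>) - 0) < \<epsilon>" by blast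
  qed
qed

lemma integrable_real_pol: "q \<in> real_pol \<Longrightarrow> integrable \<nu> q"
  using integrable_Re[OF integrable_trig_span[OF _ order_refl, of "\<lambda>x. of_real (q x)"]]
  by (simp add: real_pol_def)

end

locale ordered_haar_group = haar_group \<nu>
  for \<nu> :: "'g::{topological_ab_group_add, t2_space} measure" +
  fixes r :: "(('g \<Rightarrow> complex) \<times> ('g \<Rightarrow> complex)) set"
  assumes order: "group_order r"
begin

abbreviation "P \<equiv> positive_characters r"

lemmas P_subset = positive_characters_subset(2)[of r]

lemma integrable_P: "p \<in> trig_span P \<Longrightarrow> integrable \<nu> p"
  by (rule integrable_trig_span[OF _ P_subset])

lemma norm_1star_nonneg: "q \<in> real_pol \<Longrightarrow> 0 \<le> norm_1star \<nu> r q"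
  by (auto elim!: real_pol_decomposition[OF order] simp: norm_1star_eq[OF order])

lemma norm_1star_triangle:
  assumes "a \<in> real_pol" "b \<in> real_pol"
  shows "norm_1star \<nu> r (\<lambda>x. a x + b x) \<le> norm_1star \<nu> r a + norm_1star \<nu> r b"
proof -
  obtain c p where p: "p \<in> trig_span P" and a: "a = (\<lambda>x. c + 2 * Re (p x))"
    using real_pol_decomposition[OF order assms(1)] .
  obtain d q where q: "q \<in> trig_span P" and b: "b = (\<lambda>x. d + 2 * Re (q x))"
    using real_pol_decomposition[OF order assms(2)] .
  have eq: "(\<lambda>x. a x + b x) = (\<lambda>x. (c + d) + 2 * Re (p x + q x))"
    by (auto simp: a b)
  have L1: "(\<integral>x. cmod (f x + g x) \<partial>\<nu>) \<le> (\<integral>x. cmod (f x) \<partial>\<nu>) + (\<integral>x. cmod (g x) \<partial>\<nu>)"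
    if "integrable \<nu> f" "integrable \<nu> g" for f g :: "'g \<Rightarrow> complex"
    using that integral_mono[of \<nu> "\<lambda>x. cmod (f x + g x)" "\<lambda>x. cmod (f x) + cmod (g x)"]
    by (auto simp: norm_triangle_ineq)
  show ?thesis
    unfolding eq norm_1star_eq[OF order trig_span_add[OF p q]]
    unfolding a b norm_1star_eq[OF order p] norm_1star_eq[OF order q]
    using L1[OF integrable_P[OF p] integrable_P[OF q]]
      L1[of "\<lambda>x. of_real c + p x" "\<lambda>x. of_real d + q x"] integrable_P[OF p] integrable_P[OF q]
    by (auto simp: algebra_simps)
qed

lemma norm_1star_minus:
  assumes "a \<in> real_pol"
  shows "norm_1star \<nu> r (\<lambda>x. - a x) = norm_1star \<nu> r a"
proof -
  obtain c p where p: "p \<in> trig_span P" and a: "a = (\<lambda>x. c + 2 * Re (p x))"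
    using real_pol_decomposition[OF order assms(1)] .
  have eq: "(\<lambda>x. - a x) = (\<lambda>x. (- c) + 2 * Re (- 1 * p x))"
    by (auto simp: a)
  have "cmod (- of_real c - p x) = cmod (of_real c + p x)" for x
    by (metis minus_add_distrib norm_minus_cancel uminus_add_conv_diff add.commute)
  moreover have "norm_1star \<nu> r (\<lambda>x. - a x)
      = (\<integral>x. cmod (- 1 * p x) \<partial>\<nu>) + (\<integral>x. cmod (of_real (- c) + - 1 * p x) \<partial>\<nu>)"
    unfolding eq by (rule norm_1star_eq[OF order trig_span_scale[OF p]])
  ultimately show ?thesis
    unfolding a norm_1star_eq[OF order p] by simp
qed

lemma norm_1star_diff_le:
  assumes "a \<in> real_pol" "b \<in> real_pol"
  shows "norm_1star \<nu> r (\<lambda>x. a x - b x) \<le> norm_1star \<nu> r a + norm_1star \<nu> r b"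
proof -
  have "(\<lambda>x. - b x) \<in> real_pol"
    using real_pol_diff[OF real_pol_const[of 0] assms(2)] by simp
  from norm_1star_triangle[OF assms(1) this] show ?thesis
    using norm_1star_minus[OF assms(2)] by simp
qed

lemma norm_1star_reverse_triangle:
  assumes "a \<in> real_pol" "b \<in> real_pol"
  shows "\<bar>norm_1star \<nu> r a - norm_1star \<nu> r b\<bar> \<le> norm_1star \<nu> r (\<lambda>x. a x - b x)"
proof -
  have "norm_1star \<nu> r a \<le> norm_1star \<nu> r (\<lambda>x. a x - b x) + norm_1star \<nu> r b"
    using norm_1star_triangle[OF real_pol_diff[OF assms] assms(2)] by simp
  moreover have "norm_1star \<nu> r b \<le> norm_1star \<nu> r a + norm_1star \<nu> r (\<lambda>x. a x - b x)"
    using norm_1star_diff_le[OF assms(1) real_pol_diff[OF assms]] by simp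
  ultimately show ?thesis by simp
qed

text \<open>
  The completion embeds in \<open>L\<^sup>1\<close>: a Cauchy sequence that vanishes in \<open>L\<^sup>1\<close> has all its Fourier
  coefficients tending to zero, hence so do those of its positive parts.
\<close>

lemma norm_1star_tendsto_zero:
  assumes d: "\<And>n. d n \<in> real_pol"
    and Cauchy: "\<And>\<epsilon>. \<epsilon> > 0 \<Longrightarrow> \<exists>N. \<forall>m\<ge>N. \<forall>n\<ge>N. norm_1star \<nu> r (\<lambda>x. d m x - d n x) < \<epsilon>"
    and L1: "(\<lambda>n. \<integral>x. \<bar>d n x\<bar> \<partial>\<nu>) \<longlonglongrightarrow> 0"
  shows "(\<lambda>n. norm_1star \<nu> r (d n)) \<longlonglongrightarrow> 0"
proof -
  have "\<forall>n. \<exists>c p. p \<in> trig_span P \<and> d n = (\<lambda>x. c + 2 * Re (p x))"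
    using real_pol_decomposition[OF order d] by metis
  then obtain c p where p: "\<And>n. p n \<in> trig_span P" and d_eq: "\<And>n. d n = (\<lambda>x. c n + 2 * Re (p n x))"
    by metis
  have p': "p n \<in> trig_span characters" for n
    using p trig_span_mono[OF P_subset] by blast
  have int: "integrable \<nu> (p n)" and int_d: "integrable \<nu> (d n)" for n
    using integrable_P[OF p] integrable_real_pol[OF d] by auto
  have unit: "(\<lambda>_. 1) \<notin> P"
    by (simp add: positive_characters_def)
  have mean: "(\<integral>x. p n x \<partial>\<nu>) = 0" for n
    using integral_trig_span_orthogonal[OF p P_subset characters_one unit] by simp
  have c_eq: "c n = (\<integral>x. d n x \<partial>\<nu>)" for n
    using int[of n] mean[of n] by (simp add: d_eq prob_space[simplified])
  have c_lim: "c \<longlonglongrightarrow> 0"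
  proof (rule Lim_null_comparison[OF _ L1])
    have "norm (c n) \<le> (\<integral>x. \<bar>d n x\<bar> \<partial>\<nu>)" for n
      unfolding c_eq using integral_norm_bound[of \<nu> "d n"] by simp
    then show "\<forall>\<^sub>F n in sequentially. norm (c n) \<le> (\<integral>x. \<bar>d n x\<bar> \<partial>\<nu>)" by simp
  qed
  have p_lim: "(\<lambda>n. \<integral>x. cmod (p n x) \<partial>\<nu>) \<longlonglongrightarrow> 0"
  proof (rule L1_limit_zero_of_coefficients[OF p'])
    fix \<epsilon> :: real assume "\<epsilon> > 0"
    then obtain N where N: "\<And>m n. m \<ge> N \<Longrightarrow> n \<ge> N \<Longrightarrow> norm_1star \<nu> r (\<lambda>x. d m x - d n x) < \<epsilon>"
      using Cauchy by blast
    have "(\<integral>x. cmod (p m x - p n x) \<partial>\<nu>) \<le> norm_1star \<nu> r (\<lambda>x. d m x - d n x)" for m n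
    proof -
      have "(\<lambda>x. d m x - d n x) = (\<lambda>x. (c m - c n) + 2 * Re (p m x - p n x))"
        by (auto simp: d_eq)
      then show ?thesis
        using norm_1star_eq[OF order trig_span_diff[OF p p]] by simp
    qed
    with N show "\<exists>N. \<forall>m\<ge>N. \<forall>n\<ge>N. (\<integral>x. cmod (p m x - p n x) \<partial>\<nu>) < \<epsilon>"
      by (meson order_le_less_trans)
  next
    fix \<psi> :: "'g \<Rightarrow> complex" assume \<psi>: "\<psi> \<in> characters"
    show "(\<lambda>n. \<integral>x. p n x * cnj (\<psi> x) \<partial>\<nu>) \<longlonglongrightarrow> 0"
    proof (cases "\<psi> \<in> P")
      case False
      then show ?thesis
        using integral_trig_span_orthogonal[OF p P_subset \<psi>] by simp
    next
      case True
      let ?M = "characters - characters_plus r"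
      have M: "(\<lambda>x. cnj (p n x)) \<in> trig_span ?M" for n
        using p by (rule trig_span_cnj) (rule cnj_positive_character[OF order])
      have \<psi>span: "\<psi> \<in> trig_span characters"
        by (rule trig_span_base[OF \<psi>])
      have \<psi>ne: "\<psi> \<noteq> (\<lambda>_. 1)" "\<psi> \<notin> ?M"
        using True by (auto simp: positive_characters_def)
      have coeff_d: "(\<integral>x. p n x * cnj (\<psi> x) \<partial>\<nu>) = (\<integral>x. of_real (d n x) * cnj (\<psi> x) \<partial>\<nu>)" for n
      proof -
        have i1: "integrable \<nu> (\<lambda>x. p n x * cnj (\<psi> x))"
          by (rule integrable_mult_trig_span(3)[OF int \<psi>span order_refl])
        have i2: "integrable \<nu> (\<lambda>x. cnj (p n x) * cnj (\<psi> x))"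
          by (rule integrable_mult_trig_span(3)[OF _ \<psi>span order_refl]) (use int in simp)
        have i3: "integrable \<nu> (\<lambda>x. of_real (c n) * cnj (\<psi> x))"
          by (rule integrable_mult_trig_span(3)[OF _ \<psi>span order_refl]) simp
        have d_split: "complex_of_real (d n x) = of_real (c n) + (p n x + cnj (p n x))" for x
          by (simp add: d_eq complex_add_cnj)
        have "(\<integral>x. of_real (d n x) * cnj (\<psi> x) \<partial>\<nu>)
            = (\<integral>x. of_real (c n) * cnj (\<psi> x) + (p n x * cnj (\<psi> x) + cnj (p n x) * cnj (\<psi> x)) \<partial>\<nu>)"
          by (simp add: d_split algebra_simps)
        also have "\<dots> = (\<integral>x. of_real (c n) * cnj (\<psi> x) \<partial>\<nu>)
            + ((\<integral>x. p n x * cnj (\<psi> x) \<partial>\<nu>) + (\<integral>x. cnj (p n x) * cnj (\<psi> x) \<partial>\<nu>))"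
          using i1 i2 i3 by simp
        also have "(\<integral>x. cnj (p n x) * cnj (\<psi> x) \<partial>\<nu>) = 0"
          by (rule integral_trig_span_orthogonal[OF M _ \<psi> \<psi>ne(2)]) auto
        also have "(\<integral>x. of_real (c n) * cnj (\<psi> x) \<partial>\<nu>) = 0"
          using \<psi>ne(1) character_orthonormal[OF characters_one \<psi>] by simp
        finally show ?thesis by simp
      qed
      have "norm (\<integral>x. of_real (d n x) * cnj (\<psi> x) \<partial>\<nu>) \<le> (\<integral>x. \<bar>d n x\<bar> \<partial>\<nu>)" for n
        using integral_norm_bound[of \<nu> "\<lambda>x. of_real (d n x) * cnj (\<psi> x)"] \<psi>
        by (simp add: norm_mult norm_character)
      then show ?thesis
        unfolding coeff_d by (intro Lim_null_comparison[OF _ L1]) simp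
    qed
  qed
  have bound: "norm_1star \<nu> r (d n) \<le> 2 * (\<integral>x. cmod (p n x) \<partial>\<nu>) + \<bar>c n\<bar>" for n
  proof -
    have "(\<integral>x. cmod (of_real (c n) + p n x) \<partial>\<nu>) \<le> (\<integral>x. \<bar>c n\<bar> + cmod (p n x) \<partial>\<nu>)"
      using int[of n] by (intro integral_mono) (auto intro: norm_triangle_le)
    then show ?thesis
      using int[of n] unfolding d_eq norm_1star_eq[OF order p] by (simp add: prob_space[simplified])
  qed
  have "(\<lambda>n. 2 * (\<integral>x. cmod (p n x) \<partial>\<nu>) + \<bar>c n\<bar>) \<longlonglongrightarrow> 2 * 0 + \<bar>0\<bar>"
    by (intro tendsto_intros p_lim c_lim)
  then have lim: "(\<lambda>n. 2 * (\<integral>x. cmod (p n x) \<partial>\<nu>) + \<bar>c n\<bar>) \<longlonglongrightarrow> 0"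
    by simp
  show ?thesis
    by (rule Lim_null_comparison[OF _ lim]) (simp add: bound norm_1star_nonneg[OF d])
qed

text \<open>
  Two sequences approximating the same function differ by a null sequence of the completed norm, so
  the limit of the norms does not depend on the sequence and the definite description of the norm
  denotes it.
\<close>

lemma real_hardy_norm_limit:
  assumes f: "integrable \<nu> f" and q: "hardy_approx \<nu> r q f"
  shows "(\<lambda>n. norm_1star \<nu> r (q n)) \<longlonglongrightarrow> real_hardy_norm \<nu> r f"
proof -
  have "Cauchy (\<lambda>n. norm_1star \<nu> r (q n))"
    unfolding Cauchy_def dist_real_def
  proof (intro allI impI)
    fix \<epsilon> :: real assume "\<epsilon> > 0"
    then obtain N where "\<And>m n. m \<ge> N \<Longrightarrow> n \<ge> N \<Longrightarrow> norm_1star \<nu> r (\<lambda>x. q m x - q n x) < \<epsilon>"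
      using q unfolding hardy_approx_def by blast
    then show "\<exists>N. \<forall>m\<ge>N. \<forall>n\<ge>N. \<bar>norm_1star \<nu> r (q m) - norm_1star \<nu> r (q n)\<bar> < \<epsilon>"
      using norm_1star_reverse_triangle q unfolding hardy_approx_def by (meson order_le_less_trans)
  qed
  then obtain l where l: "(\<lambda>n. norm_1star \<nu> r (q n)) \<longlonglongrightarrow> l"
    using Cauchy_convergent unfolding convergent_def by blast
  have unique: "l' = l"
    if q': "hardy_approx \<nu> r q' f" and l': "(\<lambda>n. norm_1star \<nu> r (q' n)) \<longlonglongrightarrow> l'" for q' l'
  proof -
    have pol: "q n \<in> real_pol" "q' n \<in> real_pol" for n
      using q q' by (auto simp: hardy_approx_def)
    have approx_Cauchy: "\<exists>N. \<forall>m\<ge>N. \<forall>n\<ge>N. norm_1star \<nu> r (\<lambda>x. s m x - s n x) < \<epsilon>"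
      if "hardy_approx \<nu> r s f" "\<epsilon> > 0" for s \<epsilon>
      using that unfolding hardy_approx_def by blast
    have lim: "(\<lambda>n. norm_1star \<nu> r (\<lambda>x. q n x - q' n x)) \<longlonglongrightarrow> 0"
    proof (rule norm_1star_tendsto_zero)
      show "(\<lambda>x. q n x - q' n x) \<in> real_pol" for n
        by (intro real_pol_diff pol)
      show "\<exists>N. \<forall>m\<ge>N. \<forall>n\<ge>N. norm_1star \<nu> r (\<lambda>x. (q m x - q' m x) - (q n x - q' n x)) < \<epsilon>"
        if pos: "\<epsilon> > 0" for \<epsilon>
      proof -
        obtain N where N: "\<And>m n. m \<ge> N \<Longrightarrow> n \<ge> N \<Longrightarrow> norm_1star \<nu> r (\<lambda>x. q m x - q n x) < \<epsilon> / 2"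
          using approx_Cauchy[OF q, of "\<epsilon> / 2"] pos by auto
        obtain N' where N': "\<And>m n. m \<ge> N' \<Longrightarrow> n \<ge> N' \<Longrightarrow> norm_1star \<nu> r (\<lambda>x. q' m x - q' n x) < \<epsilon> / 2"
          using approx_Cauchy[OF q', of "\<epsilon> / 2"] pos by auto
        show ?thesis
        proof (intro exI[of _ "max N N'"] allI impI)
          fix m n assume mn: "max N N' \<le> m" "max N N' \<le> n"
          have "(\<lambda>x. (q m x - q' m x) - (q n x - q' n x)) = (\<lambda>x. (q m x - q n x) - (q' m x - q' n x))"
            by auto
          then have "norm_1star \<nu> r (\<lambda>x. (q m x - q' m x) - (q n x - q' n x))
              \<le> norm_1star \<nu> r (\<lambda>x. q m x - q n x) + norm_1star \<nu> r (\<lambda>x. q' m x - q' n x)"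
            using norm_1star_diff_le[OF real_pol_diff[OF pol(1) pol(1)] real_pol_diff[OF pol(2) pol(2)]]
            by simp
          then show "norm_1star \<nu> r (\<lambda>x. (q m x - q' m x) - (q n x - q' n x)) < \<epsilon>"
            using N[of m n] N'[of m n] mn by simp
        qed
      qed
      show "(\<lambda>n. \<integral>x. \<bar>q n x - q' n x\<bar> \<partial>\<nu>) \<longlonglongrightarrow> 0"
      proof (rule Lim_null_comparison)
        have "(\<lambda>n. (\<integral>x. \<bar>q n x - f x\<bar> \<partial>\<nu>) + (\<integral>x. \<bar>q' n x - f x\<bar> \<partial>\<nu>)) \<longlonglongrightarrow> 0 + 0"
          using q q' unfolding hardy_approx_def by (intro tendsto_intros) auto
        then show "(\<lambda>n. (\<integral>x. \<bar>q n x - f x\<bar> \<partial>\<nu>) + (\<integral>x. \<bar>q' n x - f x\<bar> \<partial>\<nu>)) \<longlonglongrightarrow> 0"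
          by simp
        have "norm (\<integral>x. \<bar>q n x - q' n x\<bar> \<partial>\<nu>) \<le> (\<integral>x. \<bar>q n x - f x\<bar> \<partial>\<nu>) + (\<integral>x. \<bar>q' n x - f x\<bar> \<partial>\<nu>)" for n
        proof -
          have i: "integrable \<nu> (q n)" "integrable \<nu> (q' n)"
            using integrable_real_pol pol by auto
          have "(\<integral>x. \<bar>q n x - q' n x\<bar> \<partial>\<nu>) \<le> (\<integral>x. \<bar>q n x - f x\<bar> + \<bar>q' n x - f x\<bar> \<partial>\<nu>)"
            using i f by (intro integral_mono) auto
          then show ?thesis
            using i f by simp
        qed
        then show "\<forall>\<^sub>F n in sequentially. norm (\<integral>x. \<bar>q n x - q' n x\<bar> \<partial>\<nu>)
            \<le> (\<integral>x. \<bar>q n x - f x\<bar> \<partial>\<nu>) + (\<integral>x. \<bar>q' n x - f x\<bar> \<partial>\<nu>)"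
          by simp
      qed
    qed
    have "(\<lambda>n. norm_1star \<nu> r (q n) - norm_1star \<nu> r (q' n)) \<longlonglongrightarrow> 0"
      by (rule Lim_null_comparison[OF _ lim]) (simp add: norm_1star_reverse_triangle pol)
    moreover have "(\<lambda>n. norm_1star \<nu> r (q n) - norm_1star \<nu> r (q' n)) \<longlonglongrightarrow> l - l'"
      by (intro tendsto_diff l l')
    ultimately show ?thesis
      using LIMSEQ_unique by fastforce
  qed
  have "real_hardy_norm \<nu> r f = l"
    unfolding real_hardy_norm_def
    by (rule the_equality) (use l q unique in blast)+
  with l show ?thesis by simp
qed

end

section \<open>Invariance of Haar measure under automorphisms\<close>

lemma Urysohn_compact_group:
  fixes K :: "'g::t2_space set"
  assumes "compact (UNIV :: 'g set)" "compact K" "open U" "K \<subseteq> U"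
  obtains f :: "'g \<Rightarrow> real"
  where "continuous_on UNIV f" "\<And>x. 0 \<le> f x" "\<And>x. f x \<le> 1"
    "\<And>x. x \<in> K \<Longrightarrow> f x = 1" "\<And>x. x \<notin> U \<Longrightarrow> f x = 0"
proof -
  have "\<exists>V W. open V \<and> open W \<and> x \<in> V \<and> y \<in> W \<and> disjnt V W" if "x \<noteq> y" for x y :: 'g
    using hausdorff[OF that] by (auto simp: disjnt_def)
  then have "Hausdorff_space (euclidean :: 'g topology)"
    unfolding Hausdorff_space_def by simp
  moreover have "compact_space (euclidean :: 'g topology)"
    using assms(1) by (simp add: compact_space_def)
  ultimately have "normal_space (euclidean :: 'g topology)"
    by (simp add: compact_Hausdorff_or_regular_imp_normal_space)
  moreover have "closedin (euclidean :: 'g topology) (- U)" "closedin (euclidean :: 'g topology) K"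
    using assms by (auto simp: compact_imp_closed)
  moreover have "disjnt (- U) K"
    using assms by (auto simp: disjnt_def)
  ultimately obtain f where f: "continuous_map (euclidean :: 'g topology) (top_of_set {0..1::real}) f"
    "f ` (- U) \<subseteq> {0}" "f ` K \<subseteq> {1}"
    by (rule Urysohn_lemma[of euclidean "- U" K 0 1]) auto
  have "continuous_on UNIV f" "range f \<subseteq> {0..1}"
    using f(1) by (auto simp: continuous_map_in_subtopology)
  moreover have "f x = 1" if "x \<in> K" for x
    using f(3) that by blast
  moreover have "f x = 0" if "x \<notin> U" for x
    using f(2) that by blast
  ultimately show ?thesis
    by (intro that[of f]) (auto simp: image_subset_iff)
qed

text \<open>
  By compactness the translates of \<open>f\<close> vary continuously in the uniform norm, so \<open>f (x + z)\<close> is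
  uniformly close to a function that depends on \<open>z\<close> only through a measurable map with finitely many
  values. This replaces joint measurability of
  addition, which may fail for the product of the Borel \<open>\<sigma>\<close>-algebras when the topology has no
  countable base.
\<close>

lemma finite_translate_approximation:
  fixes f :: "'g::topological_ab_group_add \<Rightarrow> real"
  assumes compact: "compact (UNIV :: 'g set)" and f: "continuous_on UNIV f" and \<epsilon>: "\<epsilon> > 0"
  obtains k :: "'g \<Rightarrow> nat" and y :: "nat \<Rightarrow> 'g"
  where "k \<in> measurable borel (count_space UNIV)" "\<And>x z. \<bar>f (x + z) - f (x + y (k z))\<bar> < \<epsilon>"
proof -
  have "\<exists>V. open V \<and> a \<in> V \<and> (\<forall>x. \<forall>z\<in>V. \<bar>f (x + z) - f (x + a)\<bar> < \<epsilon>)" for a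
  proof -
    define W where "W = {w :: 'g \<times> 'g. \<bar>f (fst w + snd w) - f (fst w + a)\<bar> < \<epsilon>}"
    have "continuous_on UNIV (\<lambda>w :: 'g \<times> 'g. \<bar>f (fst w + snd w) - f (fst w + a)\<bar>)"
      by (intro continuous_intros continuous_on_compose2[OF f]) auto
    then have "open W"
      unfolding W_def by (intro open_Collect_less) auto
    then have "openin (prod_topology euclidean euclidean) W"
      by simp
    moreover have "UNIV \<times> {a} \<subseteq> W"
      using \<epsilon> by (auto simp: W_def)
    ultimately have "\<exists>U V. openin euclidean U \<and> openin euclidean V \<and> UNIV \<subseteq> U \<and> a \<in> V \<and> U \<times> V \<subseteq> W"
      using compact by (intro tube_lemma_left) auto
    then obtain U V where "open V" "UNIV \<subseteq> U" "a \<in> V" "U \<times> V \<subseteq> W"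
      by auto
    moreover from this have "(x, z) \<in> W" if "z \<in> V" for x z
      using that by blast
    ultimately show ?thesis
      by (intro exI[of _ V]) (auto simp: W_def)
  qed
  then obtain V where V: "\<And>a. open (V a)" "\<And>a. a \<in> V a"
    "\<And>a x z. z \<in> V a \<Longrightarrow> \<bar>f (x + z) - f (x + a)\<bar> < \<epsilon>"
    by metis
  obtain F where F: "finite F" "UNIV \<subseteq> (\<Union>a\<in>F. V a)"
    by (rule compactE_image[OF compact, of UNIV V]) (use V(1,2) in auto)
  obtain ys where ys: "set ys = F"
    using finite_list[OF F(1)] by auto
  define k where "k = (\<lambda>z. LEAST i. i < length ys \<and> z \<in> V (ys ! i))"
  have k: "k z < length ys \<and> z \<in> V (ys ! k z)" for z
  proof -
    obtain a where "a \<in> set ys" "z \<in> V a"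
      using F(2) ys by blast
    then have "\<exists>i. i < length ys \<and> z \<in> V (ys ! i)"
      by (metis in_set_conv_nth)
    then show ?thesis
      unfolding k_def by (rule LeastI_ex)
  qed
  have "{z \<in> space borel. i < length ys \<and> z \<in> V (ys ! i)} \<in> sets borel" for i
    using V(1) by (cases "i < length ys") auto
  then have "Measurable.pred borel (\<lambda>z. i < length ys \<and> z \<in> V (ys ! i))" for i
    by (simp only: pred_def)
  then have "k \<in> measurable borel (count_space UNIV)"
    unfolding k_def by (rule measurable_Least)
  then show ?thesis
    by (rule that[of k "\<lambda>i. ys ! i"]) (use k V(3) in auto)
qed

context haar_group
begin

text \<open>
  Integrate \<open>f (x + z)\<close> over both variables: invariance of either measure removes one variable.
  The two iterated integrals are compared through the finitely valued approximation, to which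
  Fubini's theorem applies.
\<close>

lemma integral_eq_of_invariant:
  fixes f :: "'g \<Rightarrow> real"
  assumes \<kappa>: "haar_group \<kappa>" and f: "continuous_on UNIV f"
  shows "(\<integral>x. f x \<partial>\<nu>) = (\<integral>x. f x \<partial>\<kappa>)"
proof -
  interpret L: haar_group \<kappa> by (rule \<kappa>)
  interpret pair_sigma_finite \<nu> \<kappa> by standard
  have "bounded (range f)"
    using compact_continuous_image[OF f compact_group] compact_imp_bounded by blast
  then obtain B where B: "\<And>x. \<bar>f x\<bar> \<le> B"
    unfolding bounded_iff by auto
  have meas: "(\<lambda>x. f (x + a)) \<in> borel_measurable \<nu>" "(\<lambda>x. f (a + x)) \<in> borel_measurable \<kappa>"
    "(\<lambda>x. f x) \<in> borel_measurable \<nu>" "(\<lambda>x. f x) \<in> borel_measurable \<kappa>" for a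
    by (intro measurable_continuous L.measurable_continuous continuous_on_compose2[OF f]
        continuous_intros; simp)+
  have "\<bar>(\<integral>x. f x \<partial>\<nu>) - (\<integral>x. f x \<partial>\<kappa>)\<bar> \<le> \<epsilon>" if \<epsilon>: "\<epsilon> > 0" for \<epsilon>
  proof -
    obtain k :: "'g \<Rightarrow> nat" and y where k: "k \<in> measurable borel (count_space UNIV)"
      and close: "\<And>x z. \<bar>f (x + z) - f (x + y (k z))\<bar> < \<epsilon>"
      using finite_translate_approximation[OF compact_group f \<epsilon>] by metis
    have k': "k \<in> measurable \<kappa> (count_space UNIV)"
      using k by (simp add: measurable_cong_sets[OF L.sets_haar refl])
    define F where "F = (\<lambda>(x, z). f (x + y (k z)))"
    have F: "F \<in> borel_measurable (\<nu> \<Otimes>\<^sub>M \<kappa>)"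
    proof -
      have "(\<lambda>w. f (fst w + y i)) \<in> borel_measurable (\<nu> \<Otimes>\<^sub>M \<kappa>)" for i
        using measurable_compose[OF measurable_fst meas(1)] .
      moreover have "(\<lambda>w. k (snd w)) \<in> measurable (\<nu> \<Otimes>\<^sub>M \<kappa>) (count_space UNIV)"
        using measurable_compose[OF measurable_snd k'] .
      ultimately have "(\<lambda>w. f (fst w + y (k (snd w)))) \<in> borel_measurable (\<nu> \<Otimes>\<^sub>M \<kappa>)"
        by (rule measurable_compose_countable)
      then show ?thesis
        by (simp add: F_def case_prod_beta')
    qed
    interpret pair: pair_prob_space \<nu> \<kappa> by standard
    have int: "integrable (\<nu> \<Otimes>\<^sub>M \<kappa>) F"
      by (rule pair.integrable_const_bound[OF _ F, where B = B]) (auto simp: F_def B)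
    have int_x: "integrable \<nu> (\<lambda>x. \<integral>z. F (x, z) \<partial>\<kappa>)"
      by (rule integrable_fst'[OF int])
    have x_bound: "\<bar>(\<integral>z. F (x, z) \<partial>\<kappa>) - (\<integral>z. f z \<partial>\<kappa>)\<bar> \<le> \<epsilon>" for x
    proof -
      have Fx: "integrable \<kappa> (\<lambda>z. F (x, z))"
        using measurable_compose_Pair1[OF _ F, of x] B
        by (intro L.integrable_bounded[where B = B]) (auto simp: F_def)
      have fx: "integrable \<kappa> (\<lambda>z. f (x + z))"
        using B by (intro L.integrable_bounded[where B = B] meas) auto
      have "(\<integral>z. F (x, z) \<partial>\<kappa>) - (\<integral>z. f z \<partial>\<kappa>) = (\<integral>z. F (x, z) - f (x + z) \<partial>\<kappa>)"
        using L.integral_translate[OF meas(4), of x] Fx fx by simp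
      also have "\<bar>\<dots>\<bar> \<le> (\<integral>z. \<bar>F (x, z) - f (x + z)\<bar> \<partial>\<kappa>)"
        using integral_norm_bound[of \<kappa> "\<lambda>z. F (x, z) - f (x + z)"] by simp
      also have "\<dots> \<le> (\<integral>z. \<epsilon> \<partial>\<kappa>)"
        using Fx fx close[of x]
        by (intro integral_mono) (auto simp: F_def abs_minus_commute less_imp_le)
      finally show ?thesis by (simp add: L.prob_space[simplified])
    qed
    have "(\<integral>x. F (x, z) \<partial>\<nu>) = (\<integral>x. f x \<partial>\<nu>)" for z
      using integral_translate[OF meas(3), of "y (k z)"]
      by (simp add: F_def add.commute[of _ "y (k z)"])
    then have "(\<integral>x. f x \<partial>\<nu>) = (\<integral>z. (\<integral>x. F (x, z) \<partial>\<nu>) \<partial>\<kappa>)"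
      by (simp add: L.prob_space[simplified])
    also have "\<dots> = (\<integral>x. (\<integral>z. F (x, z) \<partial>\<kappa>) \<partial>\<nu>)"
      using Fubini_integral[of "\<lambda>x z. F (x, z)"] int by simp
    finally have "(\<integral>x. f x \<partial>\<nu>) - (\<integral>z. f z \<partial>\<kappa>) = (\<integral>x. (\<integral>z. F (x, z) \<partial>\<kappa>) - (\<integral>z. f z \<partial>\<kappa>) \<partial>\<nu>)"
      using int_x by (simp add: prob_space[simplified])
    also have "\<bar>\<dots>\<bar> \<le> (\<integral>x. \<bar>(\<integral>z. F (x, z) \<partial>\<kappa>) - (\<integral>z. f z \<partial>\<kappa>)\<bar> \<partial>\<nu>)"
      using integral_norm_bound[of \<nu> "\<lambda>x. (\<integral>z. F (x, z) \<partial>\<kappa>) - (\<integral>z. f z \<partial>\<kappa>)"] by simp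
    also have "\<dots> \<le> (\<integral>x. \<epsilon> \<partial>\<nu>)"
      using int_x x_bound by (intro integral_mono) auto
    finally show ?thesis by (simp add: prob_space[simplified])
  qed
  then have "\<bar>(\<integral>x. f x \<partial>\<nu>) - (\<integral>x. f x \<partial>\<kappa>)\<bar> \<le> 0"
    by (rule field_le_epsilon[of _ 0, simplified])
  then show ?thesis by simp
qed

lemma outer_regular:
  "B \<in> sets borel \<Longrightarrow> emeasure \<nu> B = (INF U\<in>{U. open U \<and> B \<subseteq> U}. emeasure \<nu> U)"
  using haar unfolding normalized_haar_def by blast

lemma inner_regular:
  "open U \<Longrightarrow> emeasure \<nu> U = (SUP K\<in>{K. compact K \<and> K \<subseteq> U}. emeasure \<nu> K)"
  using haar unfolding normalized_haar_def by blast

text \<open>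
  Equality on continuous functions gives an inequality between a compact set and an open set around
  it, by a Urysohn function. Inner regularity of the smaller measure extends it to open sets, and
  outer regularity of the larger one to Borel sets.
\<close>

lemma haar_le_of_invariant:
  assumes \<kappa>: "haar_group \<kappa>" and B: "B \<in> sets borel"
  shows "emeasure \<nu> B \<le> emeasure \<kappa> B"
proof -
  interpret L: haar_group \<kappa> by (rule \<kappa>)
  have compact_open: "emeasure \<nu> K \<le> emeasure \<kappa> U" if KU: "compact K" "open U" "K \<subseteq> U" for K U
  proof -
    obtain f where f: "continuous_on UNIV f" "\<And>x. 0 \<le> f x" "\<And>x. f x \<le> 1"
      "\<And>x. x \<in> K \<Longrightarrow> f x = 1" "\<And>x. x \<notin> U \<Longrightarrow> f x = (0::real)"
      using Urysohn_compact_group[OF compact_group KU] by metis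
    have K: "K \<in> sets \<nu>" and U: "U \<in> sets \<kappa>"
      using KU by (auto simp: sets_haar L.sets_haar compact_imp_closed)
    have int_f: "integrable \<nu> f" "integrable \<kappa> f"
      using f by (auto intro!: integrable_bounded[where B = 1] L.integrable_bounded[where B = 1]
          measurable_continuous L.measurable_continuous)
    have "measure \<nu> K = (\<integral>x. indicator K x \<partial>\<nu>)"
      using K by simp
    also have "\<dots> \<le> (\<integral>x. f x \<partial>\<nu>)"
    proof (rule integral_mono[OF _ int_f(1)])
      show "integrable \<nu> (indicator K :: 'g \<Rightarrow> real)"
        using K by (intro integrable_bounded[where B = 1]) auto
      show "indicator K x \<le> f x" for x
        using f by (auto simp: indicator_def)
    qed
    also have "\<dots> = (\<integral>x. f x \<partial>\<kappa>)"
      by (rule integral_eq_of_invariant[OF \<kappa> f(1)])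
    also have "\<dots> \<le> (\<integral>x. indicator U x \<partial>\<kappa>)"
    proof (rule integral_mono[OF int_f(2)])
      show "integrable \<kappa> (indicator U :: 'g \<Rightarrow> real)"
        using U by (intro L.integrable_bounded[where B = 1]) auto
      show "f x \<le> indicator U x" for x
        using f by (auto simp: indicator_def)
    qed
    also have "\<dots> = measure \<kappa> U"
      using U by simp
    finally show ?thesis
      by (simp add: emeasure_eq_measure L.emeasure_eq_measure)
  qed
  have "open": "emeasure \<nu> U \<le> emeasure \<kappa> U" if "open U" for U
  proof -
    have "emeasure \<nu> U = (SUP K\<in>{K. compact K \<and> K \<subseteq> U}. emeasure \<nu> K)"
      by (rule inner_regular[OF that])
    also have "\<dots> \<le> emeasure \<kappa> U"
      using compact_open that by (intro SUP_least) auto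
    finally show ?thesis .
  qed
  have "emeasure \<kappa> B = (INF U\<in>{U. open U \<and> B \<subseteq> U}. emeasure \<kappa> U)"
    by (rule L.outer_regular[OF B])
  moreover have "emeasure \<nu> B \<le> \<dots>"
    using B "open" by (intro INF_greatest)
      (auto intro: order_trans[OF emeasure_mono] simp: sets_haar)
  ultimately show ?thesis by simp
qed

text \<open>
  Uniqueness of normalized Haar measure. One inequality between two probability measures on all
  sets is an equality, by passing to complements.
\<close>

lemma haar_unique:
  assumes \<kappa>: "haar_group \<kappa>"
  shows "\<kappa> = \<nu>"
proof (rule measure_eqI)
  interpret L: haar_group \<kappa> by (rule \<kappa>)
  show "sets \<kappa> = sets \<nu>"
    by (simp add: sets_haar L.sets_haar)
  show "emeasure \<kappa> B = emeasure \<nu> B" if "B \<in> sets \<kappa>" for B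
  proof (rule antisym)
    have B: "B \<in> sets borel"
      using that by (simp add: L.sets_haar)
    show "emeasure \<kappa> B \<le> emeasure \<nu> B"
      by (rule L.haar_le_of_invariant[OF haar_group_axioms B])
    show "emeasure \<nu> B \<le> emeasure \<kappa> B"
      by (rule haar_le_of_invariant[OF \<kappa> B])
  qed
qed

text \<open>
  An automorphism conjugates translations to translations and, being a homeomorphism, exchanges
  open and compact sets with their images, so each defining property of Haar measure is transported.
\<close>

lemma normalized_haar_distr_aut:
  assumes A: "A \<in> group_aut"
  shows "normalized_haar (distr \<nu> borel A)"
proof -
  let ?\<kappa> = "distr \<nu> borel A"
  have cont: "continuous_on UNIV A" "continuous_on UNIV (inv A)" and bij: "bij A"
    and hom: "\<And>x y. A (x + y) = A x + A y"
    using A by (auto simp: group_aut_def)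
  have meas: "A \<in> measurable \<nu> borel"
    by (rule measurable_continuous[OF cont(1)])
  have em: "emeasure ?\<kappa> B = emeasure \<nu> (A -` B)" if "B \<in> sets borel" for B
    using emeasure_distr[OF meas that] by simp
  have image_vimage: "A -` (A ` B) = B" "A ` (A -` B) = B" for B
    using bij by (auto simp: bij_def inj_vimage_image_eq surj_image_vimage_eq)
  have open_vimage: "open (A -` U)" if "open U" for U
    using cont(1) that by (simp add: continuous_on_open_vimage)
  have open_image: "open (A ` U)" if "open U" for U
  proof -
    have "A ` U = inv A -` U"
      using bij_vimage_eq_inv_image[OF bij_imp_bij_inv[OF bij]] by (simp add: inv_inv_eq[OF bij])
    then show ?thesis
      using cont(2) that by (simp add: continuous_on_open_vimage)
  qed
  have compact_image: "compact (A ` K)" if "compact K" for K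
    using compact_continuous_image[OF continuous_on_subset[OF cont(1)] that] by simp
  have vimage_borel: "A -` B \<in> sets borel" if "B \<in> sets borel" for B
    using measurable_sets[OF meas that] by (simp add: sets_haar)
  have trans: "distr ?\<kappa> borel (\<lambda>x. a + x) = ?\<kappa>" for a
  proof -
    obtain b where b: "A b = a"
      using bij by (metis bij_pointE)
    have t: "(+) c \<in> measurable borel borel" for c :: 'g
      by (intro borel_measurable_continuous_onI continuous_intros)
    have tb: "(+) b \<in> measurable \<nu> borel"
      using t by (simp add: measurable_cong_sets[OF sets_haar refl])
    have "distr ?\<kappa> borel (\<lambda>x. a + x) = distr \<nu> borel ((+) a \<circ> A)"
      by (rule distr_distr[OF t meas])
    also have "(+) a \<circ> A = A \<circ> (+) b"
      by (auto simp: hom b)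
    also have "distr \<nu> borel (A \<circ> (+) b) = distr (distr \<nu> borel ((+) b)) borel A"
      using borel_measurable_continuous_onI[OF cont(1)] tb by (intro distr_distr[symmetric])
    also have "distr \<nu> borel ((+) b) = \<nu>"
      using haar by (simp add: normalized_haar_def)
    finally show ?thesis .
  qed
  have outer: "emeasure ?\<kappa> B = (INF U\<in>{U. open U \<and> B \<subseteq> U}. emeasure ?\<kappa> U)" if B: "B \<in> sets borel" for B
  proof (rule antisym)
    show "emeasure ?\<kappa> B \<le> (INF U\<in>{U. open U \<and> B \<subseteq> U}. emeasure ?\<kappa> U)"
      by (rule INF_greatest) (auto intro: emeasure_mono)
    have "emeasure ?\<kappa> B = (INF U\<in>{U. open U \<and> A -` B \<subseteq> U}. emeasure \<nu> U)"
      unfolding em[OF B] by (rule outer_regular[OF vimage_borel[OF B]])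
    also have "\<dots> \<ge> (INF U\<in>{U. open U \<and> B \<subseteq> U}. emeasure ?\<kappa> U)"
    proof (rule INF_mono)
      fix U assume U: "U \<in> {U. open U \<and> A -` B \<subseteq> U}"
      then have "A ` U \<in> {U. open U \<and> B \<subseteq> U}" "emeasure ?\<kappa> (A ` U) = emeasure \<nu> U"
        using open_image image_vimage em[of "A ` U"] image_mono[of "A -` B" U A] by auto
      then show "\<exists>V\<in>{U. open U \<and> B \<subseteq> U}. emeasure ?\<kappa> V \<le> emeasure \<nu> U"
        by (intro bexI[of _ "A ` U"]) auto
    qed
    finally show "(INF U\<in>{U. open U \<and> B \<subseteq> U}. emeasure ?\<kappa> U) \<le> emeasure ?\<kappa> B" .
  qed
  have inner: "emeasure ?\<kappa> U = (SUP K\<in>{K. compact K \<and> K \<subseteq> U}. emeasure ?\<kappa> K)" if U: "open U" for U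
  proof (rule antisym)
    show "(SUP K\<in>{K. compact K \<and> K \<subseteq> U}. emeasure ?\<kappa> K) \<le> emeasure ?\<kappa> U"
      by (rule SUP_least) (use U in \<open>auto intro: emeasure_mono\<close>)
    have "emeasure ?\<kappa> U = (SUP K\<in>{K. compact K \<and> K \<subseteq> A -` U}. emeasure \<nu> K)"
      unfolding em[OF borel_open[OF U]] by (rule inner_regular[OF open_vimage[OF U]])
    also have "\<dots> \<le> (SUP K\<in>{K. compact K \<and> K \<subseteq> U}. emeasure ?\<kappa> K)"
    proof (rule SUP_mono)
      fix K assume K: "K \<in> {K. compact K \<and> K \<subseteq> A -` U}"
      then have "A ` K \<in> {K. compact K \<and> K \<subseteq> U}" "emeasure ?\<kappa> (A ` K) = emeasure \<nu> K"
        using compact_image[of K] image_vimage em[of "A ` K"] image_mono[of K "A -` U" A]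
        by (auto simp: compact_imp_closed)
      then show "\<exists>L\<in>{K. compact K \<and> K \<subseteq> U}. emeasure \<nu> K \<le> emeasure ?\<kappa> L"
        by (intro bexI[of _ "A ` K"]) auto
    qed
    finally show "emeasure ?\<kappa> U \<le> (SUP K\<in>{K. compact K \<and> K \<subseteq> U}. emeasure ?\<kappa> K)" .
  qed
  show ?thesis
    unfolding normalized_haar_def using trans outer inner prob_space_distr[OF meas] by auto
qed

text \<open>
  Invariance is needed on all Borel sets and not only on polynomials: elements of \<open>L\<^sup>1\<close> are given up
  to null sets, and composition with an automorphism must respect these.
\<close>

lemma distr_aut:
  assumes "A \<in> group_aut"
  shows "distr \<nu> borel A = \<nu>"
  by (rule haar_unique) (intro haar_group.intro compact_group normalized_haar_distr_aut assms)

lemma measurable_aut: "A \<in> group_aut \<Longrightarrow> A \<in> measurable \<nu> borel"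
  by (rule measurable_continuous) (simp add: group_aut_def)

lemma integrable_aut:
  fixes f :: "'g \<Rightarrow> 'b::{banach, second_countable_topology}"
  assumes "A \<in> group_aut" "integrable \<nu> f"
  shows "integrable \<nu> (\<lambda>x. f (A x))"
  using integrable_distr[OF measurable_aut[OF assms(1)], of f] distr_aut[OF assms(1)] assms(2)
  by simp

lemma integral_aut:
  fixes f :: "'g \<Rightarrow> 'b::{banach, second_countable_topology}"
  assumes "A \<in> group_aut" "f \<in> borel_measurable \<nu>"
  shows "(\<integral>x. f (A x) \<partial>\<nu>) = (\<integral>x. f x \<partial>\<nu>)"
  using integral_distr[OF measurable_aut[OF assms(1)], of f] distr_aut[OF assms(1)] assms(2)
  by (simp add: measurable_cong_sets[OF sets_haar refl])

end

section \<open>Measurability of the action\<close>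

lemma openin_group_aut_topology_subset:
  "openin group_aut_topology V \<Longrightarrow> V \<subseteq> group_aut"
  using openin_subset[of group_aut_topology V]
  by (auto simp: group_aut_topology_def)

lemma space_group_aut_borel: "space group_aut_borel = group_aut"
  unfolding group_aut_borel_def
  by (rule space_measure_of) (auto dest: openin_group_aut_topology_subset)

lemma sets_group_aut_borel_subbasic:
  fixes K U :: "'g::topological_ab_group_add set"
  assumes "compact K" "open U"
  shows "{A \<in> group_aut. A ` K \<subseteq> U} \<in> sets (group_aut_borel :: ('g \<Rightarrow> 'g) measure)"
proof -
  have "openin group_aut_topology {A \<in> group_aut. A ` K \<subseteq> U}"
    unfolding group_aut_topology_def
    by (rule topology_generated_by_Basis) (use assms in blast)
  moreover have "{V. openin group_aut_topology V} \<subseteq> Pow (group_aut :: ('g \<Rightarrow> 'g) set)"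
    by (auto dest: openin_group_aut_topology_subset)
  ultimately show ?thesis
    unfolding group_aut_borel_def by (simp add: sets_measure_of sigma_sets.Basic)
qed

lemma group_aut_borel_D:
  assumes A: "A \<in> measurable \<mu> group_aut_borel"
  shows "u \<in> space \<mu> \<Longrightarrow> A u \<in> group_aut"
    and "compact K \<Longrightarrow> open U \<Longrightarrow> {u \<in> space \<mu>. A u ` K \<subseteq> U} \<in> sets \<mu>"
proof -
  show *: "A u \<in> group_aut" if "u \<in> space \<mu>" for u
    using measurable_space[OF A that] by (simp add: space_group_aut_borel)
  assume KU: "compact K" "open U"
  have "{u \<in> space \<mu>. A u ` K \<subseteq> U} = A -` {B \<in> group_aut. B ` K \<subseteq> U} \<inter> space \<mu>"
    using * by auto
  then show "{u \<in> space \<mu>. A u ` K \<subseteq> U} \<in> sets \<mu>"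
    using measurable_sets[OF A sets_group_aut_borel_subbasic[OF KU]] by simp
qed

text \<open>
  Evaluation at a point is continuous for the compact-open topology. This yields measurability in \<open>u\<close>
  at every single \<open>x\<close>, whereas joint measurability concerns the pair only modulo null sets.
\<close>

lemma measurable_orbit:
  fixes A :: "'w \<Rightarrow> 'g::topological_ab_group_add \<Rightarrow> 'g"
  assumes A: "A \<in> measurable \<mu> group_aut_borel"
  shows "(\<lambda>u. A u x) \<in> borel_measurable \<mu>"
proof (rule borel_measurableI)
  fix U :: "'g set" assume "open U"
  then show "(\<lambda>u. A u x) -` U \<inter> space \<mu> \<in> sets \<mu>"
    using group_aut_borel_D(2)[OF A, of "{x}" U] by (simp add: vimage_def Int_def conj_commute)
qed

text \<open>
  With a countable base the preimage of an open set under \<open>(u, x) \<mapsto> A u x\<close> is a countable union of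
  rectangles: near \<open>x\<close> the automorphism \<open>A u\<close> maps the compact closure of a basic neighbourhood
  into the open set, and such a condition on \<open>u\<close> is measurable.
\<close>

lemma measurable_action_second_countable:
  fixes A :: "'w \<Rightarrow> 'g::{topological_ab_group_add, t2_space} \<Rightarrow> 'g"
  assumes compact: "compact (UNIV :: 'g set)"
    and sc: "second_countable (euclidean :: 'g topology)"
    and A: "A \<in> measurable \<mu> group_aut_borel" and \<nu>: "sets \<nu> = sets borel"
  shows "(\<lambda>(u, x). A u x) \<in> borel_measurable (\<mu> \<Otimes>\<^sub>M \<nu>)"
proof (rule borel_measurableI)
  fix U :: "'g set" assume U: "open U"
  have space\<nu>: "space \<nu> = UNIV"
    using sets_eq_imp_space_eq[OF \<nu>] by simp
  obtain \<B> :: "'g set set" where \<B>: "countable \<B>" "\<And>V. V \<in> \<B> \<Longrightarrow> open V"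
    "\<And>W x. open W \<Longrightarrow> x \<in> W \<Longrightarrow> \<exists>V\<in>\<B>. x \<in> V \<and> V \<subseteq> W"
    using sc unfolding second_countable_def by auto
  have "(\<lambda>(u, x). A u x) -` U \<inter> space (\<mu> \<Otimes>\<^sub>M \<nu>)
      = (\<Union>V\<in>\<B>. {u \<in> space \<mu>. A u ` closure V \<subseteq> U} \<times> V)"
  proof (rule set_eqI, rule iffI)
    fix w assume w: "w \<in> (\<lambda>(u, x). A u x) -` U \<inter> space (\<mu> \<Otimes>\<^sub>M \<nu>)"
    obtain u x where ux: "w = (u, x)" by (cases w)
    have u: "u \<in> space \<mu>" and Aux: "A u x \<in> U"
      using w by (auto simp: ux space_pair_measure)
    have cont: "continuous_on UNIV (A u)"
      using group_aut_borel_D(1)[OF A u] by (simp add: group_aut_def)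
    have "open (A u -` U)"
      using cont U by (simp add: continuous_on_open_vimage)
    moreover have "compact {x}" "{x} \<subseteq> A u -` U"
      using Aux by auto
    ultimately obtain f where f: "continuous_on UNIV f" "f x = 1" "\<And>y. y \<notin> A u -` U \<Longrightarrow> f y = (0::real)"
      using Urysohn_compact_group[OF compact] by (metis singletonI)
    define W where "W = {y. f y > 1 / 2}"
    have "open W" "x \<in> W"
      unfolding W_def using f by (auto intro!: open_Collect_less continuous_intros)
    have "closed {y. f y \<ge> 1 / 2}"
      using f(1) by (intro closed_Collect_le) (auto intro: continuous_intros)
    then have "closure W \<subseteq> {y. f y \<ge> 1 / 2}"
      by (rule closure_minimal[rotated]) (auto simp: W_def)
    then have W: "closure W \<subseteq> A u -` U"
      using f(3) by fastforce
    obtain V where V: "V \<in> \<B>" "x \<in> V" "V \<subseteq> W"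
      using \<B>(3)[OF \<open>open W\<close> \<open>x \<in> W\<close>] by auto
    then have "closure V \<subseteq> A u -` U"
      using W closure_mono[OF V(3)] by auto
    then have "A u ` closure V \<subseteq> U" by auto
    with V u show "w \<in> (\<Union>V\<in>\<B>. {u \<in> space \<mu>. A u ` closure V \<subseteq> U} \<times> V)"
      by (auto simp: ux)
  next
    fix w assume "w \<in> (\<Union>V\<in>\<B>. {u \<in> space \<mu>. A u ` closure V \<subseteq> U} \<times> V)"
    then show "w \<in> (\<lambda>(u, x). A u x) -` U \<inter> space (\<mu> \<Otimes>\<^sub>M \<nu>)"
      using closure_subset by (fastforce simp: space_pair_measure space\<nu>)
  qed
  also have "\<dots> \<in> sets (\<mu> \<Otimes>\<^sub>M \<nu>)"
  proof (rule sets.countable_UN''[OF \<B>(1)])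
    fix V assume "V \<in> \<B>"
    have "compact (closure V)"
      using compact closed_Int_compact[of "closure V" UNIV] by simp
    then show "{u \<in> space \<mu>. A u ` closure V \<subseteq> U} \<times> V \<in> sets (\<mu> \<Otimes>\<^sub>M \<nu>)"
      using group_aut_borel_D(2)[OF A _ U] \<B>(2)[OF \<open>V \<in> \<B>\<close>] by (intro pair_measureI) (auto simp: \<nu>)
  qed
  finally show "(\<lambda>(u, x). A u x) -` U \<inter> space (\<mu> \<Otimes>\<^sub>M \<nu>) \<in> sets (\<mu> \<Otimes>\<^sub>M \<nu>)" .
qed

lemma action_measurable_second_countable:
  fixes A :: "'w \<Rightarrow> 'g::{topological_ab_group_add, t2_space} \<Rightarrow> 'g"
  assumes "compact (UNIV :: 'g set)" "second_countable (euclidean :: 'g topology)"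
    and "A \<in> measurable \<mu> group_aut_borel" and "sets \<nu> = sets borel"
  shows "action_measurable \<nu> \<mu> A"
  unfolding action_measurable_def
  using assms
  by (intro ballI impI measurable_completion measurable_action_second_countable
      measurable_restrict_space1)

text \<open>
  A measurable set for the restricted product is its own preimage under the identity on
  \<open>S \<times> space \<nu>\<close>, which is measurable into that product because its two coordinates are.
\<close>

lemma sets_pair_restrict_space:
  assumes S: "S \<in> sets \<mu>" and E: "E \<in> sets (restrict_space \<mu> S \<Otimes>\<^sub>M \<nu>)"
  shows "E \<in> sets (\<mu> \<Otimes>\<^sub>M \<nu>)"
proof -
  let ?R = "restrict_space (\<mu> \<Otimes>\<^sub>M \<nu>) (S \<times> space \<nu>)"
  have SX: "S \<times> space \<nu> \<in> sets (\<mu> \<Otimes>\<^sub>M \<nu>)"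
    using S by auto
  have S_sub: "S \<subseteq> space \<mu>"
    using sets.sets_into_space[OF S] .
  have sp: "space ?R = S \<times> space \<nu>"
    using S_sub by (auto simp: space_restrict_space space_pair_measure)
  have "fst \<in> measurable ?R (restrict_space \<mu> S)"
    by (rule measurable_restrict_space2) (auto simp: sp intro: measurable_restrict_space1)
  moreover have "snd \<in> measurable ?R \<nu>"
    by (rule measurable_restrict_space1) simp
  ultimately have "(\<lambda>w. (fst w, snd w)) \<in> measurable ?R (restrict_space \<mu> S \<Otimes>\<^sub>M \<nu>)"
    by (rule measurable_Pair)
  from measurable_sets[OF this E]
  have "E \<inter> (S \<times> space \<nu>) \<in> sets ?R"
    by (simp add: sp vimage_def Int_def)
  moreover have "E \<subseteq> S \<times> space \<nu>"
    using sets.sets_into_space[OF E] S_sub by (auto simp: space_pair_measure space_restrict_space)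
  ultimately have "E \<in> sets ?R"
    by (simp add: Int_absorb2)
  then show ?thesis
    using SX by (simp add: sets_restrict_space_iff)
qed

text \<open>
  Nullity in a product means that almost every section is null. This condition passes from \<open>\<mu>\<close> on \<open>S\<close>
  to \<open>\<mu>\<close>, the sections outside \<open>S\<close> being empty, and then to any measure with a density.
\<close>

lemma null_sets_pair_density:
  assumes sf: "sigma_finite_measure \<nu>" and S: "S \<in> sets \<mu>"
    and \<Phi>: "\<Phi> \<in> borel_measurable \<mu>"
    and N: "N \<in> null_sets (restrict_space \<mu> S \<Otimes>\<^sub>M \<nu>)"
  shows "N \<in> null_sets (density \<mu> \<Phi> \<Otimes>\<^sub>M \<nu>)"
proof -
  interpret sigma_finite_measure \<nu> by (rule sf)
  have N_sets: "N \<in> sets (restrict_space \<mu> S \<Otimes>\<^sub>M \<nu>)"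
    using N by auto
  have N_sub: "N \<subseteq> S \<times> space \<nu>"
    using sets.sets_into_space[OF N_sets] by (auto simp: space_pair_measure space_restrict_space)
  have N': "N \<in> sets (\<mu> \<Otimes>\<^sub>M \<nu>)"
    by (rule sets_pair_restrict_space[OF S N_sets])
  then have N'': "N \<in> sets (density \<mu> \<Phi> \<Otimes>\<^sub>M \<nu>)"
    by (simp add: sets_pair_measure_cong[OF sets_density refl])
  have "(\<integral>\<^sup>+u. emeasure \<nu> (Pair u -` N) \<partial>restrict_space \<mu> S) = 0"
    using emeasure_pair_measure_alt[OF N_sets] null_setsD1[OF N] by simp
  then have "AE u in restrict_space \<mu> S. emeasure \<nu> (Pair u -` N) = 0"
    by (subst (asm) nn_integral_0_iff_AE) (auto intro: measurable_emeasure_Pair[OF N_sets])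
  then have "AE u in \<mu>. u \<in> S \<longrightarrow> emeasure \<nu> (Pair u -` N) = 0"
    using S by (simp add: AE_restrict_space_iff)
  then have "AE u in \<mu>. emeasure \<nu> (Pair u -` N) = 0"
  proof (rule AE_mp, intro AE_I2 impI)
    fix u assume *: "u \<in> S \<longrightarrow> emeasure \<nu> (Pair u -` N) = 0"
    show "emeasure \<nu> (Pair u -` N) = 0"
    proof (cases "u \<in> S")
      case False
      then have "Pair u -` N = {}" using N_sub by auto
      then show ?thesis by simp
    qed (use * in simp)
  qed
  then have "AE u in density \<mu> \<Phi>. emeasure \<nu> (Pair u -` N) = 0"
    using \<Phi> by (subst AE_density) auto
  then have "(\<integral>\<^sup>+u. emeasure \<nu> (Pair u -` N) \<partial>density \<mu> \<Phi>) = 0"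
    by (subst nn_integral_0_iff_AE) (auto intro: measurable_emeasure_Pair[OF N'])
  then show ?thesis
    using emeasure_pair_measure_alt[OF N''] N'' by auto
qed

text \<open>
  Passing from sets of finite measure to the finite measure \<open>\<bar>\<Phi>\<bar> \<mu>\<close>: the sets where
  \<open>\<bar>\<Phi>\<bar> > 1 / (n + 1)\<close> have finite measure and exhaust the support of \<open>\<Phi>\<close>.
\<close>

lemma action_measurable_density:
  fixes \<nu> :: "'g::topological_space measure" and \<Phi> :: "'w \<Rightarrow> real"
  assumes sf: "sigma_finite_measure \<nu>" and \<nu>: "sets \<nu> = sets borel"
    and A: "action_measurable \<nu> \<mu> A" and \<Phi>: "integrable \<mu> \<Phi>"
  shows "(\<lambda>(u, x). A u x) \<in> borel_measurable (completion (density \<mu> (\<lambda>u. ennreal \<bar>\<Phi> u\<bar>) \<Otimes>\<^sub>M \<nu>))"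
proof (rule measurableI)
  interpret sigma_finite_measure \<nu> by (rule sf)
  define m where "m = density \<mu> (\<lambda>u. ennreal \<bar>\<Phi> u\<bar>)"
  have space\<nu>: "space \<nu> = UNIV"
    using sets_eq_imp_space_eq[OF \<nu>] by simp
  have \<Phi>meas: "\<Phi> \<in> borel_measurable \<mu>"
    using \<Phi> by simp
  then have \<Phi>enn: "(\<lambda>u. ennreal \<bar>\<Phi> u\<bar>) \<in> borel_measurable \<mu>"
    by simp
  have sets_m: "sets (m \<Otimes>\<^sub>M \<nu>) = sets (\<mu> \<Otimes>\<^sub>M \<nu>)"
    unfolding m_def by (rule sets_pair_measure_cong[OF sets_density refl])
  define S where "S n = {u \<in> space \<mu>. 1 / (real n + 1) \<le> \<bar>\<Phi> u\<bar>}" for n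
  have S_sets: "S n \<in> sets \<mu>" for n
    unfolding S_def using \<Phi>meas by measurable
  have S_fin: "emeasure \<mu> (S n) < \<infinity>" for n
  proof -
    have "emeasure \<mu> (S n) \<le> (1 / (1 / (real n + 1))) * (\<integral>u. \<bar>\<Phi> u\<bar> \<partial>\<mu>)"
      unfolding S_def using \<Phi> by (intro integral_Markov_inequality) auto
    then show ?thesis
      by (rule order_le_less_trans) simp
  qed
  define Z where "Z = {u \<in> space \<mu>. \<Phi> u = 0}"
  have Z_sets: "Z \<in> sets \<mu>"
    unfolding Z_def using \<Phi>meas by measurable
  have "AE u in \<mu>. 0 < ennreal \<bar>\<Phi> u\<bar> \<longrightarrow> u \<notin> Z"
    by (auto simp: Z_def)
  then have "AE u in m. u \<notin> Z"
    unfolding m_def using \<Phi>enn by (subst AE_density) auto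
  then have Z_null: "Z \<in> null_sets m"
    using Z_sets by (subst (asm) AE_iff_null_sets[symmetric]) (auto simp: m_def)
  then have ZX_null: "Z \<times> space \<nu> \<in> null_sets (m \<Otimes>\<^sub>M \<nu>)"
    using emeasure_pair_measure_Times[of Z m "space \<nu>"] by (auto simp: null_sets_def)
  fix B :: "'g set" assume B: "B \<in> sets borel"
  define E where "E = {w \<in> space \<mu> \<times> UNIV. A (fst w) (snd w) \<in> B}"
  have piece: "E \<inter> (S n \<times> UNIV) \<in> sets (completion (m \<Otimes>\<^sub>M \<nu>))" for n
  proof -
    let ?R = "restrict_space \<mu> (S n) \<Otimes>\<^sub>M \<nu>"
    have "(\<lambda>(u, x). A u x) \<in> borel_measurable (completion ?R)"
      using A S_sets S_fin unfolding action_measurable_def by blast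
    from measurable_sets[OF this B]
    have "E \<inter> (S n \<times> UNIV) \<in> sets (completion ?R)"
    proof (rule back_subst[of "\<lambda>X. X \<in> sets (completion ?R)"])
      show "(\<lambda>(u, x). A u x) -` B \<inter> space (completion ?R) = E \<inter> (S n \<times> UNIV)"
        using sets.sets_into_space[OF S_sets[of n]]
        by (auto simp: E_def space_pair_measure space_restrict_space space\<nu>)
    qed
    then obtain X N N' where "E \<inter> (S n \<times> UNIV) = X \<union> N" "N \<subseteq> N'" "N' \<in> null_sets ?R" "X \<in> sets ?R"
      by (rule sets_completionE)
    moreover have "N' \<in> null_sets (m \<Otimes>\<^sub>M \<nu>)" if "N' \<in> null_sets ?R" for N'
      unfolding m_def by (rule null_sets_pair_density[OF sf S_sets \<Phi>enn that])
    moreover have "X \<in> sets (m \<Otimes>\<^sub>M \<nu>)" if "X \<in> sets ?R" for X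
      unfolding sets_m by (rule sets_pair_restrict_space[OF S_sets that])
    ultimately show ?thesis
      by (metis sets_completionI)
  qed
  have zero: "E \<inter> (Z \<times> UNIV) \<in> sets (completion (m \<Otimes>\<^sub>M \<nu>))"
    by (rule sets_completionI_sub[OF ZX_null]) (auto simp: space\<nu>)
  have "E = (\<Union>n. E \<inter> (S n \<times> UNIV)) \<union> (E \<inter> (Z \<times> UNIV))"
  proof -
    have "(\<exists>n. u \<in> S n) \<or> u \<in> Z" if "u \<in> space \<mu>" for u
    proof (cases "\<Phi> u = 0")
      case False
      then obtain n where "inverse (real (Suc n)) < \<bar>\<Phi> u\<bar>"
        using reals_Archimedean[of "\<bar>\<Phi> u\<bar>"] by auto
      then have "u \<in> S n"
        using that by (simp add: S_def inverse_eq_divide add.commute)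
      then show ?thesis by auto
    qed (use that in \<open>simp add: Z_def\<close>)
    then show ?thesis
      by (auto simp: E_def)
  qed
  then have "E \<in> sets (completion (m \<Otimes>\<^sub>M \<nu>))"
    using sets.Un[OF sets.countable_UN[of "\<lambda>n. E \<inter> (S n \<times> UNIV)" UNIV] zero] piece by auto
  moreover have "(\<lambda>(u, x). A u x) -` B \<inter> space (completion (m \<Otimes>\<^sub>M \<nu>)) = E"
    by (auto simp: E_def m_def space_pair_measure space\<nu>)
  ultimately show "(\<lambda>(u, x). A u x) -` B \<inter> space (completion (density \<mu> (\<lambda>u. ennreal \<bar>\<Phi> u\<bar>) \<Otimes>\<^sub>M \<nu>))
      \<in> sets (completion (density \<mu> (\<lambda>u. ennreal \<bar>\<Phi> u\<bar>) \<Otimes>\<^sub>M \<nu>))"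
    by (simp add: m_def)
qed simp

section \<open>Partial Fourier sums and Bessel's inequality\<close>

context haar_group
begin

definition fourier_coeff :: "('g \<Rightarrow> complex) \<Rightarrow> ('g \<Rightarrow> complex) \<Rightarrow> complex" where
  "fourier_coeff f \<psi> = (\<integral>x. f x * cnj (\<psi> x) \<partial>\<nu>)"

definition partial_sum :: "('g \<Rightarrow> complex) \<Rightarrow> ('g \<Rightarrow> complex) set \<Rightarrow> 'g \<Rightarrow> complex" where
  "partial_sum f F x = (\<Sum>\<psi>\<in>F. fourier_coeff f \<psi> * \<psi> x)"

lemma partial_sum_in_trig_span:
  assumes "finite F" "F \<subseteq> S"
  shows "partial_sum f F \<in> trig_span S"
  unfolding trig_span_def
  by (rule CollectI, rule exI[of _ F], rule exI[of _ "fourier_coeff f"])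
    (use assms in \<open>auto simp: partial_sum_def fun_eq_iff\<close>)

lemma fourier_coeff_remainder:
  assumes f: "integrable \<nu> f" and F: "finite F" "F \<subseteq> characters" and \<psi>: "\<psi> \<in> characters"
  shows "fourier_coeff (\<lambda>x. f x - partial_sum f F x) \<psi> = (if \<psi> \<in> F then 0 else fourier_coeff f \<psi>)"
proof -
  have \<psi>': "\<psi> \<in> trig_span characters"
    by (rule trig_span_base[OF \<psi>])
  have i: "integrable \<nu> (\<lambda>x. fourier_coeff f \<phi> * (\<phi> x * cnj (\<psi> x)))" if "\<phi> \<in> F" for \<phi>
    using integrable_mult_trig_span(3)[OF integrable_character \<psi>' order_refl] that F
    by (intro integrable_mult_right) auto
  have "(\<integral>x. partial_sum f F x * cnj (\<psi> x) \<partial>\<nu>) = (\<integral>x. (\<Sum>\<phi>\<in>F. fourier_coeff f \<phi> * (\<phi> x * cnj (\<psi> x))) \<partial>\<nu>)"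
    by (simp add: partial_sum_def sum_distrib_right mult.assoc)
  also have "\<dots> = (\<Sum>\<phi>\<in>F. \<integral>x. fourier_coeff f \<phi> * (\<phi> x * cnj (\<psi> x)) \<partial>\<nu>)"
    by (rule Bochner_Integration.integral_sum) (rule i)
  also have "\<dots> = (\<Sum>\<phi>\<in>F. fourier_coeff f \<phi> * (if \<phi> = \<psi> then 1 else 0))"
    using F \<psi> by (intro sum.cong) (auto simp: character_orthonormal subset_iff)
  also have "\<dots> = (if \<psi> \<in> F then fourier_coeff f \<psi> else 0)"
    using F(1) by (simp add: if_distrib cong: if_cong)
  finally have s: "(\<integral>x. partial_sum f F x * cnj (\<psi> x) \<partial>\<nu>) = (if \<psi> \<in> F then fourier_coeff f \<psi> else 0)" .
  have "fourier_coeff (\<lambda>x. f x - partial_sum f F x) \<psi> = (\<integral>x. f x * cnj (\<psi> x) - partial_sum f F x * cnj (\<psi> x) \<partial>\<nu>)"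
    by (simp add: fourier_coeff_def left_diff_distrib)
  also have "\<dots> = fourier_coeff f \<psi> - (\<integral>x. partial_sum f F x * cnj (\<psi> x) \<partial>\<nu>)"
    unfolding fourier_coeff_def
    using integrable_mult_trig_span(3)[OF f \<psi>' order_refl]
      integrable_mult_trig_span(3)[OF integrable_trig_span[OF partial_sum_in_trig_span[OF F] order_refl] \<psi>' order_refl]
    by (rule Bochner_Integration.integral_diff)
  finally show ?thesis
    unfolding s by simp
qed

text \<open>
  Both formulas express that the remainder is orthogonal to the partial sum. The first turns its
  square norm into a pairing with \<open>f\<close>; the second contains Bessel's inequality.
\<close>

lemma remainder_norm:
  assumes f: "f \<in> borel_measurable \<nu>" "\<And>x. cmod (f x) \<le> B" and F: "finite F" "F \<subseteq> characters"
  defines "e \<equiv> \<lambda>x. f x - partial_sum f F x"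
  shows "of_real (\<integral>x. (cmod (e x))\<^sup>2 \<partial>\<nu>) = (\<integral>x. e x * cnj (f x) \<partial>\<nu>)"
    and "(\<integral>x. (cmod (e x))\<^sup>2 \<partial>\<nu>) = (\<integral>x. (cmod (f x))\<^sup>2 \<partial>\<nu>) - (\<Sum>\<psi>\<in>F. (cmod (fourier_coeff f \<psi>))\<^sup>2)"
proof -
  note s = partial_sum_in_trig_span[OF F, of f]
  have fi: "integrable \<nu> f"
    by (rule integrable_bounded[OF f])
  have si: "integrable \<nu> (partial_sum f F)"
    by (rule integrable_trig_span[OF s order_refl])
  have ei: "integrable \<nu> e"
    unfolding e_def using fi si by simp
  have cf: "integrable \<nu> (\<lambda>x. w x * cnj (f x))" if w: "integrable \<nu> w" for w
  proof (rule Bochner_Integration.integrable_bound[of \<nu> "\<lambda>x. of_real B * w x"])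
    show "integrable \<nu> (\<lambda>x. of_real B * w x)"
      using w by simp
    show "(\<lambda>x. w x * cnj (f x)) \<in> borel_measurable \<nu>"
      using borel_measurable_integrable[OF w] measurable_cnj[OF f(1)] by (rule borel_measurable_times)
    show "AE x in \<nu>. norm (w x * cnj (f x)) \<le> norm (of_real B * w x)"
    proof (rule AE_I2)
      fix x
      have "cmod (f x) \<le> \<bar>B\<bar>"
        using f(2)[of x] by simp
      from mult_left_mono[OF this norm_ge_zero[of "w x"]]
      show "norm (w x * cnj (f x)) \<le> norm (of_real B * w x)"
        by (simp add: norm_mult mult.commute)
    qed
  qed
  have terms: "integrable \<nu> (\<lambda>x. cnj (fourier_coeff f \<psi>) * (e x * cnj (\<psi> x)))"
    "integrable \<nu> (\<lambda>x. fourier_coeff f \<psi> * (\<psi> x * cnj (f x)))" if "\<psi> \<in> F" for \<psi>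
  proof -
    have "\<psi> \<in> characters"
      using that F by auto
    then show "integrable \<nu> (\<lambda>x. cnj (fourier_coeff f \<psi>) * (e x * cnj (\<psi> x)))"
      "integrable \<nu> (\<lambda>x. fourier_coeff f \<psi> * (\<psi> x * cnj (f x)))"
      using integrable_mult_trig_span(3)[OF ei trig_span_base order_refl] cf[OF integrable_character]
      by auto
  qed
  have "(\<integral>x. e x * cnj (partial_sum f F x) \<partial>\<nu>) = (\<integral>x. (\<Sum>\<psi>\<in>F. cnj (fourier_coeff f \<psi>) * (e x * cnj (\<psi> x))) \<partial>\<nu>)"
    by (simp add: partial_sum_def sum_distrib_left mult_ac)
  also have "\<dots> = (\<Sum>\<psi>\<in>F. cnj (fourier_coeff f \<psi>) * fourier_coeff e \<psi>)"
    by (subst Bochner_Integration.integral_sum) (use terms in \<open>auto simp: fourier_coeff_def\<close>)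
  also have "\<dots> = 0"
    using fourier_coeff_remainder[OF fi F] F(2) unfolding e_def by (intro sum.neutral) auto
  finally have orth: "(\<integral>x. e x * cnj (partial_sum f F x) \<partial>\<nu>) = 0" .
  have "of_real (\<integral>x. (cmod (e x))\<^sup>2 \<partial>\<nu>) = (\<integral>x. complex_of_real ((cmod (e x))\<^sup>2) \<partial>\<nu>)"
    by (simp only: integral_complex_of_real)
  also have "\<dots> = (\<integral>x. e x * cnj (f x) - e x * cnj (partial_sum f F x) \<partial>\<nu>)"
    by (simp only: complex_norm_square) (simp add: e_def algebra_simps)
  also have "\<dots> = (\<integral>x. e x * cnj (f x) \<partial>\<nu>)"
    using cf[OF ei] integrable_mult_trig_span(3)[OF ei s order_refl] orth by simp
  finally show 1: "of_real (\<integral>x. (cmod (e x))\<^sup>2 \<partial>\<nu>) = (\<integral>x. e x * cnj (f x) \<partial>\<nu>)" .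
  have "(\<integral>x. partial_sum f F x * cnj (f x) \<partial>\<nu>) = (\<integral>x. (\<Sum>\<psi>\<in>F. fourier_coeff f \<psi> * (\<psi> x * cnj (f x))) \<partial>\<nu>)"
    by (simp add: partial_sum_def sum_distrib_right mult.assoc)
  also have "\<dots> = (\<Sum>\<psi>\<in>F. fourier_coeff f \<psi> * (\<integral>x. cnj (f x * cnj (\<psi> x)) \<partial>\<nu>))"
    by (subst Bochner_Integration.integral_sum) (use terms in \<open>auto simp: mult.commute\<close>)
  also have "\<dots> = (\<Sum>\<psi>\<in>F. fourier_coeff f \<psi> * cnj (fourier_coeff f \<psi>))"
    by (simp only: Bochner_Integration.integral_cnj fourier_coeff_def)
  also have "\<dots> = of_real (\<Sum>\<psi>\<in>F. (cmod (fourier_coeff f \<psi>))\<^sup>2)"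
    by (simp only: of_real_sum complex_norm_square)
  finally have sum: "(\<integral>x. partial_sum f F x * cnj (f x) \<partial>\<nu>) = of_real (\<Sum>\<psi>\<in>F. (cmod (fourier_coeff f \<psi>))\<^sup>2)" .
  have "of_real (\<integral>x. (cmod (e x))\<^sup>2 \<partial>\<nu>) = (\<integral>x. f x * cnj (f x) - partial_sum f F x * cnj (f x) \<partial>\<nu>)"
    unfolding 1 by (simp add: e_def left_diff_distrib)
  also have "\<dots> = (\<integral>x. f x * cnj (f x) \<partial>\<nu>) - (\<integral>x. partial_sum f F x * cnj (f x) \<partial>\<nu>)"
    using cf[OF fi] cf[OF si] by (rule Bochner_Integration.integral_diff)
  also have "(\<integral>x. f x * cnj (f x) \<partial>\<nu>) = of_real (\<integral>x. (cmod (f x))\<^sup>2 \<partial>\<nu>)"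
    by (simp only: complex_norm_square[symmetric] integral_complex_of_real)
  finally show "(\<integral>x. (cmod (e x))\<^sup>2 \<partial>\<nu>) = (\<integral>x. (cmod (f x))\<^sup>2 \<partial>\<nu>) - (\<Sum>\<psi>\<in>F. (cmod (fourier_coeff f \<psi>))\<^sup>2)"
    unfolding sum by (simp only: of_real_diff[symmetric] of_real_eq_iff)
qed

text \<open>Only finitely many coefficients are large, by Bessel's inequality.\<close>

lemma finite_large_coefficients:
  assumes f: "f \<in> borel_measurable \<nu>" "\<And>x. cmod (f x) \<le> B" and \<eta>: "\<eta> > 0"
  shows "finite {\<psi> \<in> characters. \<eta> \<le> cmod (fourier_coeff f \<psi>)}"
proof (rule ccontr)
  let ?E = "\<integral>x. (cmod (f x))\<^sup>2 \<partial>\<nu>"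
  assume "infinite {\<psi> \<in> characters. \<eta> \<le> cmod (fourier_coeff f \<psi>)}"
  obtain n :: nat where n: "?E / \<eta>\<^sup>2 < real n"
    using reals_Archimedean2 by blast
  obtain F where F: "F \<subseteq> {\<psi> \<in> characters. \<eta> \<le> cmod (fourier_coeff f \<psi>)}" "finite F" "card F = n"
    using infinite_arbitrarily_large[OF \<open>infinite _\<close>, of n] by auto
  have "(\<integral>x. (cmod (f x - partial_sum f F x))\<^sup>2 \<partial>\<nu>) = ?E - (\<Sum>\<psi>\<in>F. (cmod (fourier_coeff f \<psi>))\<^sup>2)"
    using F by (intro remainder_norm(2)[OF f]) auto
  moreover have "0 \<le> (\<integral>x. (cmod (f x - partial_sum f F x))\<^sup>2 \<partial>\<nu>)"
    by (rule Bochner_Integration.integral_nonneg) simp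
  ultimately have "(\<Sum>\<psi>\<in>F. (cmod (fourier_coeff f \<psi>))\<^sup>2) \<le> ?E"
    by simp
  moreover have "real n * \<eta>\<^sup>2 \<le> (\<Sum>\<psi>\<in>F. (cmod (fourier_coeff f \<psi>))\<^sup>2)"
    using sum_bounded_below[of F "\<eta>\<^sup>2" "\<lambda>\<psi>. (cmod (fourier_coeff f \<psi>))\<^sup>2"] F \<eta>
    by (auto simp: power_mono subset_iff)
  ultimately show False
    using n \<eta> by (simp add: field_simps)
qed

end

section \<open>The Hausdorff operator on integrable functions\<close>

locale hausdorff_operator = ordered_haar_group \<nu> r
  for \<nu> :: "'g::{topological_ab_group_add, t2_space} measure"
    and r :: "(('g \<Rightarrow> complex) \<times> ('g \<Rightarrow> complex)) set" +
  fixes \<mu> :: "'w measure" and A :: "'w \<Rightarrow> 'g \<Rightarrow> 'g" and \<Phi> :: "'w \<Rightarrow> real"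
  assumes A: "A \<in> measurable \<mu> group_aut_borel"
    and joint: "action_measurable \<nu> \<mu> A"
    and positive: "AE u in \<mu>. A u \<in> group_aut_plus r"
    and integrable_\<Phi>: "integrable \<mu> \<Phi>"
begin

text \<open>
  The measure \<open>\<mu>\<close> need not be \<open>\<sigma>\<close>-finite. Moving \<open>\<bar>\<Phi>\<bar>\<close> into the measure and leaving the sign of \<open>\<Phi>\<close>
  in the integrand gives a finite measure, to which Fubini's theorem applies.
\<close>

definition weight :: "'w measure" where
  "weight = density \<mu> (\<lambda>u. ennreal \<bar>\<Phi> u\<bar>)"

definition \<Phi>_norm :: real where
  "\<Phi>_norm = (\<integral>u. \<bar>\<Phi> u\<bar> \<partial>\<mu>)"

lemma measurable_\<Phi> [measurable]: "\<Phi> \<in> borel_measurable \<mu>"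
  using integrable_\<Phi> by simp

lemma sets_weight [measurable_cong]: "sets weight = sets \<mu>"
  by (simp add: weight_def)

lemma space_weight: "space weight = space \<mu>"
  by (simp add: weight_def)

lemma finite_weight: "finite_measure weight"
proof
  have "emeasure weight (space weight) = (\<integral>\<^sup>+u. ennreal \<bar>\<Phi> u\<bar> \<partial>\<mu>)"
    using emeasure_density[of "\<lambda>u. ennreal \<bar>\<Phi> u\<bar>" \<mu> "space \<mu>"]
    by (simp add: weight_def cong: nn_integral_cong)
  then show "emeasure weight (space weight) \<noteq> \<infinity>"
    using integrable_\<Phi> by (simp add: integrable_iff_bounded less_top)
qed

lemma \<Phi>_norm_nonneg: "0 \<le> \<Phi>_norm"
  by (simp add: \<Phi>_norm_def)

lemma A_aut: "u \<in> space \<mu> \<Longrightarrow> A u \<in> group_aut"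
  by (rule group_aut_borel_D(1)[OF A])

lemma measurable_orbit_fun:
  assumes "f \<in> borel_measurable \<nu>"
  shows "(\<lambda>u. f (A u x)) \<in> borel_measurable \<mu>"
  using measurable_compose[OF measurable_orbit[OF A], of f borel x] assms
  by (simp add: measurable_cong_sets[OF sets_haar refl])

text \<open>
  The integral over \<open>u\<close> exists only for almost every \<open>x\<close>, and joint measurability modulo null sets
  does not make it a Borel function of \<open>x\<close>. The operator is therefore treated as a relation between
  a function and the integrable representatives of its image.
\<close>

definition represents :: "('g \<Rightarrow> complex) \<Rightarrow> ('g \<Rightarrow> complex) \<Rightarrow> bool" where
  "represents h g \<longleftrightarrow> integrable \<nu> g \<and>
     (AE x in \<nu>. integrable \<mu> (\<lambda>u. \<Phi> u *\<^sub>R h (A u x)) \<and> g x = (\<integral>u. \<Phi> u *\<^sub>R h (A u x) \<partial>\<mu>))"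

text \<open>
  A function measurable for the completed product agrees almost everywhere with one measurable for
  the product itself. Its sections have the \<open>L\<^sup>1\<close> norms of \<open>h \<circ> A u\<close>, that is of \<open>h\<close>, so it is
  integrable because the weight is finite.
\<close>

lemma kernel_representative:
  assumes h: "integrable \<nu> (h :: 'g \<Rightarrow> complex)"
  obtains H where "integrable (weight \<Otimes>\<^sub>M \<nu>) H"
    "AE u in weight. AE x in \<nu>. H (u, x) = sgn (\<Phi> u) *\<^sub>R h (A u x)"
    "AE x in \<nu>. AE u in weight. H (u, x) = sgn (\<Phi> u) *\<^sub>R h (A u x)"
proof -
  interpret W: finite_measure weight by (rule finite_weight)
  interpret pair_sigma_finite weight \<nu> by standard
  let ?M = "weight \<Otimes>\<^sub>M \<nu>"
  have h_meas: "h \<in> borel_measurable borel"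
    using borel_measurable_integrable[OF h] by (simp add: measurable_cong_sets[OF sets_haar refl])
  have act: "(\<lambda>(u, x). A u x) \<in> borel_measurable (completion ?M)"
    unfolding weight_def
    by (rule action_measurable_density[OF _ sets_haar joint integrable_\<Phi>]) standard
  have comp: "(\<lambda>w. h (A (fst w) (snd w))) \<in> borel_measurable (completion ?M)"
    using measurable_compose[OF act h_meas] by (simp add: case_prod_beta')
  then have re: "(\<lambda>w. Re (h (A (fst w) (snd w)))) \<in> borel_measurable (completion ?M)"
    and im: "(\<lambda>w. Im (h (A (fst w) (snd w)))) \<in> borel_measurable (completion ?M)"
    by auto
  obtain a where a: "a \<in> borel_measurable ?M" "AE w in ?M. Re (h (A (fst w) (snd w))) = a w"
    using completion_ex_borel_measurable_real[OF re] by blast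
  obtain b where b: "b \<in> borel_measurable ?M" "AE w in ?M. Im (h (A (fst w) (snd w))) = b w"
    using completion_ex_borel_measurable_real[OF im] by blast
  define H where "H w = sgn (\<Phi> (fst w)) *\<^sub>R Complex (a w) (b w)" for w
  have "H \<in> borel_measurable ?M"
  proof -
    have "(\<lambda>w. complex_of_real (a w) + \<i> * complex_of_real (b w)) \<in> borel_measurable ?M"
      using a(1) b(1) by measurable
    moreover have "(\<lambda>w. sgn (\<Phi> (fst w))) \<in> borel_measurable ?M"
      by (intro borel_measurable_sgn measurable_compose[OF measurable_fst]) simp
    ultimately show ?thesis
      unfolding H_def Complex_eq by (intro borel_measurable_scaleR)
  qed
  note H = this
  \<comment> \<open>A measurable exceptional set is fixed here, so that the order of the two quantifiers over
      almost all points can be exchanged.\<close>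
  have "AE w in ?M. H w = sgn (\<Phi> (fst w)) *\<^sub>R h (A (fst w) (snd w))"
    using a(2) b(2) by eventually_elim (simp add: H_def complex_eq_iff)
  then obtain N where N: "{w \<in> space ?M. \<not> H w = sgn (\<Phi> (fst w)) *\<^sub>R h (A (fst w) (snd w))} \<subseteq> N"
    "emeasure ?M N = 0" "N \<in> sets ?M"
    by (rule AE_E)
  have AE_N: "AE w in ?M. w \<notin> N"
    using N by (intro AE_not_in) auto
  have N_sound: "H (u, x) = sgn (\<Phi> u) *\<^sub>R h (A u x)"
    if "u \<in> space weight" "(u, x) \<notin> N" for u x
    using subsetD[OF N(1), of "(u, x)"] that by (auto simp: space_pair_measure)
  have N1: "AE u in weight. AE x in \<nu>. (u, x) \<notin> N"
    by (rule AE_pair[OF AE_N])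
  have N2: "AE x in \<nu>. AE u in weight. (u, x) \<notin> N"
    using N1 N(3) by (subst (asm) AE_commute) (auto simp: pred_def)
  have E1: "AE u in weight. AE x in \<nu>. H (u, x) = sgn (\<Phi> u) *\<^sub>R h (A u x)"
    using N1 AE_space[of weight] by eventually_elim (auto elim: eventually_mono intro: N_sound)
  have E2: "AE x in \<nu>. AE u in weight. H (u, x) = sgn (\<Phi> u) *\<^sub>R h (A u x)"
    using N2
  proof eventually_elim
    case (elim x)
    then show ?case
      using AE_space[of weight] by eventually_elim (auto intro: N_sound)
  qed
  have sections: "AE u in weight. integrable \<nu> (\<lambda>x. H (u, x)) \<and>
      (\<integral>x. norm (H (u, x)) \<partial>\<nu>) = \<bar>sgn (\<Phi> u)\<bar> * (\<integral>x. norm (h x) \<partial>\<nu>)"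
    using E1 AE_space[of weight]
  proof eventually_elim
    case (elim u)
    then have aut: "A u \<in> group_aut"
      by (simp add: A_aut space_weight)
    have Hu: "(\<lambda>x. H (u, x)) \<in> borel_measurable \<nu>"
      by (rule measurable_compose_Pair1[OF elim(2) H])
    have hA: "integrable \<nu> (\<lambda>x. h (A u x))"
      by (rule integrable_aut[OF aut h])
    have "integrable \<nu> (\<lambda>x. H (u, x))"
      using hA Hu elim(1) by (subst integrable_cong_AE[where g = "\<lambda>x. sgn (\<Phi> u) *\<^sub>R h (A u x)"]) auto
    moreover have "(\<integral>x. norm (H (u, x)) \<partial>\<nu>) = (\<integral>x. \<bar>sgn (\<Phi> u)\<bar> * norm (h (A u x)) \<partial>\<nu>)"
      using hA Hu elim(1) by (intro integral_cong_AE) auto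
    moreover have "(\<integral>x. norm (h (A u x)) \<partial>\<nu>) = (\<integral>x. norm (h x) \<partial>\<nu>)"
      using h by (intro integral_aut[OF aut]) simp
    ultimately show ?case by simp
  qed
  have "integrable weight (\<lambda>u. \<integral>x. norm (H (u, x)) \<partial>\<nu>)"
  proof (rule W.integrable_const_bound[where B = "\<integral>x. norm (h x) \<partial>\<nu>"])
    show "AE u in weight. norm (\<integral>x. norm (H (u, x)) \<partial>\<nu>) \<le> (\<integral>x. norm (h x) \<partial>\<nu>)"
      using sections by eventually_elim (auto simp: sgn_real_def)
    show "(\<lambda>u. \<integral>x. norm (H (u, x)) \<partial>\<nu>) \<in> borel_measurable weight"
    proof (rule sigma_finite_measure.borel_measurable_lebesgue_integral)
      show "sigma_finite_measure \<nu>" by standard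
      have "(\<lambda>w. norm (H w)) \<in> borel_measurable ?M"
        using H by simp
      then show "(\<lambda>(u, x). norm (H (u, x))) \<in> borel_measurable ?M"
        by (simp add: case_prod_beta')
    qed
  qed
  moreover have "AE u in weight. integrable \<nu> (\<lambda>x. H (u, x))"
    using sections by eventually_elim simp
  ultimately have "integrable ?M H"
    using Fubini_integrable[OF H] by simp
  then show ?thesis
    using E1 E2 by (rule that)
qed

lemma weight_to_\<mu>:
  fixes f :: "'w \<Rightarrow> complex"
  assumes "f \<in> borel_measurable \<mu>"
  shows "integrable weight (\<lambda>u. sgn (\<Phi> u) *\<^sub>R f u) \<longleftrightarrow> integrable \<mu> (\<lambda>u. \<Phi> u *\<^sub>R f u)"
    and "(\<integral>u. sgn (\<Phi> u) *\<^sub>R f u \<partial>weight) = (\<integral>u. \<Phi> u *\<^sub>R f u \<partial>\<mu>)"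
proof -
  have meas: "(\<lambda>u. sgn (\<Phi> u) *\<^sub>R f u) \<in> borel_measurable \<mu>"
    using assms by (intro borel_measurable_scaleR borel_measurable_sgn) auto
  have abs: "(\<lambda>u. \<bar>\<Phi> u\<bar>) \<in> borel_measurable \<mu>"
    by simp
  show "integrable weight (\<lambda>u. sgn (\<Phi> u) *\<^sub>R f u) \<longleftrightarrow> integrable \<mu> (\<lambda>u. \<Phi> u *\<^sub>R f u)"
    unfolding weight_def using integrable_density[OF meas abs] by (simp add: abs_mult_sgn mult.commute)
  show "(\<integral>u. sgn (\<Phi> u) *\<^sub>R f u \<partial>weight) = (\<integral>u. \<Phi> u *\<^sub>R f u \<partial>\<mu>)"
    unfolding weight_def using integral_density[OF meas abs] by (simp add: abs_mult_sgn mult.commute)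
qed

text \<open>
  Fubini's theorem for the kernel \<open>h (A u x)\<close> gives the existence of representatives, and moves a
  bounded test function inside the integral over \<open>u\<close>. The bound is stated on the inner integrals
  because these need not depend measurably on \<open>u\<close> everywhere.
\<close>

lemma represents_exists_pairing:
  assumes h: "integrable \<nu> h"
  shows "\<exists>g. represents h g \<and> (\<forall>k C. k \<in> borel_measurable \<nu> \<longrightarrow> (\<forall>x. cmod (k x) \<le> 1) \<longrightarrow>
        (AE u in \<mu>. cmod (\<integral>x. h (A u x) * k x \<partial>\<nu>) \<le> C) \<longrightarrow>
        cmod (\<integral>x. g x * k x \<partial>\<nu>) \<le> C * \<Phi>_norm)"
proof -
  interpret W: finite_measure weight by (rule finite_weight)
  interpret pair_sigma_finite weight \<nu> by standard
  obtain H where H: "integrable (weight \<Otimes>\<^sub>M \<nu>) H"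
    and E1: "AE u in weight. AE x in \<nu>. H (u, x) = sgn (\<Phi> u) *\<^sub>R h (A u x)"
    and E2: "AE x in \<nu>. AE u in weight. H (u, x) = sgn (\<Phi> u) *\<^sub>R h (A u x)"
    by (rule kernel_representative[OF h])
  define g where "g x = (\<integral>u. H (u, x) \<partial>weight)" for x
  have g: "integrable \<nu> g"
    unfolding g_def using integrable_snd[of "\<lambda>u x. H (u, x)"] H by simp
  have "AE x in \<nu>. integrable weight (\<lambda>u. H (u, x))"
    using AE_integrable_snd[of "\<lambda>u x. H (u, x)"] H by simp
  then have "AE x in \<nu>. integrable \<mu> (\<lambda>u. \<Phi> u *\<^sub>R h (A u x)) \<and> g x = (\<integral>u. \<Phi> u *\<^sub>R h (A u x) \<partial>\<mu>)"
    using E2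
  proof eventually_elim
    case (elim x)
    have orbit: "(\<lambda>u. h (A u x)) \<in> borel_measurable \<mu>"
      using h by (intro measurable_orbit_fun) simp
    then have orbit': "(\<lambda>u. sgn (\<Phi> u) *\<^sub>R h (A u x)) \<in> borel_measurable weight"
      by (intro borel_measurable_scaleR borel_measurable_sgn)
        (simp_all add: measurable_cong_sets[OF sets_weight refl])
    have "integrable weight (\<lambda>u. sgn (\<Phi> u) *\<^sub>R h (A u x))"
      by (rule iffD1[OF integrable_cong_AE[OF borel_measurable_integrable[OF elim(1)] orbit' elim(2)] elim(1)])
    moreover have "g x = (\<integral>u. sgn (\<Phi> u) *\<^sub>R h (A u x) \<partial>weight)"
      unfolding g_def using elim orbit' by (intro integral_cong_AE) auto
    ultimately show ?case
      using weight_to_\<mu>[OF orbit] by simp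
  qed
  with g have rep: "represents h g"
    by (simp add: represents_def)
  have pairing: "cmod (\<integral>x. g x * k x \<partial>\<nu>) \<le> C * \<Phi>_norm"
    if k: "k \<in> borel_measurable \<nu>" "\<And>x. cmod (k x) \<le> 1"
      and C: "AE u in \<mu>. cmod (\<integral>x. h (A u x) * k x \<partial>\<nu>) \<le> C" for k C
  proof -
    have Hk: "integrable (weight \<Otimes>\<^sub>M \<nu>) (\<lambda>w. H w * k (snd w))"
    proof (rule Bochner_Integration.integrable_bound[OF H])
      show "(\<lambda>w. H w * k (snd w)) \<in> borel_measurable (weight \<Otimes>\<^sub>M \<nu>)"
        using borel_measurable_integrable[OF H] measurable_compose[OF measurable_snd k(1)]
        by (rule borel_measurable_times)
      show "AE w in weight \<Otimes>\<^sub>M \<nu>. norm (H w * k (snd w)) \<le> norm (H w)"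
        by (rule AE_I2) (simp add: norm_mult mult_left_le k(2))
    qed
    have Hk': "integrable weight (\<lambda>u. \<integral>x. H (u, x) * k x \<partial>\<nu>)"
      using integrable_fst'[OF Hk] by simp
    have C_weight: "AE u in weight. cmod (\<integral>x. h (A u x) * k x \<partial>\<nu>) \<le> C"
      unfolding weight_def using C by (subst AE_density) auto
    have bound: "AE u in weight. cmod (\<integral>x. H (u, x) * k x \<partial>\<nu>) \<le> C"
      using E1 C_weight AE_space[of weight]
    proof eventually_elim
      case (elim u)
      have aut: "A u \<in> group_aut"
        using elim(3) by (simp add: A_aut space_weight)
      have hA: "(\<lambda>x. h (A u x)) \<in> borel_measurable \<nu>"
        using integrable_aut[OF aut h] by simp
      have Hu: "(\<lambda>x. H (u, x)) \<in> borel_measurable \<nu>"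
        by (rule measurable_compose_Pair1[OF elim(3) borel_measurable_integrable[OF H]])
      have "(\<integral>x. H (u, x) * k x \<partial>\<nu>) = (\<integral>x. sgn (\<Phi> u) *\<^sub>R (h (A u x) * k x) \<partial>\<nu>)"
        using elim(1) hA Hu k(1) by (intro integral_cong_AE) auto
      then have "cmod (\<integral>x. H (u, x) * k x \<partial>\<nu>) = \<bar>sgn (\<Phi> u)\<bar> * cmod (\<integral>x. h (A u x) * k x \<partial>\<nu>)"
        by simp
      also have "\<dots> \<le> cmod (\<integral>x. h (A u x) * k x \<partial>\<nu>)"
        by (intro mult_left_le_one_le) (auto simp: sgn_real_def)
      finally show ?case
        using elim(2) by simp
    qed
    have "(\<integral>x. g x * k x \<partial>\<nu>) = (\<integral>x. (\<integral>u. H (u, x) * k x \<partial>weight) \<partial>\<nu>)"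
      by (simp add: g_def)
    also have "\<dots> = (\<integral>u. (\<integral>x. H (u, x) * k x \<partial>\<nu>) \<partial>weight)"
      using Fubini_integral[of "\<lambda>u x. H (u, x) * k x"] Hk by (simp add: case_prod_beta')
    also have "cmod \<dots> \<le> (\<integral>u. cmod (\<integral>x. H (u, x) * k x \<partial>\<nu>) \<partial>weight)"
      by (rule integral_norm_bound)
    also have "\<dots> \<le> (\<integral>u. C \<partial>weight)"
      using Hk' bound by (intro integral_mono_AE) auto
    also have "\<dots> = (\<integral>u. \<bar>\<Phi> u\<bar> *\<^sub>R C \<partial>\<mu>)"
      unfolding weight_def by (rule integral_density) auto
    also have "\<dots> = C * \<Phi>_norm"
      by (simp add: \<Phi>_norm_def)
    finally show ?thesis .
  qed
  show ?thesis
    by (intro exI[of _ g] conjI rep allI impI pairing) auto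
qed

lemma represents_unique:
  assumes "represents h g" "represents h g'"
  shows "AE x in \<nu>. g x = g' x"
  using assms[unfolded represents_def, THEN conjunct2] by eventually_elim simp

lemma represents_exists:
  assumes "integrable \<nu> h"
  obtains g where "represents h g"
  using represents_exists_pairing[OF assms] that by (elim exE conjE)

lemma represents_pairing:
  assumes h: "integrable \<nu> h" and g: "represents h g"
    and k: "k \<in> borel_measurable \<nu>" "\<And>x. cmod (k x) \<le> 1"
    and C: "AE u in \<mu>. cmod (\<integral>x. h (A u x) * k x \<partial>\<nu>) \<le> C"
  shows "cmod (\<integral>x. g x * k x \<partial>\<nu>) \<le> C * \<Phi>_norm"
proof -
  obtain g' where g': "represents h g'" and pairing: "(\<forall>k C. k \<in> borel_measurable \<nu> \<longrightarrow> (\<forall>x. cmod (k x) \<le> 1) \<longrightarrow>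
        (AE u in \<mu>. cmod (\<integral>x. h (A u x) * k x \<partial>\<nu>) \<le> C) \<longrightarrow>
        cmod (\<integral>x. g' x * k x \<partial>\<nu>) \<le> C * \<Phi>_norm)"
    using represents_exists_pairing[OF h] by (elim exE conjE)
  have bound: "cmod (\<integral>x. g' x * k x \<partial>\<nu>) \<le> C * \<Phi>_norm"
    using pairing[rule_format, OF k C] .
  have "(\<integral>x. g x * k x \<partial>\<nu>) = (\<integral>x. g' x * k x \<partial>\<nu>)"
    using represents_unique[OF g g'] g g' k(1)
    by (intro integral_cong_AE) (auto simp: represents_def)
  with bound show ?thesis by simp
qed

text \<open>
  Test a representative against its own conjugate phase: the inner integrals are at most the \<open>L\<^sup>1\<close>
  norm of \<open>h \<circ> A u\<close>, which is that of \<open>h\<close>.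
\<close>

lemma represents_norm:
  assumes h: "integrable \<nu> h" and g: "represents h g"
  shows "(\<integral>x. cmod (g x) \<partial>\<nu>) \<le> \<Phi>_norm * (\<integral>x. cmod (h x) \<partial>\<nu>)"
proof -
  define k where "k x = cnj (sgn (g x))" for x
  have g_meas: "g \<in> borel_measurable \<nu>"
    using g by (auto simp: represents_def)
  then have k: "k \<in> borel_measurable \<nu>"
    unfolding k_def sgn_div_norm
    by (intro measurable_cnj borel_measurable_scaleR borel_measurable_inverse) simp_all
  have k1: "cmod (k x) \<le> 1" for x
    by (simp add: k_def norm_sgn)
  have "AE u in \<mu>. cmod (\<integral>x. h (A u x) * k x \<partial>\<nu>) \<le> (\<integral>x. cmod (h x) \<partial>\<nu>)"
  proof (rule AE_I2)
    fix u assume u: "u \<in> space \<mu>"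
    have hA: "integrable \<nu> (\<lambda>x. h (A u x))"
      by (rule integrable_aut[OF A_aut[OF u] h])
    have "cmod (\<integral>x. h (A u x) * k x \<partial>\<nu>) \<le> (\<integral>x. cmod (h (A u x) * k x) \<partial>\<nu>)"
      by (rule integral_norm_bound)
    also have "\<dots> \<le> (\<integral>x. cmod (h (A u x)) \<partial>\<nu>)"
    proof (rule integral_mono')
      show "integrable \<nu> (\<lambda>x. cmod (h (A u x)))"
        using hA by simp
      show "cmod (h (A u x) * k x) \<le> cmod (h (A u x))" for x
        using k1[of x] by (simp add: norm_mult mult_left_le)
    qed simp
    also have "\<dots> = (\<integral>x. cmod (h x) \<partial>\<nu>)"
      using h by (intro integral_aut[OF A_aut[OF u]]) simp
    finally show "cmod (\<integral>x. h (A u x) * k x \<partial>\<nu>) \<le> (\<integral>x. cmod (h x) \<partial>\<nu>)" .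
  qed
  from represents_pairing[OF h g k k1 this]
  have "cmod (\<integral>x. g x * k x \<partial>\<nu>) \<le> \<Phi>_norm * (\<integral>x. cmod (h x) \<partial>\<nu>)"
    by (simp add: mult.commute)
  moreover have "g x * k x = of_real (cmod (g x))" for x
  proof (cases "g x = 0")
    case False
    have "g x * k x = (g x * cnj (g x)) / of_real (cmod (g x))"
      by (simp add: k_def sgn_eq)
    also have "\<dots> = of_real ((cmod (g x))\<^sup>2) / of_real (cmod (g x))"
      by (simp only: complex_norm_square)
    finally show ?thesis
      using False by (simp add: power2_eq_square)
  qed (simp add: k_def)
  ultimately show ?thesis
    by (simp add: integral_nonneg_AE)
qed

lemma represents_cnj:
  assumes "represents h g"
  shows "represents (\<lambda>x. cnj (h x)) (\<lambda>x. cnj (g x))"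
proof -
  have "AE x in \<nu>. integrable \<mu> (\<lambda>u. cnj (\<Phi> u *\<^sub>R h (A u x))) \<and>
      cnj (g x) = (\<integral>u. cnj (\<Phi> u *\<^sub>R h (A u x)) \<partial>\<mu>)"
    using assms[unfolded represents_def, THEN conjunct2]
    by eventually_elim (simp del: complex_cnj_scaleR)
  then show ?thesis
    using assms by (simp add: represents_def)
qed

lemma represents_add:
  assumes "represents h g" "represents h' g'"
  shows "represents (\<lambda>x. h x + h' x) (\<lambda>x. g x + g' x)"
proof -
  have "AE x in \<nu>. integrable \<mu> (\<lambda>u. \<Phi> u *\<^sub>R h (A u x) + \<Phi> u *\<^sub>R h' (A u x)) \<and>
      g x + g' x = (\<integral>u. \<Phi> u *\<^sub>R h (A u x) + \<Phi> u *\<^sub>R h' (A u x) \<partial>\<mu>)"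
    using assms[unfolded represents_def, THEN conjunct2] by eventually_elim simp
  then show ?thesis
    using assms by (simp add: represents_def scaleR_add_right)
qed

lemma represents_scale:
  assumes "represents h g"
  shows "represents (\<lambda>x. c * h x) (\<lambda>x. c * g x)"
proof -
  have "AE x in \<nu>. integrable \<mu> (\<lambda>u. c * (\<Phi> u *\<^sub>R h (A u x))) \<and>
      c * g x = (\<integral>u. c * (\<Phi> u *\<^sub>R h (A u x)) \<partial>\<mu>)"
    using assms[unfolded represents_def, THEN conjunct2] by eventually_elim (simp del: mult_scaleR_right)
  then show ?thesis
    using assms by (simp add: represents_def)
qed

lemma represents_diff:
  "represents h g \<Longrightarrow> represents h' g' \<Longrightarrow> represents (\<lambda>x. h x - h' x) (\<lambda>x. g x - g' x)"
  using represents_add[OF _ represents_scale[of h' g' "-1"]] by simp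

lemma represents_const: "represents (\<lambda>_. c) (\<lambda>_. c * of_real (\<integral>u. \<Phi> u \<partial>\<mu>))"
  using integrable_\<Phi> by (simp add: represents_def scaleR_conv_of_real mult.commute)

end

section \<open>Images of trigonometric polynomials\<close>

context hausdorff_operator
begin

lemma represents_pairing_bounded:
  assumes h: "integrable \<nu> h" and g: "represents h g"
    and k: "k \<in> borel_measurable \<nu>" "\<And>x. cmod (k x) \<le> B" and B: "B > 0"
    and C: "AE u in \<mu>. cmod (\<integral>x. h (A u x) * k x \<partial>\<nu>) \<le> C"
  shows "cmod (\<integral>x. g x * k x \<partial>\<nu>) \<le> C * \<Phi>_norm"
proof -
  define k' where "k' = (\<lambda>x. k x / of_real B)"
  have k': "k' \<in> borel_measurable \<nu>" "\<And>x. cmod (k' x) \<le> 1"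
    using k B by (auto simp: k'_def norm_divide)
  have scale: "(\<integral>x. w x * k' x \<partial>\<nu>) = (\<integral>x. w x * k x \<partial>\<nu>) / of_real B" for w
    by (simp add: k'_def)
  have "AE u in \<mu>. cmod (\<integral>x. h (A u x) * k' x \<partial>\<nu>) \<le> C / B"
    using C by eventually_elim (use B in \<open>simp add: scale norm_divide divide_right_mono\<close>)
  from represents_pairing[OF h g k' this] show ?thesis
    using B by (simp add: scale norm_divide field_simps)
qed

text \<open>
  Cutting a representative off on the null set where it exceeds the bound makes test functions
  formed from it bounded at every point, as the pairing estimate requires.
\<close>

lemma represents_bounded:
  assumes h: "integrable \<nu> h" "\<And>x. cmod (h x) \<le> 1"
  shows "\<exists>g. represents h g \<and> (\<forall>x. cmod (g x) \<le> \<Phi>_norm)"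
proof -
  obtain g where g: "represents h g"
    using represents_exists[OF h(1)] .
  have gi: "integrable \<nu> g"
    using g by (simp add: represents_def)
  have bound: "AE x in \<nu>. cmod (g x) \<le> \<Phi>_norm"
    using g[unfolded represents_def, THEN conjunct2]
  proof eventually_elim
    case (elim x)
    have "cmod (g x) \<le> (\<integral>u. norm (\<Phi> u *\<^sub>R h (A u x)) \<partial>\<mu>)"
      using elim integral_norm_bound by metis
    also have "\<dots> \<le> (\<integral>u. \<bar>\<Phi> u\<bar> \<partial>\<mu>)"
      using integrable_\<Phi> by (intro integral_mono') (auto intro!: mult_left_le h(2))
    finally show ?case
      by (simp add: \<Phi>_norm_def)
  qed
  define g' where "g' x = (if cmod (g x) \<le> \<Phi>_norm then g x else 0)" for x
  have ae: "AE x in \<nu>. g' x = g x"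
    using bound by eventually_elim (simp add: g'_def)
  have "g' \<in> borel_measurable \<nu>"
    using borel_measurable_integrable[OF gi] unfolding g'_def by measurable
  then have "integrable \<nu> g'"
    using integrable_cong_AE[OF _ borel_measurable_integrable[OF gi] ae] gi by simp
  moreover have "AE x in \<nu>. integrable \<mu> (\<lambda>u. \<Phi> u *\<^sub>R h (A u x)) \<and>
      g' x = (\<integral>u. \<Phi> u *\<^sub>R h (A u x) \<partial>\<mu>)"
    using g[unfolded represents_def, THEN conjunct2] ae by eventually_elim simp
  ultimately have "represents h g'"
    by (simp add: represents_def)
  then show ?thesis
    by (intro exI[of _ g'] conjI allI) (simp_all add: g'_def \<Phi>_norm_nonneg)
qed

text \<open>
  The image of a positive character is a \<open>\<mu>\<close>-average of positive characters, possibly of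
  infinitely many. Subtract from it the finite partial sum over the positive characters whose
  coefficients reach \<open>\<eta>\<close>. The remainder \<open>e\<close> is orthogonal to the partial sum, so its
  square norm is its pairing with the image itself; by Fubini's theorem that pairing is an average
  of the coefficients of \<open>e\<close> at positive characters, all at most \<open>\<eta>\<close>.
\<close>

lemma character_image_approximation:
  assumes \<theta>: "\<theta> \<in> P" and g: "represents \<theta> g" and \<epsilon>: "\<epsilon> > 0"
  shows "\<exists>t\<in>trig_span P. (\<integral>x. cmod (g x - t x) \<partial>\<nu>) < \<epsilon>"
proof -
  have \<theta>': "\<theta> \<in> characters"
    using \<theta> P_subset by auto
  have \<theta>i: "integrable \<nu> \<theta>"
    by (rule integrable_character[OF \<theta>'])
  obtain g' where g': "represents \<theta> g'" "\<And>x. cmod (g' x) \<le> \<Phi>_norm"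
    using represents_bounded[OF \<theta>i] by (auto simp: norm_character[OF \<theta>'])
  have g'i: "integrable \<nu> g'" and gi: "integrable \<nu> g"
    using g g' by (auto simp: represents_def)
  have g'm: "g' \<in> borel_measurable \<nu>"
    using g'i by simp
  \<comment> \<open>The squared \<open>L\<^sup>2\<close> norm of the remainder will be at most \<open>\<eta>\<close> times the norm of \<open>\<Phi>\<close>; the added \<open>1\<close>
      covers \<open>\<Phi> = 0\<close>.\<close>
  define \<eta> where "\<eta> = \<epsilon>\<^sup>2 / (\<Phi>_norm + 1)"
  have \<eta>: "\<eta> > 0" "\<eta> * \<Phi>_norm < \<epsilon>\<^sup>2"
    using \<epsilon> \<Phi>_norm_nonneg by (auto simp: \<eta>_def field_simps intro!: divide_pos_pos add_nonneg_pos)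
  define F where "F = {\<psi> \<in> P. \<eta> \<le> cmod (fourier_coeff g' \<psi>)}"
  have F: "finite F" "F \<subseteq> P" "F \<subseteq> characters"
    using finite_subset[OF _ finite_large_coefficients[OF g'm g'(2) \<eta>(1)], of F] P_subset
    by (auto simp: F_def)
  define t where "t = partial_sum g' F"
  have t: "t \<in> trig_span P"
    unfolding t_def by (rule partial_sum_in_trig_span[OF F(1,2)])
  define e where "e = (\<lambda>x. g' x - t x)"
  obtain D where D: "D > 0" "\<And>x. cmod (t x) \<le> D"
    using bounded_trig_span[OF t P_subset] by blast
  have tm: "t \<in> borel_measurable \<nu>"
    by (rule measurable_trig_span[OF t P_subset])
  have em: "e \<in> borel_measurable \<nu>"
    unfolding e_def using g'm tm by simp
  have e_bound: "cmod (e x) \<le> \<Phi>_norm + D" for x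
    unfolding e_def using g'(2)[of x] D(2)[of x] norm_triangle_ineq4[of "g' x" "t x"] by linarith
  have small: "cmod (fourier_coeff e \<psi>) \<le> \<eta>" if "\<psi> \<in> P" for \<psi>
    using fourier_coeff_remainder[OF g'i F(1,3), of \<psi>] that P_subset \<eta>(1)
    by (auto simp: e_def t_def F_def not_le)
  have "AE u in \<mu>. cmod (\<integral>x. \<theta> (A u x) * cnj (e x) \<partial>\<nu>) \<le> \<eta>"
    using positive
  proof eventually_elim
    case (elim u)
    have "\<theta> \<circ> A u \<in> P"
      by (rule group_aut_plus_D(2)[OF elim \<theta>])
    then have "cmod (fourier_coeff e (\<theta> \<circ> A u)) \<le> \<eta>"
      by (rule small)
    moreover have "(\<integral>x. \<theta> (A u x) * cnj (e x) \<partial>\<nu>) = (\<integral>x. cnj (e x * cnj (\<theta> (A u x))) \<partial>\<nu>)"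
      by (simp add: mult.commute)
    then have "(\<integral>x. \<theta> (A u x) * cnj (e x) \<partial>\<nu>) = cnj (fourier_coeff e (\<theta> \<circ> A u))"
      by (simp only: Bochner_Integration.integral_cnj fourier_coeff_def comp_def)
    ultimately show ?case by simp
  qed
  then have "cmod (\<integral>x. g' x * cnj (e x) \<partial>\<nu>) \<le> \<eta> * \<Phi>_norm"
    using em e_bound D(1) \<Phi>_norm_nonneg
    by (intro represents_pairing_bounded[OF \<theta>i g'(1), where B = "\<Phi>_norm + D"])
      (auto intro!: measurable_cnj)
  moreover have "of_real (\<integral>x. (cmod (e x))\<^sup>2 \<partial>\<nu>) = (\<integral>x. e x * cnj (g' x) \<partial>\<nu>)"
    using remainder_norm(1)[OF g'm g'(2) F(1,3)] by (simp add: e_def t_def)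
  moreover have "(\<integral>x. e x * cnj (g' x) \<partial>\<nu>) = cnj (\<integral>x. g' x * cnj (e x) \<partial>\<nu>)"
    by (subst Bochner_Integration.integral_cnj[symmetric]) (simp add: mult.commute)
  ultimately have "cmod (of_real (\<integral>x. (cmod (e x))\<^sup>2 \<partial>\<nu>)) \<le> \<eta> * \<Phi>_norm"
    by (simp only: complex_mod_cnj)
  then have sq: "(\<integral>x. (cmod (e x))\<^sup>2 \<partial>\<nu>) < \<epsilon>\<^sup>2"
    using \<eta>(2) unfolding norm_of_real by linarith
  have "e \<in> L2_functions \<nu>"
    using em e_bound unfolding L2_functions_def
    by (auto intro!: integrable_bounded[where B = "(\<Phi>_norm + D)\<^sup>2"] power_mono)
  from integral_norm_le_L2(2)[OF this] have "(\<integral>x. cmod (e x) \<partial>\<nu>) \<le> sqrt (\<integral>x. (cmod (e x))\<^sup>2 \<partial>\<nu>)" .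
  also have "\<dots> < \<epsilon>"
    using sq \<epsilon> by (simp add: real_less_lsqrt)
  finally have "(\<integral>x. cmod (e x) \<partial>\<nu>) < \<epsilon>" .
  moreover have "(\<integral>x. cmod (g x - t x) \<partial>\<nu>) = (\<integral>x. cmod (e x) \<partial>\<nu>)"
    using represents_unique[OF g g'(1)] gi em tm
    by (intro integral_cong_AE) (auto simp: e_def)
  ultimately show ?thesis
    using t by (intro bexI[of _ t]) auto
qed

text \<open>
  The span inherits the property from the characters because the operator is linear; the induction
  produces its own representative, which is compared with the given one at the end.
\<close>

lemma trig_image_approximation:
  assumes p: "p \<in> trig_span P" and g: "represents p g" and \<epsilon>: "\<epsilon> > 0"
  shows "\<exists>t\<in>trig_span P. (\<integral>x. cmod (g x - t x) \<partial>\<nu>) < \<epsilon>"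
proof -
  have "\<forall>\<epsilon>>0. \<exists>G. represents p G \<and> (\<exists>t\<in>trig_span P. (\<integral>x. cmod (G x - t x) \<partial>\<nu>) < \<epsilon>)"
    using p
  proof (induction rule: trig_span_induct)
    case zero
    have "represents (\<lambda>_. 0) (\<lambda>_. 0)"
      using represents_const[of 0] by simp
    then show ?case
      by (intro allI impI exI[of _ "\<lambda>_. 0"] conjI bexI[of _ "\<lambda>_. 0"] trig_span_zero) auto
  next
    case (step c \<theta> p)
    show ?case
    proof (intro allI impI)
      fix \<epsilon> :: real assume \<epsilon>: "\<epsilon> > 0"
      define \<delta> where "\<delta> = \<epsilon> / (cmod c + 1)"
      have c1: "cmod c + 1 > 0"
        by (rule add_nonneg_pos) auto
      have "(cmod c + 1) * \<delta> = \<epsilon>"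
        using c1 by (simp add: \<delta>_def)
      then have \<delta>: "\<delta> > 0" "cmod c * \<delta> + \<delta> = \<epsilon>"
        using divide_pos_pos[OF \<epsilon> c1] by (simp_all only: \<delta>_def distrib_right mult_1_left)
      obtain G1 where G1: "represents \<theta> G1"
        using represents_exists[OF integrable_P[OF trig_span_base[OF step(1)]]] .
      obtain t1 where t1: "t1 \<in> trig_span P" "(\<integral>x. cmod (G1 x - t1 x) \<partial>\<nu>) < \<delta>"
        using character_image_approximation[OF step(1) G1 \<delta>(1)] by blast
      obtain G2 t2 where G2: "represents p G2" and t2: "t2 \<in> trig_span P" "(\<integral>x. cmod (G2 x - t2 x) \<partial>\<nu>) < \<delta>"
        using step(3) \<delta>(1) by blast
      have i: "integrable \<nu> (\<lambda>x. G1 x - t1 x)" "integrable \<nu> (\<lambda>x. G2 x - t2 x)"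
        using G1 G2 integrable_P[OF t1(1)] integrable_P[OF t2(1)] by (auto simp: represents_def)
      have i': "integrable \<nu> (\<lambda>x. cmod c * cmod (G1 x - t1 x) + cmod (G2 x - t2 x))"
        using i by auto
      have "(\<integral>x. cmod ((c * G1 x + G2 x) - (c * t1 x + t2 x)) \<partial>\<nu>)
          \<le> (\<integral>x. cmod c * cmod (G1 x - t1 x) + cmod (G2 x - t2 x) \<partial>\<nu>)"
      proof (rule integral_mono'[OF i'])
        show "cmod ((c * G1 x + G2 x) - (c * t1 x + t2 x))
            \<le> cmod c * cmod (G1 x - t1 x) + cmod (G2 x - t2 x)" for x
        proof -
          have "(c * G1 x + G2 x) - (c * t1 x + t2 x) = c * (G1 x - t1 x) + (G2 x - t2 x)"
            by (simp add: algebra_simps)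
          then show ?thesis
            using norm_triangle_ineq[of "c * (G1 x - t1 x)" "G2 x - t2 x"] by (simp only: norm_mult)
        qed
      qed simp
      also have "\<dots> = cmod c * (\<integral>x. cmod (G1 x - t1 x) \<partial>\<nu>) + (\<integral>x. cmod (G2 x - t2 x) \<partial>\<nu>)"
        using i by simp
      also have "\<dots> < \<epsilon>"
        using mult_left_mono[OF less_imp_le[OF t1(2)] norm_ge_zero[of c]] t2(2) \<delta>(2) by linarith
      finally show "\<exists>G. represents (\<lambda>x. c * \<theta> x + p x) G \<and>
          (\<exists>t\<in>trig_span P. (\<integral>x. cmod (G x - t x) \<partial>\<nu>) < \<epsilon>)"
        using represents_add[OF represents_scale[OF G1] G2]
          trig_span_add[OF trig_span_scale[OF t1(1)] t2(1)]
        by (intro exI[of _ "\<lambda>x. c * G1 x + G2 x"] conjI bexI[of _ "\<lambda>x. c * t1 x + t2 x"])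
    qed
  qed
  then obtain G t where G: "represents p G" and t: "t \<in> trig_span P" "(\<integral>x. cmod (G x - t x) \<partial>\<nu>) < \<epsilon>"
    using \<epsilon> by blast
  have "(\<integral>x. cmod (g x - t x) \<partial>\<nu>) = (\<integral>x. cmod (G x - t x) \<partial>\<nu>)"
    using represents_unique[OF g G] g G measurable_trig_span[OF t(1) P_subset]
    by (intro integral_cong_AE) (auto simp: represents_def)
  with t show ?thesis
    by (intro bexI[of _ t]) auto
qed

end

section \<open>The operator on real Hardy space\<close>

context ordered_haar_group
begin

lemma hardy_approx_const: "hardy_approx \<nu> r (\<lambda>_ _. c) (\<lambda>_. c)"
proof -
  have "norm_1star \<nu> r (\<lambda>_. 0) = 0"
    using norm_1star_eq[OF order trig_span_zero, of 0] by simp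
  then show ?thesis
    by (simp add: hardy_approx_def real_pol_const)
qed

lemma const_in_real_hardy: "(\<lambda>_. c) \<in> real_hardy \<nu> r"
  using hardy_approx_const by (auto simp: real_hardy_def)

lemma real_hardy_norm_zero: "real_hardy_norm \<nu> r (\<lambda>_. 0) = 0"
proof -
  have "norm_1star \<nu> r (\<lambda>_. 0) = 0"
    using norm_1star_eq[OF order trig_span_zero, of 0] by simp
  moreover have "(\<lambda>_. norm_1star \<nu> r (\<lambda>_. 0)) \<longlonglongrightarrow> real_hardy_norm \<nu> r (\<lambda>_. 0)"
    by (rule real_hardy_norm_limit[OF _ hardy_approx_const]) simp
  ultimately show ?thesis
    by (simp add: LIMSEQ_const_iff)
qed

lemma hardy_approx_cong_AE:
  assumes q: "hardy_approx \<nu> r q f" and f: "integrable \<nu> f" "integrable \<nu> g"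
    and ae: "AE x in \<nu>. f x = g x"
  shows "hardy_approx \<nu> r q g"
proof -
  have "(\<integral>x. \<bar>q n x - g x\<bar> \<partial>\<nu>) = (\<integral>x. \<bar>q n x - f x\<bar> \<partial>\<nu>)" for n
  proof (rule integral_cong_AE)
    have "integrable \<nu> (q n)"
      using q by (intro integrable_real_pol) (simp add: hardy_approx_def)
    then show "(\<lambda>x. \<bar>q n x - g x\<bar>) \<in> borel_measurable \<nu>" "(\<lambda>x. \<bar>q n x - f x\<bar>) \<in> borel_measurable \<nu>"
      using f by auto
    show "AE x in \<nu>. \<bar>q n x - g x\<bar> = \<bar>q n x - f x\<bar>"
      using ae by eventually_elim simp
  qed
  with q show ?thesis
    by (simp add: hardy_approx_def)
qed

end

context hausdorff_operator
begin

lemma represents_real: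
  fixes f :: "'g \<Rightarrow> real"
  assumes "represents (\<lambda>x. of_real (f x)) g"
  shows "AE x in \<nu>. integrable \<mu> (\<lambda>u. \<Phi> u * f (A u x)) \<and> g x = of_real (hausdorff_op \<mu> \<Phi> A f x)"
  using assms[unfolded represents_def, THEN conjunct2]
proof eventually_elim
  case (elim x)
  have eq: "(\<lambda>u. \<Phi> u *\<^sub>R complex_of_real (f (A u x))) = (\<lambda>u. complex_of_real (\<Phi> u * f (A u x)))"
    by (simp add: scaleR_conv_of_real)
  have "integrable \<mu> (\<lambda>u. complex_of_real (\<Phi> u * f (A u x)))"
    using elim unfolding eq by (rule conjunct1)
  from integrable_Re[OF this] have "integrable \<mu> (\<lambda>u. \<Phi> u * f (A u x))"
    by simp
  moreover have "g x = of_real (hausdorff_op \<mu> \<Phi> A f x)"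
    using elim unfolding eq hausdorff_op_def integral_complex_of_real by (rule conjunct2)
  ultimately show ?case ..
qed

text \<open>
  The image of \<open>c + 2 Re p\<close> is \<open>c \<integral>\<Phi> + 2 Re G\<close>, and \<open>t\<close> is a polynomial near \<open>G\<close> with strictly positive
  spectrum. The two parts of the norm of \<open>c \<integral>\<Phi> + 2 Re t\<close> are the \<open>L\<^sup>1\<close> norms of approximate images of
  the two parts of the original, and on \<open>L\<^sup>1\<close> the operator has norm at most \<open>\<integral>\<bar>\<Phi>\<bar>\<close>.
\<close>

lemma norm_1star_image_le:
  assumes p: "p \<in> trig_span P" and G: "represents p G"
    and t: "t \<in> trig_span P" "(\<integral>x. cmod (G x - t x) \<partial>\<nu>) \<le> \<delta>"
  shows "norm_1star \<nu> r (\<lambda>x. c * (\<integral>u. \<Phi> u \<partial>\<mu>) + 2 * Re (t x))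
    \<le> \<Phi>_norm * norm_1star \<nu> r (\<lambda>x. c + 2 * Re (p x)) + 2 * \<delta>"
proof -
  let ?I = "\<integral>u. \<Phi> u \<partial>\<mu>"
  have pi: "integrable \<nu> p" and ti: "integrable \<nu> t"
    using integrable_P p t by auto
  have Gi: "integrable \<nu> G"
    using G by (simp add: represents_def)
  have triangle: "(\<integral>x. cmod (a + t x) \<partial>\<nu>) \<le> (\<integral>x. cmod (a + G x) \<partial>\<nu>) + \<delta>" for a
  proof -
    have i: "integrable \<nu> (\<lambda>x. cmod (a + G x) + cmod (G x - t x))"
      using Gi ti by simp
    have "(\<integral>x. cmod (a + t x) \<partial>\<nu>) \<le> (\<integral>x. cmod (a + G x) + cmod (G x - t x) \<partial>\<nu>)"
    proof (rule integral_mono'[OF i])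
      show "cmod (a + t x) \<le> cmod (a + G x) + cmod (G x - t x)" for x
        using norm_triangle_ineq4[of "a + G x" "G x - t x"] by simp
    qed simp
    also have "\<dots> = (\<integral>x. cmod (a + G x) \<partial>\<nu>) + (\<integral>x. cmod (G x - t x) \<partial>\<nu>)"
      using Gi ti by simp
    finally show ?thesis using t(2) by simp
  qed
  have "represents (\<lambda>x. of_real c + p x) (\<lambda>x. of_real c * of_real ?I + G x)"
    by (intro represents_add represents_const G)
  from represents_norm[OF _ this]
  have "(\<integral>x. cmod (of_real (c * ?I) + G x) \<partial>\<nu>) \<le> \<Phi>_norm * (\<integral>x. cmod (of_real c + p x) \<partial>\<nu>)"
    using pi by simp
  moreover have "(\<integral>x. cmod (G x) \<partial>\<nu>) \<le> \<Phi>_norm * (\<integral>x. cmod (p x) \<partial>\<nu>)"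
    by (rule represents_norm[OF pi G])
  ultimately show ?thesis
    unfolding norm_1star_eq[OF order t(1)] norm_1star_eq[OF order p]
    using triangle[of 0] triangle[of "of_real (c * ?I)"] by (simp add: distrib_left)
qed

text \<open>
  Each image of an approximating polynomial is replaced by a nearby polynomial. The previous
  estimate, applied to differences, makes these a Cauchy sequence for the completed norm, and the
  \<open>L\<^sup>1\<close> bound of the operator identifies their limit as the image of \<open>f\<close>.
\<close>

lemma hardy_image:
  assumes f: "integrable \<nu> f" and q: "hardy_approx \<nu> r q f"
  shows "\<exists>g s. integrable \<nu> g \<and> hardy_approx \<nu> r s g \<and>
    (AE x in \<nu>. integrable \<mu> (\<lambda>u. \<Phi> u * f (A u x)) \<and> hausdorff_op \<mu> \<Phi> A f x = g x) \<and>
    (\<forall>n. norm_1star \<nu> r (s n) \<le> \<Phi>_norm * norm_1star \<nu> r (q n) + 2 / (real n + 1))"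
proof -
  let ?I = "\<integral>u. \<Phi> u \<partial>\<mu>"
  have q_pol: "q n \<in> real_pol" for n
    using q by (simp add: hardy_approx_def)
  have "\<forall>n. \<exists>c p. p \<in> trig_span P \<and> q n = (\<lambda>x. c + 2 * Re (p x))"
    using real_pol_decomposition[OF order q_pol] by metis
  then obtain c p where p: "\<And>n. p n \<in> trig_span P" and q_eq: "\<And>n. q n = (\<lambda>x. c n + 2 * Re (p n x))"
    by metis
  have "\<forall>n. \<exists>G. represents (p n) G"
    using represents_exists[OF integrable_P[OF p]] by metis
  then obtain G where G: "\<And>n. represents (p n) (G n)"
    by metis
  have Gi: "integrable \<nu> (G n)" for n
    using G by (simp add: represents_def)
  have "\<exists>t\<in>trig_span P. (\<integral>x. cmod (G n x - t x) \<partial>\<nu>) < 1 / (real n + 1)" for n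
    by (rule trig_image_approximation[OF p G]) simp
  then obtain t where t: "\<And>n. t n \<in> trig_span P"
    and t_close: "\<And>n. (\<integral>x. cmod (G n x - t n x) \<partial>\<nu>) < 1 / (real n + 1)"
    by metis
  have ti: "integrable \<nu> (t n)" for n
    by (rule integrable_P[OF t])
  define s where "s = (\<lambda>n x. c n * ?I + 2 * Re (t n x))"
  have s_pol: "s n \<in> real_pol" for n
    unfolding s_def by (rule real_pol_of_positive[OF t])
  have bound: "norm_1star \<nu> r (s n) \<le> \<Phi>_norm * norm_1star \<nu> r (q n) + 2 / (real n + 1)" for n
    using norm_1star_image_le[OF p G t less_imp_le[OF t_close[of n]], where c = "c n"]
    by (simp add: s_def q_eq)
  have bound_diff: "norm_1star \<nu> r (\<lambda>x. s m x - s n x)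
      \<le> \<Phi>_norm * norm_1star \<nu> r (\<lambda>x. q m x - q n x) + 2 * (1 / (real m + 1) + 1 / (real n + 1))" for m n
  proof -
    have i: "integrable \<nu> (\<lambda>x. cmod (G m x - t m x) + cmod (G n x - t n x))"
      using Gi ti by simp
    have "(\<integral>x. cmod ((G m x - G n x) - (t m x - t n x)) \<partial>\<nu>)
        \<le> (\<integral>x. cmod (G m x - t m x) + cmod (G n x - t n x) \<partial>\<nu>)"
    proof (rule integral_mono'[OF i])
      show "cmod ((G m x - G n x) - (t m x - t n x)) \<le> cmod (G m x - t m x) + cmod (G n x - t n x)" for x
        using norm_triangle_ineq4[of "G m x - t m x" "G n x - t n x"] by (simp add: algebra_simps)
    qed simp
    also have "\<dots> = (\<integral>x. cmod (G m x - t m x) \<partial>\<nu>) + (\<integral>x. cmod (G n x - t n x) \<partial>\<nu>)"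
      using Gi ti by simp
    finally have close: "(\<integral>x. cmod ((G m x - G n x) - (t m x - t n x)) \<partial>\<nu>) \<le> 1 / (real m + 1) + 1 / (real n + 1)"
      using t_close[of m] t_close[of n] by linarith
    have "(\<lambda>x. s m x - s n x) = (\<lambda>x. (c m - c n) * ?I + 2 * Re (t m x - t n x))"
      "(\<lambda>x. q m x - q n x) = (\<lambda>x. (c m - c n) + 2 * Re (p m x - p n x))"
      by (auto simp: s_def q_eq algebra_simps)
    then show ?thesis
      using norm_1star_image_le[OF trig_span_diff[OF p p] represents_diff[OF G G] trig_span_diff[OF t t] close]
      by simp
  qed
  obtain gc where gc: "represents (\<lambda>x. complex_of_real (f x)) gc"
    using represents_exists[OF integrable_of_real[OF f]] .
  have gci: "integrable \<nu> gc"
    using gc by (simp add: represents_def)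
  define g where "g x = Re (gc x)" for x
  have gi: "integrable \<nu> g"
    unfolding g_def using gci by (rule integrable_Re)
  have op: "AE x in \<nu>. integrable \<mu> (\<lambda>u. \<Phi> u * f (A u x)) \<and> hausdorff_op \<mu> \<Phi> A f x = g x"
    using represents_real[OF gc] by eventually_elim (simp add: g_def)
  have small: "(\<lambda>n. 1 / (real n + 1)) \<longlonglongrightarrow> 0"
    using LIMSEQ_inverse_real_of_nat by (simp add: inverse_eq_divide add.commute)
  have approx: "hardy_approx \<nu> r s g"
    unfolding hardy_approx_def
  proof (intro conjI allI impI s_pol)
    fix \<epsilon> :: real assume \<epsilon>: "\<epsilon> > 0"
    define \<delta> where "\<delta> = \<epsilon> / (2 * (\<Phi>_norm + 1))"
    have \<delta>: "\<delta> > 0" "\<Phi>_norm * \<delta> < \<epsilon> / 2"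
      using \<epsilon> \<Phi>_norm_nonneg by (auto simp: \<delta>_def field_simps intro!: divide_pos_pos)
    obtain N1 where N1: "\<And>m n. m \<ge> N1 \<Longrightarrow> n \<ge> N1 \<Longrightarrow> norm_1star \<nu> r (\<lambda>x. q m x - q n x) < \<delta>"
      using q \<delta>(1) unfolding hardy_approx_def by blast
    obtain N2 where N2: "\<And>n. n \<ge> N2 \<Longrightarrow> 1 / (real n + 1) < \<epsilon> / 8"
      using LIMSEQ_D[OF small, of "\<epsilon> / 8"] \<epsilon> by auto
    show "\<exists>N. \<forall>m\<ge>N. \<forall>n\<ge>N. norm_1star \<nu> r (\<lambda>x. s m x - s n x) < \<epsilon>"
    proof (intro exI[of _ "max N1 N2"] allI impI)
      fix m n assume mn: "max N1 N2 \<le> m" "max N1 N2 \<le> n"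
      have "\<Phi>_norm * norm_1star \<nu> r (\<lambda>x. q m x - q n x) \<le> \<Phi>_norm * \<delta>"
        using N1[of m n] mn \<Phi>_norm_nonneg by (intro mult_left_mono) auto
      then show "norm_1star \<nu> r (\<lambda>x. s m x - s n x) < \<epsilon>"
        using bound_diff[of m n] \<delta>(2) N2[of m] N2[of n] mn by simp
    qed
  next
    define d where "d n x = gc x - (of_real (c n) * of_real ?I + (G n x + cnj (G n x)))" for n x
    have L1: "(\<integral>x. \<bar>s n x - g x\<bar> \<partial>\<nu>) \<le> \<Phi>_norm * (\<integral>x. \<bar>q n x - f x\<bar> \<partial>\<nu>) + 2 * (1 / (real n + 1))" for n
    proof -
      have "represents (\<lambda>x. of_real (f x) - (of_real (c n) + (p n x + cnj (p n x)))) (d n)"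
        unfolding d_def
        by (intro represents_diff gc represents_add represents_const represents_cnj G)
      moreover have "complex_of_real (f x) - (of_real (c n) + (p n x + cnj (p n x))) = of_real (f x - q n x)" for x
        by (simp add: q_eq complex_add_cnj)
      ultimately have rep: "represents (\<lambda>x. of_real (f x - q n x)) (d n)"
        by simp
      have fq: "integrable \<nu> (\<lambda>x. f x - q n x)"
        using f integrable_real_pol[OF q_pol] by simp
      have dn: "(\<integral>x. cmod (d n x) \<partial>\<nu>) \<le> \<Phi>_norm * (\<integral>x. \<bar>q n x - f x\<bar> \<partial>\<nu>)"
        using represents_norm[OF integrable_of_real[OF fq] rep]
        by (simp only: norm_of_real abs_minus_commute)
      have di: "integrable \<nu> (d n)"
        using rep by (simp add: represents_def)
      have i: "integrable \<nu> (\<lambda>x. cmod (d n x) + 2 * cmod (G n x - t n x))"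
        using di Gi ti by simp
      have "(\<integral>x. \<bar>s n x - g x\<bar> \<partial>\<nu>) \<le> (\<integral>x. cmod (d n x) + 2 * cmod (G n x - t n x) \<partial>\<nu>)"
      proof (rule integral_mono'[OF i])
        fix x
        have "s n x - g x = - Re (d n x) - 2 * Re (G n x - t n x)"
          by (simp add: s_def g_def d_def)
        then show "\<bar>s n x - g x\<bar> \<le> cmod (d n x) + 2 * cmod (G n x - t n x)"
          using abs_Re_le_cmod[of "d n x"] abs_Re_le_cmod[of "G n x - t n x"] by linarith
      qed simp
      also have "\<dots> = (\<integral>x. cmod (d n x) \<partial>\<nu>) + 2 * (\<integral>x. cmod (G n x - t n x) \<partial>\<nu>)"
        using di Gi ti by simp
      finally show ?thesis
        using dn t_close[of n] by linarith
    qed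
    have "(\<lambda>n. \<Phi>_norm * (\<integral>x. \<bar>q n x - f x\<bar> \<partial>\<nu>) + 2 * (1 / (real n + 1))) \<longlonglongrightarrow> \<Phi>_norm * 0 + 2 * 0"
      using q unfolding hardy_approx_def by (intro tendsto_intros small) auto
    then have lim: "(\<lambda>n. \<Phi>_norm * (\<integral>x. \<bar>q n x - f x\<bar> \<partial>\<nu>) + 2 * (1 / (real n + 1))) \<longlonglongrightarrow> 0"
      by simp
    show "(\<lambda>n. \<integral>x. \<bar>s n x - g x\<bar> \<partial>\<nu>) \<longlonglongrightarrow> 0"
      by (rule Lim_null_comparison[OF _ lim]) (use L1 in auto)
  qed
  show ?thesis
    by (intro exI[of _ g] exI[of _ s] conjI gi approx op allI bound)
qed

lemma real_hardy_image:
  assumes f: "f \<in> real_hardy \<nu> r"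
  shows "\<exists>g\<in>real_hardy \<nu> r.
      AE x in \<nu>. integrable \<mu> (\<lambda>u. \<Phi> u * f (A u x)) \<and> hausdorff_op \<mu> \<Phi> A f x = g x"
proof -
  obtain q where q: "integrable \<nu> f" "hardy_approx \<nu> r q f"
    using f by (auto simp: real_hardy_def)
  obtain g s where "integrable \<nu> g" "hardy_approx \<nu> r s g"
    "AE x in \<nu>. integrable \<mu> (\<lambda>u. \<Phi> u * f (A u x)) \<and> hausdorff_op \<mu> \<Phi> A f x = g x"
    using hardy_image[OF q] by (elim exE conjE)
  then show ?thesis
    by (intro bexI[of _ g]) (auto simp: real_hardy_def)
qed

lemma real_hardy_norm_image_le:
  assumes f: "f \<in> real_hardy \<nu> r" and g: "g \<in> real_hardy \<nu> r"
    and op: "AE x in \<nu>. hausdorff_op \<mu> \<Phi> A f x = g x"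
  shows "real_hardy_norm \<nu> r g \<le> \<Phi>_norm * real_hardy_norm \<nu> r f"
proof -
  obtain q where q: "integrable \<nu> f" "hardy_approx \<nu> r q f"
    using f by (auto simp: real_hardy_def)
  have gi: "integrable \<nu> g"
    using g by (simp add: real_hardy_def)
  obtain g' s where g': "integrable \<nu> g'" "hardy_approx \<nu> r s g'"
    "AE x in \<nu>. integrable \<mu> (\<lambda>u. \<Phi> u * f (A u x)) \<and> hausdorff_op \<mu> \<Phi> A f x = g' x"
    and bound: "\<forall>n. norm_1star \<nu> r (s n) \<le> \<Phi>_norm * norm_1star \<nu> r (q n) + 2 / (real n + 1)"
    using hardy_image[OF q] by (elim exE conjE)
  have "AE x in \<nu>. g' x = g x"
    using g'(3) op by eventually_elim simp
  then have s: "hardy_approx \<nu> r s g"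
    by (rule hardy_approx_cong_AE[OF g'(2,1) gi])
  have small: "(\<lambda>n. 1 / (real n + 1)) \<longlonglongrightarrow> 0"
    using LIMSEQ_inverse_real_of_nat by (simp add: inverse_eq_divide add.commute)
  have "(\<lambda>n. \<Phi>_norm * norm_1star \<nu> r (q n) + 2 * (1 / (real n + 1)))
      \<longlonglongrightarrow> \<Phi>_norm * real_hardy_norm \<nu> r f + 2 * 0"
    by (intro tendsto_intros small real_hardy_norm_limit[OF q])
  then have "(\<lambda>n. \<Phi>_norm * norm_1star \<nu> r (q n) + 2 / (real n + 1)) \<longlonglongrightarrow> \<Phi>_norm * real_hardy_norm \<nu> r f"
    by simp
  from LIMSEQ_le[OF real_hardy_norm_limit[OF gi s] this] bound show ?thesis
    by blast
qed

lemma hausdorff_bounded_of_integrable: "hausdorff_bounded \<nu> r \<mu> \<Phi> A"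
  unfolding hausdorff_bounded_def
proof (intro conjI ballI)
  fix f assume "f \<in> real_hardy \<nu> r"
  then obtain g where g: "g \<in> real_hardy \<nu> r"
    "AE x in \<nu>. integrable \<mu> (\<lambda>u. \<Phi> u * f (A u x)) \<and> hausdorff_op \<mu> \<Phi> A f x = g x"
    using real_hardy_image by blast
  from g(2) show "AE x in \<nu>. integrable \<mu> (\<lambda>u. \<Phi> u * f (A u x))"
    by eventually_elim simp
  from g(2) have "AE x in \<nu>. hausdorff_op \<mu> \<Phi> A f x = g x"
    by eventually_elim simp
  with g(1) show "\<exists>g\<in>real_hardy \<nu> r. AE x in \<nu>. hausdorff_op \<mu> \<Phi> A f x = g x"
    by blast
qed (use real_hardy_norm_image_le in blast)

lemma hausdorff_norm_le: "hausdorff_norm \<nu> r \<mu> \<Phi> A \<le> \<Phi>_norm"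
  unfolding hausdorff_norm_def
proof (rule cSup_least)
  have "AE x in \<nu>. hausdorff_op \<mu> \<Phi> A (\<lambda>_. 0) x = 0"
    by (simp add: hausdorff_op_def)
  then have "real_hardy_norm \<nu> r (\<lambda>_. 0) \<in> {real_hardy_norm \<nu> r g | f g. f \<in> real_hardy \<nu> r \<and>
      real_hardy_norm \<nu> r f \<le> 1 \<and> g \<in> real_hardy \<nu> r \<and> (AE x in \<nu>. hausdorff_op \<mu> \<Phi> A f x = g x)}"
    using const_in_real_hardy[of 0] real_hardy_norm_zero
    by (intro CollectI exI[of _ "\<lambda>_. 0"]) auto
  then show "{real_hardy_norm \<nu> r g | f g. f \<in> real_hardy \<nu> r \<and> real_hardy_norm \<nu> r f \<le> 1 \<and>
      g \<in> real_hardy \<nu> r \<and> (AE x in \<nu>. hausdorff_op \<mu> \<Phi> A f x = g x)} \<noteq> {}"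
    by blast
next
  fix y assume "y \<in> {real_hardy_norm \<nu> r g | f g. f \<in> real_hardy \<nu> r \<and> real_hardy_norm \<nu> r f \<le> 1 \<and>
      g \<in> real_hardy \<nu> r \<and> (AE x in \<nu>. hausdorff_op \<mu> \<Phi> A f x = g x)}"
  then obtain f g where fg: "y = real_hardy_norm \<nu> r g" "f \<in> real_hardy \<nu> r" "real_hardy_norm \<nu> r f \<le> 1"
    "g \<in> real_hardy \<nu> r" "AE x in \<nu>. hausdorff_op \<mu> \<Phi> A f x = g x"
    by blast
  have "y \<le> \<Phi>_norm * real_hardy_norm \<nu> r f"
    using real_hardy_norm_image_le[OF fg(2,4,5)] fg(1) by simp
  also have "\<dots> \<le> \<Phi>_norm"
    using mult_left_mono[OF fg(3) \<Phi>_norm_nonneg] by simp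
  finally show "y \<le> \<Phi>_norm" .
qed

end

text \<open>Testing the operator on the constant function \<open>1\<close>, which every automorphism fixes.\<close>

lemma (in ordered_haar_group) integrable_of_hausdorff_bounded:
  assumes "hausdorff_bounded \<nu> r \<mu> \<Phi> A"
  shows "integrable \<mu> \<Phi>"
proof -
  have "\<forall>f\<in>real_hardy \<nu> r. AE x in \<nu>. integrable \<mu> (\<lambda>u. \<Phi> u * f (A u x))"
    using assms unfolding hausdorff_bounded_def by blast
  from bspec[OF this const_in_real_hardy[of 1]] show ?thesis
    by simp
qed

theorem theorem5:
  fixes \<nu> :: "'g::{topological_ab_group_add, t2_space} measure"
    and r :: "(('g \<Rightarrow> complex) \<times> ('g \<Rightarrow> complex)) set"
    and \<mu> :: "'w measure"
    and A :: "'w \<Rightarrow> 'g \<Rightarrow> 'g"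
    and \<Phi> :: "'w \<Rightarrow> real"
  assumes "compact (UNIV :: 'g set)" and "connected (UNIV :: 'g set)"
    and "normalized_haar \<nu>"
    and "group_order r"
    and "A \<in> measurable \<mu> group_aut_borel"
    and "second_countable (euclidean :: 'g topology) \<or> action_measurable \<nu> \<mu> A"
    and "AE u in \<mu>. A u \<in> group_aut_plus r"
    and "locally_integrable \<mu> \<Phi>"
  shows "(hausdorff_bounded \<nu> r \<mu> \<Phi> A \<longleftrightarrow> integrable \<mu> \<Phi>) \<and>
         (hausdorff_bounded \<nu> r \<mu> \<Phi> A \<longrightarrow>
            hausdorff_norm \<nu> r \<mu> \<Phi> A \<le> (\<integral>u. \<bar>\<Phi> u\<bar> \<partial>\<mu>))"
proof -
  interpret ordered_haar_group \<nu> r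
    using assms by unfold_locales
  have joint: "action_measurable \<nu> \<mu> A"
    using assms(6) action_measurable_second_countable[OF assms(1) _ assms(5) sets_haar] by blast
  have op: "hausdorff_operator \<nu> r \<mu> A \<Phi>" if "integrable \<mu> \<Phi>"
    using joint assms that by unfold_locales
  show ?thesis
    using integrable_of_hausdorff_bounded[of \<mu> \<Phi> A] hausdorff_operator.hausdorff_bounded_of_integrable[OF op]
      hausdorff_operator.hausdorff_norm_le[OF op] hausdorff_operator.\<Phi>_norm_def[OF op]
    by metis
qed

end
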